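(* Let $k\geq 2$. For every $c>0$ and every $\gamma>c$ there exists a constant $C>0$ such that the following holds for all sufficiently large $n$. Let $p=p(n)\in[0,1]$ with $p\geq (k+\gamma)\log(n)/n$, let $d:=p(n-k)$, $\gamma_A:=C\sqrt{d}$ and $\gamma_\Delta:=C/\sqrt{d}$. Then with probability at least $1-n^{-c}$ the random complex $X=X^k(n,p)$ satisfies: (i) the largest $\binom{n-1}{k-1}$ eigenvalues of $A_{k-1}(X)$ lie in $[d-\gamma_A,d+\gamma_A]$, and the remaining $\binom{n-1}{k}$ eigenvalues lie in $[-\gamma_A,\gamma_A]$; (ii) $X$ is pure, the smallest $\binom{n-1}{k-1}$ eigenvalues of $\Delta^{\mathrm{up}}_{k-1}(X)$ are $0$, and the remaining $\binom{n-1}{k}$ eigenvalues lie in $[1-\gamma_\Delta,1+\gamma_\Delta]$; in particular $\tilde H^{k-1}(X;\mathbb{R})=0$. Moreover, statement (i) already holds (with probability at least $1-n^{-c}$) under the weaker assumption $p\geq \gamma\log(n)/n$.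
   Context: A simplicial complex $X$ has a linearly ordered vertex set; $X_i$ is its set of $i$-dimensional faces ($(i+1)$-element faces). For $F\in X_i$, $G\in X_{i-1}$ the incidence number is $[F:G]=(-1)^j$ if $G\subseteq F$ and $F\setminus G=\{v_j\}$ where $F=\{v_0<\dots<v_i\}$, and $[F:G]=0$ if $G\not\subseteq F$. For a $k$-dimensional complex, the degree $\deg(F)$ of a face is the number of $k$-faces containing it; $X$ is pure if every maximal face has dimension $k$. $C^{i}(X;\mathbb R)=\mathbb R^{X_i}$, the coboundary map is $(\delta_i f)(H)=\sum_{G\in X_i}[H:G]f(G)$, and $B^{i}(X)=\operatorname{im}\delta_{i-1}$. The generalized adjacency matrix $A_{k-1}(X)$ is the $X_{k-1}\times X_{k-1}$ matrix with $(A_{k-1})_{F,G}=[F:F\cap G]\,[G:F\cap G]$ if $|F\cap G|=k-1$ and $F\cup G\in X_k$, and $0$ otherwise. For pure $X$, with $D_{k-1}$ the diagonal matrix of degrees of $(k-1)$-faces, the normalized up-Laplacian is $\Delta^{\mathrm{up}}_{k-1}(X)=I-D_{k-1}^{-1}A_{k-1}(X)$; it is self-adjoint with respect to $\langle f,g\rangle=\sum_{F\in X_{k-1}}\deg(F)f(F)g(F)$ and has real eigenvalues. The Linial–Meshulam random complex $X^k(n,p)$ has vertex set $[n]$, contains every subset of $[n]$ of size at most $k$ as a face (complete $(k-1)$-skeleton), and contains each $(k+1)$-element subset of $[n]$ as a $k$-face independently with probability $p$. *)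

theory Defs
  imports "HOL-Analysis.Analysis" "HOL-Computational_Algebra.Polynomial"
    "HOL-Combinatorics.Permutations" "HOL-Library.Multiset"
begin

text \<open>Simplicial complexes are sets of faces; faces are finite sets of natural
numbers (vertices, linearly ordered by the order of nat).\<close>

definition faces :: "nat set set \<Rightarrow> nat \<Rightarrow> nat set set" where
  "faces X i = {F \<in> X. card F = i + 1}"

text \<open>Incidence number [F:G]: if G is a subset of F with F - G = {v_j}, where
F = {v_0 < ... < v_i}, then (-1)^j (j = number of vertices of F below v_j);
otherwise 0.\<close>
definition incid :: "nat set \<Rightarrow> nat set \<Rightarrow> real" where
  "incid F G = (if G \<subseteq> F \<and> card (F - G) = 1
      then (-1) ^ card {v \<in> F. v < the_elem (F - G)} else 0)"

definition deg :: "nat set set \<Rightarrow> nat \<Rightarrow> nat set \<Rightarrow> nat" where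
  "deg X k F = card {H \<in> faces X k. F \<subseteq> H}"

definition pure :: "nat set set \<Rightarrow> nat \<Rightarrow> bool" where
  "pure X k \<longleftrightarrow> (\<forall>F\<in>X. (\<forall>H\<in>X. F \<subseteq> H \<longrightarrow> H = F) \<longrightarrow> card F = k + 1)"

definition adj :: "nat set set \<Rightarrow> nat \<Rightarrow> nat set \<Rightarrow> nat set \<Rightarrow> real" where
  "adj X k F G = (if card (F \<inter> G) = k - 1 \<and> F \<union> G \<in> faces X k
      then incid F (F \<inter> G) * incid G (F \<inter> G) else 0)"

definition uplap :: "nat set set \<Rightarrow> nat \<Rightarrow> nat set \<Rightarrow> nat set \<Rightarrow> real" where
  "uplap X k F G = (if F = G then 1 else 0) - adj X k F G / real (deg X k F)"

definition cobound :: "nat set set \<Rightarrow> nat \<Rightarrow> (nat set \<Rightarrow> real) \<Rightarrow> nat set \<Rightarrow> real" where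
  "cobound X i f H = (\<Sum>G\<in>faces X i. incid H G * f G)"

text \<open>Vanishing of the (reduced) real cohomology in degree i+1 (for i \<ge> 0, reduced and
unreduced cohomology agree): every (i+1)-cocycle is a coboundary.\<close>
definition cohom_vanishes :: "nat set set \<Rightarrow> nat \<Rightarrow> bool" where
  "cohom_vanishes X i \<longleftrightarrow>
     (\<forall>f. (\<forall>H\<in>faces X (i + 2). cobound X (i + 1) f H = 0) \<longrightarrow>
          (\<exists>g. \<forall>F\<in>faces X (i + 1). f F = cobound X i g F))"

definition det_on :: "'a set \<Rightarrow> ('a \<Rightarrow> 'a \<Rightarrow> 'b::comm_ring_1) \<Rightarrow> 'b" where
  "det_on S M = (\<Sum>p | p permutes S. of_int (sign p) * (\<Prod>i\<in>S. M i (p i)))"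

definition charpoly :: "'a set \<Rightarrow> ('a \<Rightarrow> 'a \<Rightarrow> real) \<Rightarrow> real poly" where
  "charpoly S M = det_on S (\<lambda>i j. (if i = j then [:0, 1:] else 0) - [:M i j:])"

definition eigs_asc :: "'a set \<Rightarrow> ('a \<Rightarrow> 'a \<Rightarrow> real) \<Rightarrow> real list" where
  "eigs_asc S M = sorted_list_of_multiset (proots (charpoly S M))"

definition eigs_desc :: "'a set \<Rightarrow> ('a \<Rightarrow> 'a \<Rightarrow> real) \<Rightarrow> real list" where
  "eigs_desc S M = rev (eigs_asc S M)"

definition LM_complex :: "nat \<Rightarrow> nat \<Rightarrow> nat set set \<Rightarrow> nat set set" where
  "LM_complex k n S = {F. F \<subseteq> {1..n} \<and> card F \<le> k} \<union> S"

definition LM_cands :: "nat \<Rightarrow> nat \<Rightarrow> nat set set" where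
  "LM_cands k n = {F. F \<subseteq> {1..n} \<and> card F = k + 1}"

definition LM_prob :: "nat \<Rightarrow> nat \<Rightarrow> real \<Rightarrow> (nat set set \<Rightarrow> bool) \<Rightarrow> real" where
  "LM_prob k n p P = (\<Sum>S\<in>Pow (LM_cands k n).
      (if P (LM_complex k n S) then p ^ card S * (1 - p) ^ (card (LM_cands k n) - card S) else 0))"

definition spec_A :: "nat \<Rightarrow> nat \<Rightarrow> real \<Rightarrow> real \<Rightarrow> nat set set \<Rightarrow> bool" where
  "spec_A k n d \<gamma>A X \<longleftrightarrow>
     (let S = faces X (k - 1); ev = eigs_desc S (adj X k) in
      length ev = card S \<and>
      (\<forall>i < ((n - 1) choose (k - 1)). d - \<gamma>A \<le> ev ! i \<and> ev ! i \<le> d + \<gamma>A) \<and>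
      (\<forall>i. ((n - 1) choose (k - 1)) \<le> i \<and> i < ((n - 1) choose (k - 1)) + ((n - 1) choose k) \<longrightarrow>
           - \<gamma>A \<le> ev ! i \<and> ev ! i \<le> \<gamma>A))"

definition spec_L :: "nat \<Rightarrow> nat \<Rightarrow> real \<Rightarrow> nat set set \<Rightarrow> bool" where
  "spec_L k n \<gamma>D X \<longleftrightarrow>
     pure X k \<and>
     (let S = faces X (k - 1); ev = eigs_asc S (uplap X k) in
      length ev = card S \<and>
      (\<forall>i < ((n - 1) choose (k - 1)). ev ! i = 0) \<and>
      (\<forall>i. ((n - 1) choose (k - 1)) \<le> i \<and> i < ((n - 1) choose (k - 1)) + ((n - 1) choose k) \<longrightarrow>
           1 - \<gamma>D \<le> ev ! i \<and> ev ! i \<le> 1 + \<gamma>D)) \<and>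
     cohom_vanishes X (k - 2)"

end

theory Submission
  imports Defs "Jordan_Normal_Form.Char_Poly"
begin

text \<open>
  Write \<open>A\<close> for the adjacency matrix of the random complex and \<open>K\<close> for that of the complete one.
  Since \<open>K = \<delta>\<delta>\<^sup>* - k = (n - k) - \<delta>\<^sup>*\<delta>\<close>, the matrix \<open>pK\<close> has eigenvalue \<open>d\<close> on coboundaries
  and \<open>-pk\<close> on cycles, so (i) follows from \<open>\<parallel>A - pK\<parallel> = O(\<surd>d)\<close>. The quadratic form of \<open>A - pK\<close> is a sum
  over the \<open>(k-2)\<close>-faces of the forms of centred adjacency matrices of binomial random graphs (the
  links), and it suffices to bound the norm of one of these by a union bound.

  The norm of a link matrix is bounded by the trace of a power of order \<open>2q\<close> with \<open>q\<close> comparable to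
  \<open>pn\<close>. Only closed walks using every edge at least twice contribute, each with at most
  \<open>p\<close> to the number of its edges, hence at most \<open>p\<close> to the number of its vertices minus one. The
  sum of \<open>p\<close> to the number of vertices is the expected number of such walks inside a \<open>p\<close>-random
  vertex set \<open>R\<close>, and the number of such walks in a fixed \<open>R\<close> is at most the expected trace of a dense
  random matrix on \<open>R\<close> with bounded centred entries whose higher moments are all at least \<open>1\<close>. The
  norm of the latter is controlled by a grid net and exponential moments.

  For (ii), a coboundary \<open>b\<close> satisfies \<open>Ab = Db\<close> exactly and \<open>Ab = db + O(\<surd>d)\<close>. Hence a cochain that
  is orthogonal to the coboundaries for the degree-weighted inner product is nearly orthogonal to
  them for the unweighted one, and only a lower bound on the degrees, by a Chernoff estimate, is
  needed to pass from \<open>A\<close> to the normalized Laplacian.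
\<close>

section \<open>Eigenvalues of symmetric matrices on finite index sets\<close>

text \<open>A net argument applied directly to a link matrix would lose: a centred entry has
  variance at most p, but for small p its tails are far from subgaussian at the scale sqrt p. For
  the dense comparison matrix this obstacle is absent, and a net costs only a factor exponential in
  the size of the vertex set R. Averaging over a p-random R turns that factor into exp (K1 * p * n).
  This dictates the exponent: q >= p * n lets the factor be absorbed into the q-th power of a
  constant; q >= ln n makes a surplus exp (-b) in that constant worth n^(-b); q = O(p * n) keeps the
  norm bound, which is of order sqrt q, at the order sqrt d. The three demands are compatible
  because p * n is at least gamma * ln n. The union bound over the links and the division by the
  spare factor p together cost at most n^k, which b absorbs. Near the threshold (k + gamma) * ln n /
  n the smallest degree may be only a small fraction of d. The degrees are therefore bounded below
  by epsilon * d, with epsilon depending on the distance of gamma from c.\<close>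

definition ip :: "'a set \<Rightarrow> ('a \<Rightarrow> real) \<Rightarrow> ('a \<Rightarrow> real) \<Rightarrow> real" where
  "ip S f g = (\<Sum>x\<in>S. f x * g x)"

definition bil :: "'a set \<Rightarrow> ('a \<Rightarrow> 'a \<Rightarrow> real) \<Rightarrow> ('a \<Rightarrow> real) \<Rightarrow> ('a \<Rightarrow> real) \<Rightarrow> real" where
  "bil S M f g = (\<Sum>x\<in>S. \<Sum>y\<in>S. M x y * f x * g y)"

text \<open>Eigenvectors are labelled by \<open>S\<close> itself, which builds in that there are
  \<open>card S\<close> of them; orthonormality then makes them a basis.\<close>

definition eigensystem ::
    "'a set \<Rightarrow> ('a \<Rightarrow> 'a \<Rightarrow> real) \<Rightarrow> ('a \<Rightarrow> 'a \<Rightarrow> real) \<Rightarrow> ('a \<Rightarrow> real) \<Rightarrow> bool" where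
  "eigensystem S M v lam \<longleftrightarrow>
     (\<forall>i\<in>S. \<forall>j\<in>S. ip S (v i) (v j) = (if i = j then 1 else 0)) \<and>
     (\<forall>i\<in>S. \<forall>x\<in>S. (\<Sum>y\<in>S. M x y * v i y) = lam i * v i x)"

lemma ip_commute: "ip S f g = ip S g f"
  by (simp add: ip_def mult.commute)

lemma ip_self_nonneg: "0 \<le> ip S f f"
  by (simp add: ip_def sum_nonneg)

lemma ip_self_eq_0_iff: "finite S \<Longrightarrow> ip S f f = 0 \<longleftrightarrow> (\<forall>x\<in>S. f x = 0)"
  by (simp add: ip_def sum_nonneg_eq_0_iff)

lemma ip_add_scaled: "ip S (\<lambda>x. f x + t * g x) h = ip S f h + t * ip S g h"
  by (simp add: ip_def sum.distrib sum_distrib_left algebra_simps)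

lemma ip_add_scaled_right: "ip S h (\<lambda>x. f x + t * g x) = ip S h f + t * ip S h g"
  by (simp add: ip_commute[of S h] ip_add_scaled)

lemma bil_eq_ip: "bil S M f g = ip S f (\<lambda>x. \<Sum>y\<in>S. M x y * g y)"
  by (simp add: bil_def ip_def sum_distrib_left mult_ac)

lemma bil_add_scaled_left: "bil S M (\<lambda>x. f x + t * g x) h = bil S M f h + t * bil S M g h"
  by (simp add: bil_eq_ip ip_add_scaled)

lemma bil_add_scaled_right: "bil S M h (\<lambda>x. f x + t * g x) = bil S M h f + t * bil S M h g"
  by (simp add: bil_def distrib_left sum.distrib sum_distrib_left mult_ac)

lemma bil_commute:
  assumes "\<And>x y. x \<in> S \<Longrightarrow> y \<in> S \<Longrightarrow> M x y = M y x"
  shows "bil S M f g = bil S M g f"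
proof -
  have "bil S M f g = (\<Sum>y\<in>S. \<Sum>x\<in>S. M x y * f x * g y)"
    unfolding bil_def by (rule sum.swap)
  also have "\<dots> = bil S M g f"
    unfolding bil_def by (intro sum.cong refl) (simp add: assms)
  finally show ?thesis .
qed

text \<open>Gaussian elimination. It stands in for dimension counts and intersections of subspaces
  in the min-max arguments and in the proof that cohomology vanishes.\<close>

lemma homogeneous_system_nontrivial:
  fixes a :: "'b \<Rightarrow> 'a \<Rightarrow> real"
  assumes "finite J" "finite I" "card J < card I"
  shows "\<exists>x. (\<exists>i\<in>I. x i \<noteq> 0) \<and> (\<forall>j\<in>J. (\<Sum>i\<in>I. a j i * x i) = 0)"
  using assms
proof (induction J arbitrary: I a rule: finite_induct)
  case empty
  then show ?case by (intro exI[of _ "\<lambda>_. 1"]) (auto simp: card_gt_0_iff)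
next
  case (insert j J)
  show ?case
  proof (cases "\<forall>i\<in>I. a j i = 0")
    case True
    have "card J < card I" using insert by simp
    from insert.IH[OF insert.prems(1) this, of a] obtain x where
      "\<exists>i\<in>I. x i \<noteq> 0" "\<forall>j\<in>J. (\<Sum>i\<in>I. a j i * x i) = 0" by blast
    with True show ?thesis by (intro exI[of _ x]) auto
  next
    case False
    \<comment> \<open>The pivot \<open>k\<close> is eliminated from the remaining equations by means
      of equation \<open>j\<close>; \<open>y\<close> below is the back substitution.\<close>
    then obtain k where k: "k \<in> I" "a j k \<noteq> 0" by blast
    define I' where "I' = I - {k}"
    have I': "finite I'" "k \<notin> I'" "I = insert k I'" "card J < card I'"
      using insert k by (auto simp: I'_def card_Diff_singleton)
    from insert.IH[OF I'(1,4), of "\<lambda>l i. a l i - a l k * a j i / a j k"] obtain x where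
      x: "\<exists>i\<in>I'. x i \<noteq> 0" "\<forall>l\<in>J. (\<Sum>i\<in>I'. (a l i - a l k * a j i / a j k) * x i) = 0"
      by blast
    define y where "y = x(k := - (\<Sum>i\<in>I'. a j i * x i) / a j k)"
    have yI: "(\<Sum>i\<in>I'. c i * y i) = (\<Sum>i\<in>I'. c i * x i)" for c :: "'a \<Rightarrow> real"
      by (intro sum.cong) (use I' in \<open>auto simp: y_def\<close>)
    have *: "(\<Sum>i\<in>I. c i * y i) = c k * y k + (\<Sum>i\<in>I'. c i * x i)" for c :: "'a \<Rightarrow> real"
      using I' yI[of c] by simp
    have "(\<Sum>i\<in>I. a l i * y i) = 0" if "l \<in> J" for l
    proof -
      have "0 = (\<Sum>i\<in>I'. a l i * x i - (a l k / a j k) * (a j i * x i))"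
        using x(2)[rule_format, OF that] by (simp add: left_diff_distrib mult.assoc)
      also have "\<dots> = (\<Sum>i\<in>I'. a l i * x i) - (a l k / a j k) * (\<Sum>i\<in>I'. a j i * x i)"
        by (simp add: sum_subtractf sum_distrib_left)
      also have "\<dots> = (\<Sum>i\<in>I. a l i * y i)"
        unfolding * by (simp add: y_def)
      finally show ?thesis by simp
    qed
    moreover have "(\<Sum>i\<in>I. a j i * y i) = 0"
      unfolding * using k by (simp add: y_def)
    moreover have "\<exists>i\<in>I. y i \<noteq> 0" using x(1) I' by (auto simp: y_def)
    ultimately show ?thesis by (intro exI[of _ y]) auto
  qed
qed

text \<open>First-order condition at a maximum: for small \<open>t > 0\<close> a positive linear
  term would beat the quadratic one.\<close>

lemma linear_coefficient_zero:
  fixes a b :: real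
  assumes "a \<ge> 0" "\<And>t. 2 * t * a + t\<^sup>2 * b \<le> 0"
  shows "a = 0"
proof (rule ccontr)
  assume "a \<noteq> 0"
  with assms have a: "a > 0" by simp
  define t where "t = a / (\<bar>b\<bar> + 1)"
  have t: "t > 0" "t * (\<bar>b\<bar> + 1) = a" using a by (auto simp: t_def)
  have "t * (- \<bar>b\<bar>) \<le> t * b" using t by (intro mult_left_mono) auto
  moreover have "t * \<bar>b\<bar> + t = a" using t(2) by (simp add: distrib_left)
  ultimately have "2 * a + t * b > 0" using a t(1) by simp
  then have "t * (2 * a + t * b) > 0" using t by simp
  then show False using assms(2)[of t] by (simp add: power2_eq_square algebra_simps)
qed

text \<open>A maximiser \<open>x\<close> of the quadratic form on the unit sphere of the complement
  is an eigenvector. By symmetry the residual \<open>r\<close> is again orthogonal to all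
  \<open>w j\<close>, so \<open>x\<close> may be varied in the direction \<open>r\<close>, and the
  first-order condition forces \<open>r\<close> to vanish.\<close>

lemma eigenvector_in_complement:
  fixes M :: "'a \<Rightarrow> 'a \<Rightarrow> real" and w :: "'b \<Rightarrow> 'a \<Rightarrow> real"
  assumes fin: "finite S" and sym: "\<And>x y. x \<in> S \<Longrightarrow> y \<in> S \<Longrightarrow> M x y = M y x"
    and J: "finite J" "card J < card S"
    and eig: "\<And>j x. j \<in> J \<Longrightarrow> x \<in> S \<Longrightarrow> (\<Sum>y\<in>S. M x y * w j y) = mu j * w j x"
  obtains x l where "ip S x x = 1" "\<forall>j\<in>J. ip S (w j) x = 0"
    "\<forall>a\<in>S. (\<Sum>y\<in>S. M a y * x y) = l * x a"
proof -
  \<comment> \<open>Coordinates outside \<open>S\<close> are pinned to 0; otherwise the sphere would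
    not be compact in the full function space.\<close>
  define K where "K = {x. (\<forall>i. i \<notin> S \<longrightarrow> x i = 0) \<and> ip S x x = 1 \<and> (\<forall>j\<in>J. ip S (w j) x = 0)}"
  define box :: "('a \<Rightarrow> real) set" where "box = PiE UNIV (\<lambda>i. if i \<in> S then {-1..1} else {0})"
  have cont: "continuous_on A (\<lambda>x. x i)" for A and i :: 'a
    by (rule continuous_on_subset[OF continuous_on_product_coordinates]) simp
  have "compact box"
    unfolding box_def compactin_euclidean_iff[symmetric] euclidean_product_topology[symmetric]
    by (subst compactin_PiE) auto
  moreover have "closed {x. ip S x x = 1 \<and> (\<forall>j\<in>J. ip S (w j) x = 0)}"
  proof -
    have "closed {x. ip S x x = 1}"
      unfolding ip_def by (intro closed_Collect_eq continuous_on_sum continuous_on_mult cont continuous_on_const)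
    moreover have "closed {x. ip S (w j) x = 0}" for j
      unfolding ip_def by (intro closed_Collect_eq continuous_on_sum continuous_on_mult cont continuous_on_const)
    moreover have "{x. ip S x x = 1 \<and> (\<forall>j\<in>J. ip S (w j) x = 0)} =
        {x. ip S x x = 1} \<inter> (\<Inter>j\<in>J. {x. ip S (w j) x = 0})" by auto
    ultimately show ?thesis by (simp add: closed_INT closed_Int)
  qed
  ultimately have "compact (box \<inter> {x. ip S x x = 1 \<and> (\<forall>j\<in>J. ip S (w j) x = 0)})"
    by (rule compact_Int_closed)
  also have "box \<inter> {x. ip S x x = 1 \<and> (\<forall>j\<in>J. ip S (w j) x = 0)} = K"
  proof -
    have "\<bar>x i\<bar> \<le> 1" if "ip S x x = 1" "i \<in> S" for x i
    proof -
      have "x i * x i \<le> ip S x x"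
        unfolding ip_def using that fin by (intro member_le_sum) auto
      then have "(x i)\<^sup>2 \<le> 1\<^sup>2" using that by (simp add: power2_eq_square)
      then show ?thesis by (simp add: abs_square_le_1)
    qed
    then show ?thesis
      by (auto simp: K_def box_def PiE_iff abs_le_iff split: if_splits)
  qed
  finally have "compact K" .
  moreover have "K \<noteq> {}"
  proof -
    obtain x where x: "\<exists>i\<in>S. x i \<noteq> 0" "\<forall>j\<in>J. (\<Sum>i\<in>S. w j i * x i) = 0"
      using homogeneous_system_nontrivial[OF J(1) fin J(2)] by blast
    define n where "n = sqrt (ip S x x)"
    have "ip S x x \<noteq> 0" using x(1) fin by (simp add: ip_self_eq_0_iff)
    then have n: "n * n = ip S x x" "n \<noteq> 0" using ip_self_nonneg[of S x] by (auto simp: n_def)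
    define y where "y = (\<lambda>i. if i \<in> S then x i / n else 0)"
    have "ip S y y = ip S x x / (n * n)"
      by (simp add: ip_def y_def sum_divide_distrib)
    moreover have "ip S (w j) y = ip S (w j) x / n" for j
      by (simp add: ip_def y_def sum_divide_distrib)
    ultimately have "y \<in> K" using n x(2) by (auto simp: K_def y_def ip_def)
    then show ?thesis by blast
  qed
  moreover have "continuous_on K (\<lambda>x. bil S M x x)"
    unfolding bil_def by (intro continuous_on_sum continuous_on_mult cont continuous_on_const)
  ultimately obtain x where x: "x \<in> K" "\<forall>y\<in>K. bil S M y y \<le> bil S M x x"
    using continuous_attains_sup by blast
  define l where "l = bil S M x x"
  have le: "bil S M y y \<le> l * ip S y y" if y: "\<forall>j\<in>J. ip S (w j) y = 0" for y
  proof (cases "ip S y y = 0")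
    case True
    then have "\<forall>x\<in>S. y x = 0" using fin by (simp add: ip_self_eq_0_iff)
    then show ?thesis by (simp add: bil_def ip_def)
  next
    case False
    define n where "n = sqrt (ip S y y)"
    have n: "n * n = ip S y y" "n \<noteq> 0" using False ip_self_nonneg[of S y] by (auto simp: n_def)
    define z where "z = (\<lambda>i. if i \<in> S then y i / n else 0)"
    have "ip S z z = ip S y y / (n * n)"
      by (simp add: ip_def z_def sum_divide_distrib)
    moreover have "ip S (w j) z = ip S (w j) y / n" for j
      by (simp add: ip_def z_def sum_divide_distrib)
    ultimately have "z \<in> K" using n y by (auto simp: K_def z_def)
    then have "bil S M z z \<le> l" using x l_def by blast
    moreover have "bil S M z z = bil S M y y / (n * n)"
      by (simp add: bil_def z_def sum_divide_distrib)
    ultimately have "bil S M y y / ip S y y \<le> l" by (simp add: n)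
    then show ?thesis using False ip_self_nonneg[of S y] by (simp add: divide_simps split: if_splits)
  qed
  define r where "r = (\<lambda>a. (\<Sum>y\<in>S. M a y * x y) - l * x a)"
  have xK: "ip S x x = 1" "\<And>j. j \<in> J \<Longrightarrow> ip S (w j) x = 0" using x(1) by (auto simp: K_def)
  have rw: "ip S (w j) r = 0" if "j \<in> J" for j
  proof -
    have "ip S (w j) r = bil S M (w j) x - l * ip S (w j) x"
      unfolding bil_eq_ip by (simp add: r_def ip_def algebra_simps sum_subtractf sum_distrib_left)
    also have "bil S M (w j) x = bil S M x (w j)" using sym by (rule bil_commute)
    also have "\<dots> = ip S x (\<lambda>a. mu j * w j a)"
      unfolding bil_eq_ip ip_def using that by (intro sum.cong) (auto simp: eig)
    also have "\<dots> = mu j * ip S (w j) x" by (simp add: ip_def sum_distrib_left mult_ac)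
    finally show ?thesis using xK that by simp
  qed
  have Mx: "bil S M r x = ip S r r + l * ip S r x"
  proof -
    have "bil S M r x = ip S r (\<lambda>a. r a + l * x a)" unfolding bil_eq_ip by (simp add: r_def)
    also have "\<dots> = ip S r r + l * ip S r x"
      by (simp add: ip_def distrib_left sum.distrib sum_distrib_left mult_ac)
    finally show ?thesis .
  qed
  \<comment> \<open>The maximality of \<open>l\<close> evaluated at \<open>x + t * r\<close>; the
    linear coefficient is twice the squared norm of the residual.\<close>
  have "2 * t * ip S r r + t\<^sup>2 * (bil S M r r - l * ip S r r) \<le> 0" for t
  proof -
    have "ip S (w j) (\<lambda>a. x a + t * r a) = 0" if "j \<in> J" for j
      using rw[OF that] xK(2)[OF that] by (simp add: ip_add_scaled_right)
    then have "bil S M (\<lambda>a. x a + t * r a) (\<lambda>a. x a + t * r a)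
        \<le> l * ip S (\<lambda>a. x a + t * r a) (\<lambda>a. x a + t * r a)" by (intro le) auto
    moreover have "bil S M (\<lambda>a. x a + t * r a) (\<lambda>a. x a + t * r a) =
      bil S M x x + t * bil S M x r + t * bil S M r x + t\<^sup>2 * bil S M r r"
      by (simp add: bil_add_scaled_left bil_add_scaled_right power2_eq_square algebra_simps)
    moreover have "bil S M x r = bil S M r x" using sym by (rule bil_commute)
    moreover have "ip S (\<lambda>a. x a + t * r a) (\<lambda>a. x a + t * r a) =
      ip S x x + 2 * t * ip S r x + t\<^sup>2 * ip S r r"
      using ip_commute[of S x r] by (simp add: ip_add_scaled ip_add_scaled_right power2_eq_square algebra_simps)
    ultimately show ?thesis using Mx xK l_def by (simp add: algebra_simps)
  qed
  then have "ip S r r = 0" using ip_self_nonneg by (intro linear_coefficient_zero) auto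
  then have "\<forall>a\<in>S. r a = 0" using fin by (simp add: ip_self_eq_0_iff)
  then show thesis using xK by (intro that[of x l]) (auto simp: r_def)
qed

text \<open>Eigenvectors are added one at a time: as long as the labels \<open>T\<close> do not
  exhaust \<open>S\<close>, the previous lemma yields another one orthogonal to those already
  found.\<close>

lemma symmetric_eigensystem:
  fixes M :: "'a \<Rightarrow> 'a \<Rightarrow> real"
  assumes fin: "finite S" and sym: "\<And>x y. x \<in> S \<Longrightarrow> y \<in> S \<Longrightarrow> M x y = M y x"
  obtains v lam where "eigensystem S M v lam"
proof -
  have "\<exists>v lam. (\<forall>i\<in>T. \<forall>j\<in>T. ip S (v i) (v j) = (if i = j then 1 else 0)) \<and>
     (\<forall>i\<in>T. \<forall>x\<in>S. (\<Sum>y\<in>S. M x y * v i y) = lam i * v i x)" if "T \<subseteq> S" for T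
  proof -
    from that fin have "finite T" by (rule finite_subset)
    then show ?thesis using that
    proof (induction T rule: finite_induct)
      case (insert k T)
      then have "T \<subseteq> S" by simp
      from insert.IH[OF this] obtain v lam where
        "(\<forall>i\<in>T. \<forall>j\<in>T. ip S (v i) (v j) = (if i = j then 1 else 0)) \<and>
         (\<forall>i\<in>T. \<forall>x\<in>S. (\<Sum>y\<in>S. M x y * v i y) = lam i * v i x)"
        by (elim exE)
      then have v: "\<And>i j. i \<in> T \<Longrightarrow> j \<in> T \<Longrightarrow> ip S (v i) (v j) = (if i = j then 1 else 0)"
        "\<And>i x. i \<in> T \<Longrightarrow> x \<in> S \<Longrightarrow> (\<Sum>y\<in>S. M x y * v i y) = lam i * v i x"
        by blast+
      have cT: "card T < card S" using insert.hyps insert.prems fin by (intro psubset_card_mono) auto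
      obtain x l where x: "ip S x x = 1" "\<forall>j\<in>T. ip S (v j) x = 0"
        "\<forall>a\<in>S. (\<Sum>y\<in>S. M a y * x y) = l * x a"
        by (rule eigenvector_in_complement[OF fin sym \<open>finite T\<close> cT v(2)])
      have x': "\<forall>j\<in>T. ip S x (v j) = 0" using x(2) by (subst ip_commute)
      show ?case
      proof (intro exI[of _ "v(k := x)"] exI[of _ "lam(k := l)"] conjI ballI)
        fix i j assume "i \<in> insert k T" "j \<in> insert k T"
        then show "ip S ((v(k := x)) i) ((v(k := x)) j) = (if i = j then 1 else 0)"
          using v(1) x(1,2) x' insert.hyps(2) by (cases "i = k"; cases "j = k") auto
      next
        fix i a assume "i \<in> insert k T" "a \<in> S"
        then show "(\<Sum>y\<in>S. M a y * (v(k := x)) i y) = (lam(k := l)) i * (v(k := x)) i a"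
          using v(2) x(3) by (cases "i = k") simp_all
      qed
    qed auto
  qed
  from this[OF order_refl] obtain v lam where "eigensystem S M v lam"
    unfolding eigensystem_def by (elim exE)
  then show thesis by (rule that)
qed

section \<open>Characteristic polynomials and sorted lists of eigenvalues\<close>

lemma det_on_eq_det:
  fixes M :: "'a \<Rightarrow> 'a \<Rightarrow> 'b :: comm_ring_1"
  assumes f: "bij_betw f {0..<n} S"
  shows "det_on S M = det (mat n n (\<lambda>(i, j). M (f i) (f j)))"
proof -
  define g where "g = inv_into {0..<n} f"
  have g: "bij_betw g S {0..<n}" "\<And>x. x \<in> S \<Longrightarrow> f (g x) = x" "\<And>i. i < n \<Longrightarrow> g (f i) = i"
    using f by (auto simp: g_def bij_betw_inv_into bij_betw_inv_into_right bij_betw_inv_into_left)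
  have "det_on S M = (\<Sum>p | p permutes {0..<n}. of_int (sign p) * (\<Prod>i\<in>{0..<n}. M (f i) (f (p i))))"
    unfolding det_on_def
  proof (rule sum.reindex_bij_witness[of _ "map_permutation {0..<n} f" "map_permutation S g"])
    fix p assume "p \<in> {p. p permutes S}"
    then have p: "p permutes S" by simp
    show "map_permutation {0..<n} f (map_permutation S g p) = p"
      by (rule map_permutation_compose_inv) (use g p in auto)
    show mp: "map_permutation S g p \<in> {p. p permutes {0..<n}}"
      using map_permutation_permutes[OF g(1) p] by simp
    have "finite S" using f bij_betw_finite by blast
    then have "sign (map_permutation S g p) = sign p"
      using g p by (intro sign_map_permutation) (auto simp: bij_betw_def)
    moreover have "(\<Prod>i\<in>{0..<n}. M (f i) (f (map_permutation S g p i))) = (\<Prod>x\<in>S. M x (p x))"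
    proof (rule prod.reindex_bij_witness[of _ g f])
      fix i assume i: "i \<in> {0..<n}"
      then have fi: "f i \<in> S" using f by (auto simp: bij_betw_def)
      have "map_permutation S g p (g (f i)) = g (p (f i))"
        using g fi by (intro map_permutation_apply) (auto simp: bij_betw_def)
      then show "M (f i) (p (f i)) = M (f i) (f (map_permutation S g p i))"
        using g i fi permutes_in_image[OF p] by simp
    qed (use f g in \<open>auto simp: bij_betw_def\<close>)
    ultimately show "of_int (sign (map_permutation S g p)) *
        (\<Prod>i\<in>{0..<n}. M (f i) (f (map_permutation S g p i))) = of_int (sign p) * (\<Prod>i\<in>S. M i (p i))"
      by simp
  next
    fix p assume "p \<in> {p. p permutes {0..<n}}"
    then have p: "p permutes {0..<n}" by simp
    show "map_permutation S g (map_permutation {0..<n} f p) = p"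
      by (rule map_permutation_compose_inv) (use f g p in auto)
    show "map_permutation {0..<n} f p \<in> {p. p permutes S}"
      using map_permutation_permutes[OF f p] by simp
  qed
  also have "\<dots> = det (mat n n (\<lambda>(i, j). M (f i) (f j)))"
    unfolding Determinant.det_def
    by (auto intro!: sum.cong prod.cong simp: sign_def permutes_in_image[of _ "{0..<n}", simplified])
  finally show ?thesis .
qed

text \<open>Let \<open>P\<close> have the eigenvectors as columns and let \<open>Q\<close> be its
  transpose. Orthonormality is \<open>Q * P = 1\<close>, so \<open>P * Q = 1\<close>, which is
  completeness, and \<open>A = P * D * Q\<close> is similar to a diagonal matrix.\<close>

lemma eigensystem_charpoly:
  assumes fin: "finite S" and E: "eigensystem S M v lam"
  shows "charpoly S M = (\<Prod>i\<in>S. [:- lam i, 1:])"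
    and eigensystem_complete:
      "\<And>x y. x \<in> S \<Longrightarrow> y \<in> S \<Longrightarrow> (\<Sum>i\<in>S. v i x * v i y) = (if x = y then 1 else 0)"
proof -
  define n where "n = card S"
  obtain f where f: "bij_betw f {0..<n} S" using ex_bij_betw_nat_finite[OF fin] n_def by blast
  have fS: "f i \<in> S" if "i < n" for i using f that by (auto simp: bij_betw_def)
  have feq: "f i = f j \<longleftrightarrow> i = j" if "i < n" "j < n" for i j
    using f that by (auto simp: bij_betw_def inj_on_def)
  have sumf: "(\<Sum>i = 0..<n. h (f i)) = (\<Sum>x\<in>S. h x)" for h :: "'a \<Rightarrow> real"
    using f by (rule sum.reindex_bij_betw)
  define A where "A = mat n n (\<lambda>(i, j). M (f i) (f j))"
  define P where "P = mat n n (\<lambda>(i, j). v (f j) (f i))"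
  define Q where "Q = mat n n (\<lambda>(i, j). v (f i) (f j))"
  define D where "D = mat n n (\<lambda>(i, j). if i = j then lam (f i) else 0)"
  have car: "A \<in> carrier_mat n n" "P \<in> carrier_mat n n" "Q \<in> carrier_mat n n" "D \<in> carrier_mat n n"
    by (auto simp: A_def P_def Q_def D_def)
  have "Q * P = 1\<^sub>m n"
  proof (rule eq_matI)
    fix i j assume "i < dim_row (1\<^sub>m n :: real mat)" "j < dim_col (1\<^sub>m n :: real mat)"
    then have ij: "i < n" "j < n" by auto
    then have "(Q * P) $$ (i, j) = (\<Sum>l = 0..<n. v (f i) (f l) * v (f j) (f l))"
      by (simp add: Q_def P_def scalar_prod_def)
    also have "\<dots> = ip S (v (f i)) (v (f j))" unfolding ip_def by (rule sumf)
    finally show "(Q * P) $$ (i, j) = 1\<^sub>m n $$ (i, j)"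
      using E fS ij feq by (auto simp: eigensystem_def)
  qed (auto simp: Q_def P_def)
  then have PQ: "P * Q = 1\<^sub>m n" "Q * P = 1\<^sub>m n"
    using mat_mult_left_right_inverse[OF car(3,2)] by auto
  show "(\<Sum>i\<in>S. v i x * v i y) = (if x = y then 1 else 0)" if "x \<in> S" "y \<in> S" for x y
  proof -
    have "x \<in> f ` {0..<n}" "y \<in> f ` {0..<n}" using f that by (simp_all add: bij_betw_def)
    then obtain i j where ij: "i < n" "j < n" "x = f i" "y = f j" by auto
    have "(\<Sum>i\<in>S. v i x * v i y) = (\<Sum>l = 0..<n. v (f l) x * v (f l) y)" by (rule sumf[symmetric])
    also have "\<dots> = (P * Q) $$ (i, j)" using ij by (simp add: Q_def P_def scalar_prod_def)
    finally show ?thesis using ij feq PQ by simp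
  qed
  have AP: "A * P = P * D"
  proof (rule eq_matI)
    fix i j assume "i < dim_row (P * D)" "j < dim_col (P * D)"
    then have ij: "i < n" "j < n" by (auto simp: P_def D_def)
    then have "(A * P) $$ (i, j) = (\<Sum>l = 0..<n. M (f i) (f l) * v (f j) (f l))"
      by (simp add: A_def P_def scalar_prod_def)
    also have "\<dots> = (\<Sum>y\<in>S. M (f i) y * v (f j) y)" by (rule sumf)
    also have "\<dots> = lam (f j) * v (f j) (f i)" using E fS ij by (simp add: eigensystem_def)
    also have "\<dots> = (P * D) $$ (i, j)"
      using ij by (simp add: P_def D_def scalar_prod_def if_distrib[of "\<lambda>x. _ * x"] cong: if_cong)
    finally show "(A * P) $$ (i, j) = (P * D) $$ (i, j)" .
  qed (auto simp: A_def P_def D_def)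
  have "A = A * (P * Q)" using PQ car by simp
  also have "\<dots> = P * D * Q" using AP car by (simp flip: assoc_mult_mat[of A n n P n Q n])
  finally have "similar_mat A D" by (intro similar_matI[OF _ PQ]) (use car in auto)
  have "charpoly S M = char_poly A"
    unfolding charpoly_def det_on_eq_det[OF f] char_poly_def char_poly_matrix_def
    by (rule arg_cong[of _ _ det], rule eq_matI) (auto simp: A_def feq)
  also have "\<dots> = char_poly D" using \<open>similar_mat A D\<close> by (rule char_poly_similar)
  also have "\<dots> = (\<Prod>a \<leftarrow> diag_mat D. [:- a, 1:])"
    by (rule char_poly_upper_triangular[OF car(4)]) (auto simp: D_def upper_triangular_def)
  also have "diag_mat D = map (\<lambda>i. lam (f i)) [0..<n]"
    unfolding diag_mat_def by (simp add: D_def)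
  also have "(\<Prod>a \<leftarrow> map (\<lambda>i. lam (f i)) [0..<n]. [:- a, 1:]) = (\<Prod>i = 0..<n. [:- lam (f i), 1:])"
    using prod.distinct_set_conv_list[of "[0..<n]" "\<lambda>i. [:- lam (f i), 1:]"] by (simp add: o_def)
  also have "\<dots> = (\<Prod>i\<in>S. [:- lam i, 1:])" using f by (rule prod.reindex_bij_betw)
  finally show "charpoly S M = (\<Prod>i\<in>S. [:- lam i, 1:])" .
qed

lemma eigensystem_uminus:
  "eigensystem S M v lam \<Longrightarrow> eigensystem S (\<lambda>x y. - M x y) v (\<lambda>i. - lam i)"
  by (simp add: eigensystem_def sum_negf)

lemma bil_uminus: "bil S (\<lambda>x y. - M x y) f g = - bil S M f g"
  by (simp add: bil_def sum_negf)

lemma eigs_asc_eigensystem: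
  assumes "finite S" "eigensystem S M v lam"
  shows "eigs_asc S M = sorted_list_of_multiset (image_mset lam (mset_set S))"
proof -
  have "proots (charpoly S M) = (\<Sum>i\<in>S. {#lam i#})"
    using assms by (simp add: eigensystem_charpoly proots_prod)
  also have "\<dots> = image_mset lam (mset_set S)"
    using assms(1) by (induction S rule: finite_induct) auto
  finally show ?thesis by (simp add: eigs_asc_def)
qed

lemma length_eigs_asc:
  assumes "finite S" "eigensystem S M v lam"
  shows "length (eigs_asc S M) = card S"
  using assms by (simp add: eigs_asc_eigensystem size_mset[symmetric] del: size_mset)

lemma length_filter_eigs_asc:
  assumes "finite S" "eigensystem S M v lam"
  shows "length (filter P (eigs_asc S M)) = card {i \<in> S. P (lam i)}"
proof -
  have "length (filter P (eigs_asc S M)) = size (filter_mset P (mset (eigs_asc S M)))"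
    by (simp flip: mset_filter)
  also have "\<dots> = size (image_mset lam (filter_mset (\<lambda>i. P (lam i)) (mset_set S)))"
    using assms by (simp add: eigs_asc_eigensystem filter_mset_image_mset)
  also have "\<dots> = card {i \<in> S. P (lam i)}" using assms(1) by (simp add: filter_mset_mset_set)
  finally show ?thesis .
qed

text \<open>An entry above \<open>\<beta>\<close> at position \<open>i\<close> would put all later
  entries above \<open>\<beta>\<close> as well, giving \<open>card S - i\<close> such eigenvalues,
  more than \<open>c\<close> allows. Together with \<open>eigs_asc_ge\<close> this turns eigenvalue
  counts into bounds at positions of the list.\<close>

lemma eigs_asc_le:
  assumes S: "finite S" "eigensystem S M v lam"
    and c: "card {i \<in> S. lam i > \<beta>} + m \<le> card S" and i: "i < m"
  shows "eigs_asc S M ! i \<le> \<beta>"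
proof (rule ccontr)
  let ?xs = "eigs_asc S M"
  assume "\<not> ?xs ! i \<le> \<beta>"
  then have gt: "?xs ! i > \<beta>" by simp
  have len: "length ?xs = card S" using S by (rule length_eigs_asc)
  have sorted: "sorted ?xs" by (simp add: eigs_asc_def)
  have "\<forall>x\<in>set (drop i ?xs). x > \<beta>"
  proof
    fix x assume "x \<in> set (drop i ?xs)"
    then obtain j where "j < length ?xs - i" "x = ?xs ! (i + j)" by (auto simp: in_set_conv_nth)
    then have "?xs ! i \<le> x" using sorted_nth_mono[OF sorted, of i "i + j"] by (simp add: less_diff_conv add.commute)
    then show "x > \<beta>" using gt by simp
  qed
  then have "filter (\<lambda>x. x > \<beta>) (drop i ?xs) = drop i ?xs" by simp
  moreover have "length (filter (\<lambda>x. x > \<beta>) ?xs) =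
      length (filter (\<lambda>x. x > \<beta>) (take i ?xs)) + length (filter (\<lambda>x. x > \<beta>) (drop i ?xs))"
    by (metis append_take_drop_id filter_append length_append)
  ultimately have "length (filter (\<lambda>x. x > \<beta>) ?xs) \<ge> card S - i" using len by simp
  then show False using c i length_filter_eigs_asc[OF S, of "\<lambda>x. x > \<beta>"] by simp
qed

lemma eigs_asc_ge:
  assumes S: "finite S" "eigensystem S M v lam"
    and c: "card {i \<in> S. lam i < \<beta>} \<le> i" and i: "i < card S"
  shows "\<beta> \<le> eigs_asc S M ! i"
proof (rule ccontr)
  let ?xs = "eigs_asc S M"
  assume "\<not> \<beta> \<le> ?xs ! i"
  then have gt: "?xs ! i < \<beta>" by simp
  have len: "length ?xs = card S" using S by (rule length_eigs_asc)
  have sorted: "sorted ?xs" by (simp add: eigs_asc_def)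
  have "\<forall>x\<in>set (take (Suc i) ?xs). x < \<beta>"
  proof
    fix x assume "x \<in> set (take (Suc i) ?xs)"
    then obtain j where "j < Suc i" "x = ?xs ! j" by (auto simp: in_set_conv_nth)
    then show "x < \<beta>" using sorted_nth_mono[OF sorted, of j i] gt i len by simp
  qed
  then have "filter (\<lambda>x. x < \<beta>) (take (Suc i) ?xs) = take (Suc i) ?xs" by simp
  moreover have "length (filter (\<lambda>x. x < \<beta>) ?xs) =
      length (filter (\<lambda>x. x < \<beta>) (take (Suc i) ?xs)) + length (filter (\<lambda>x. x < \<beta>) (drop (Suc i) ?xs))"
    by (metis append_take_drop_id filter_append length_append)
  ultimately have "length (filter (\<lambda>x. x < \<beta>) ?xs) \<ge> Suc i" using len i by simp
  then show False using c length_filter_eigs_asc[OF S, of "\<lambda>x. x < \<beta>"] by simp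
qed

section \<open>Counting eigenvalues by means of quadratic forms\<close>

lemma ip_sum_right: "ip S f (\<lambda>x. \<Sum>i\<in>I. c i * u i x) = (\<Sum>i\<in>I. c i * ip S f (u i))"
proof -
  have "ip S f (\<lambda>x. \<Sum>i\<in>I. c i * u i x) = (\<Sum>x\<in>S. \<Sum>i\<in>I. c i * (f x * u i x))"
    by (simp add: ip_def sum_distrib_left mult_ac)
  also have "\<dots> = (\<Sum>i\<in>I. \<Sum>x\<in>S. c i * (f x * u i x))" by (rule sum.swap)
  finally show ?thesis by (simp add: ip_def sum_distrib_left)
qed

lemma ip_eigen_combination:
  assumes fin: "finite S" and E: "eigensystem S M v lam" and I: "I \<subseteq> S"
  shows "ip S (\<lambda>x. \<Sum>i\<in>I. c i * v i x) (\<lambda>x. \<Sum>i\<in>I. d i * v i x) = (\<Sum>i\<in>I. c i * d i)"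
proof -
  have fI: "finite I" using I fin by (rule finite_subset)
  have "ip S (\<lambda>x. \<Sum>i\<in>I. c i * v i x) (v j) = c j" if "j \<in> I" for j
  proof -
    have "ip S (\<lambda>x. \<Sum>i\<in>I. c i * v i x) (v j) = (\<Sum>i\<in>I. c i * ip S (v j) (v i))"
      by (subst ip_commute) (rule ip_sum_right)
    also have "\<dots> = (\<Sum>i\<in>I. if i = j then c i else 0)"
      using E I that by (intro sum.cong) (auto simp: eigensystem_def subset_iff)
    finally show ?thesis using fI that by simp
  qed
  then show ?thesis by (simp add: ip_sum_right mult.commute)
qed

lemma bil_eigen_combination:
  fixes c :: "'a \<Rightarrow> real"
  assumes fin: "finite S" and E: "eigensystem S M v lam" and I: "I \<subseteq> S"
  defines "x \<equiv> (\<lambda>a. \<Sum>i\<in>I. c i * v i a)"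
  shows "bil S M x x = (\<Sum>i\<in>I. lam i * (c i * c i))"
proof -
  have "(\<Sum>y\<in>S. M a y * x y) = (\<Sum>i\<in>I. (c i * lam i) * v i a)" if "a \<in> S" for a
  proof -
    have "(\<Sum>y\<in>S. M a y * x y) = ip S (M a) x" by (simp add: ip_def)
    also have "\<dots> = (\<Sum>i\<in>I. c i * ip S (M a) (v i))" unfolding x_def by (rule ip_sum_right)
    also have "\<dots> = (\<Sum>i\<in>I. c i * (lam i * v i a))"
      using E I that by (intro sum.cong) (auto simp: eigensystem_def ip_def)
    finally show ?thesis by (simp add: mult_ac)
  qed
  then have "bil S M x x = ip S x (\<lambda>a. \<Sum>i\<in>I. (c i * lam i) * v i a)"
    unfolding bil_eq_ip ip_def by (intro sum.cong) auto
  also have "\<dots> = (\<Sum>i\<in>I. c i * (c i * lam i))"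
    unfolding x_def by (rule ip_eigen_combination[OF fin E I])
  finally show ?thesis by (simp add: mult_ac)
qed

lemma weighted_square_sum_strict:
  fixes c lam :: "'a \<Rightarrow> real"
  assumes "finite I" "\<And>i. i \<in> I \<Longrightarrow> lam i > \<beta>" "\<exists>i\<in>I. c i \<noteq> 0"
  shows "\<beta> * (\<Sum>i\<in>I. c i * c i) < (\<Sum>i\<in>I. lam i * (c i * c i))"
proof -
  obtain k where k: "k \<in> I" "c k \<noteq> 0" using assms by blast
  have "(\<Sum>i\<in>I. \<beta> * (c i * c i)) < (\<Sum>i\<in>I. lam i * (c i * c i))"
  proof (rule sum_strict_mono_ex1)
    show "\<forall>i\<in>I. \<beta> * (c i * c i) \<le> lam i * (c i * c i)"
      using assms by (auto intro!: mult_right_mono simp: less_imp_le)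
    have "c k * c k > 0" using k by (metis not_real_square_gt_zero)
    then show "\<exists>i\<in>I. \<beta> * (c i * c i) < lam i * (c i * c i)"
      using k assms(2) by (intro bexI[of _ k] mult_strict_right_mono) auto
  qed (use assms in auto)
  then show ?thesis by (simp add: sum_distrib_left)
qed

text \<open>One half of the min-max principle: with more than \<open>card J\<close> eigenvalues
  above \<open>\<beta>\<close>, some nonzero combination of their eigenvectors would satisfy all
  constraints, and there the form exceeds \<open>\<beta>\<close>.\<close>

lemma card_eigenvalues_gt_constraints:
  assumes fin: "finite S" and E: "eigensystem S M v lam" and J: "finite J"
    and le: "\<And>x. (\<And>j. j \<in> J \<Longrightarrow> ip S (w j) x = 0) \<Longrightarrow> bil S M x x \<le> \<beta> * ip S x x"
  shows "card {i \<in> S. lam i > \<beta>} \<le> card J"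
proof (rule ccontr)
  let ?I = "{i \<in> S. lam i > \<beta>}"
  assume "\<not> card ?I \<le> card J"
  then obtain c where c: "\<exists>i\<in>?I. c i \<noteq> 0" "\<forall>j\<in>J. (\<Sum>i\<in>?I. ip S (w j) (v i) * c i) = 0"
    using homogeneous_system_nontrivial[OF J, of ?I "\<lambda>j i. ip S (w j) (v i)"] fin by auto
  define x where "x = (\<lambda>a. \<Sum>i\<in>?I. c i * v i a)"
  have "ip S (w j) x = 0" if "j \<in> J" for j
    unfolding x_def using c(2) that by (subst ip_sum_right) (simp add: mult.commute)
  then have "bil S M x x \<le> \<beta> * ip S x x" by (rule le)
  moreover have "bil S M x x = (\<Sum>i\<in>?I. lam i * (c i * c i))"
    unfolding x_def by (rule bil_eigen_combination[OF fin E]) auto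
  moreover have "ip S x x = (\<Sum>i\<in>?I. c i * c i)"
    unfolding x_def by (rule ip_eigen_combination[OF fin E]) auto
  moreover have "\<beta> * (\<Sum>i\<in>?I. c i * c i) < (\<Sum>i\<in>?I. lam i * (c i * c i))"
    by (rule weighted_square_sum_strict) (use fin c in auto)
  ultimately show False by simp
qed

text \<open>The dual half, for a subspace given by generators; \<open>inj\<close> is their linear
  independence. With too many eigenvalues above \<open>\<beta>\<close>, a nonzero vector of the
  subspace would be orthogonal to all other eigenvectors, hence a combination of those above
  \<open>\<beta>\<close>.\<close>

lemma card_eigenvalues_gt_range:
  assumes fin: "finite S" and E: "eigensystem S M v lam" and J: "finite J"
    and inj: "\<And>g. \<exists>j\<in>J. g j \<noteq> 0 \<Longrightarrow> \<exists>x\<in>S. (\<Sum>j\<in>J. g j * u j x) \<noteq> 0"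
    and le: "\<And>g. bil S M (\<lambda>x. \<Sum>j\<in>J. g j * u j x) (\<lambda>x. \<Sum>j\<in>J. g j * u j x)
        \<le> \<beta> * ip S (\<lambda>x. \<Sum>j\<in>J. g j * u j x) (\<lambda>x. \<Sum>j\<in>J. g j * u j x)"
  shows "card {i \<in> S. lam i > \<beta>} + card J \<le> card S"
proof (rule ccontr)
  let ?I = "{i \<in> S. lam i > \<beta>}"
  let ?I' = "{i \<in> S. \<not> lam i > \<beta>}"
  assume neg: "\<not> card ?I + card J \<le> card S"
  have "card (?I \<union> ?I') = card ?I + card ?I'" using fin by (intro card_Un_disjoint) auto
  moreover have "?I \<union> ?I' = S" by auto
  ultimately have "card ?I' < card J" using neg by simp
  then obtain g where g: "\<exists>j\<in>J. g j \<noteq> 0" "\<forall>i\<in>?I'. (\<Sum>j\<in>J. ip S (v i) (u j) * g j) = 0"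
    using homogeneous_system_nontrivial[of ?I' J "\<lambda>i j. ip S (v i) (u j)"] fin J by auto
  define f where "f = (\<lambda>x. \<Sum>j\<in>J. g j * u j x)"
  have f0: "ip S (v i) f = 0" if "i \<in> ?I'" for i
    unfolding f_def using g(2) that by (subst ip_sum_right) (simp add: mult.commute)
  define c where "c = (\<lambda>i. ip S (v i) f)"
  define x where "x = (\<lambda>a. \<Sum>i\<in>?I. c i * v i a)"
  have fx: "f a = x a" if "a \<in> S" for a
  proof -
    have "x a = (\<Sum>i\<in>S. c i * v i a)"
      unfolding x_def by (rule sum.mono_neutral_left) (use fin f0 in \<open>auto simp: c_def\<close>)
    also have "\<dots> = (\<Sum>i\<in>S. \<Sum>y\<in>S. v i y * f y * v i a)"
      by (simp add: c_def ip_def sum_distrib_right)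
    also have "\<dots> = (\<Sum>y\<in>S. \<Sum>i\<in>S. v i y * f y * v i a)" by (rule sum.swap)
    also have "\<dots> = (\<Sum>y\<in>S. f y * (\<Sum>i\<in>S. v i y * v i a))" by (simp add: sum_distrib_left mult_ac)
    also have "\<dots> = (\<Sum>y\<in>S. f y * (if y = a then 1 else 0))"
      using that by (intro sum.cong) (simp_all add: eigensystem_complete[OF fin E])
    also have "\<dots> = f a" using fin that by (simp add: if_distrib[of "\<lambda>x. _ * x"] cong: if_cong)
    finally show ?thesis by simp
  qed
  have "bil S M x x = bil S M f f" "ip S x x = ip S f f"
    by (simp_all add: bil_def ip_def fx)
  then have "bil S M x x \<le> \<beta> * ip S x x" using le[of g] by (simp add: f_def)
  moreover have "bil S M x x = (\<Sum>i\<in>?I. lam i * (c i * c i))"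
    unfolding x_def by (rule bil_eigen_combination[OF fin E]) auto
  moreover have ip: "ip S x x = (\<Sum>i\<in>?I. c i * c i)"
    unfolding x_def by (rule ip_eigen_combination[OF fin E]) auto
  moreover have "\<exists>i\<in>?I. c i \<noteq> 0"
  proof (rule ccontr)
    assume "\<not> ?thesis"
    then have "\<forall>a\<in>S. f a = 0" by (simp add: fx x_def)
    then show False using inj[OF g(1)] by (simp add: f_def)
  qed
  then have "\<beta> * (\<Sum>i\<in>?I. c i * c i) < (\<Sum>i\<in>?I. lam i * (c i * c i))"
    by (intro weighted_square_sum_strict) (use fin in auto)
  ultimately show False by simp
qed

lemma card_eigenvalues_lt_constraints:
  assumes "finite S" "eigensystem S M v lam" "finite J"
    and "\<And>x. (\<And>j. j \<in> J \<Longrightarrow> ip S (w j) x = 0) \<Longrightarrow> \<beta> * ip S x x \<le> bil S M x x"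
  shows "card {i \<in> S. lam i < \<beta>} \<le> card J"
  using card_eigenvalues_gt_constraints[OF assms(1) eigensystem_uminus[OF assms(2)] assms(3),
      where \<beta> = "- \<beta>" and w = w] assms(4) by (simp add: bil_uminus)

lemma card_eigenvalues_lt_range:
  assumes "finite S" "eigensystem S M v lam" "finite J"
    and "\<And>g. \<exists>j\<in>J. g j \<noteq> 0 \<Longrightarrow> \<exists>x\<in>S. (\<Sum>j\<in>J. g j * u j x) \<noteq> 0"
    and "\<And>g. \<beta> * ip S (\<lambda>x. \<Sum>j\<in>J. g j * u j x) (\<lambda>x. \<Sum>j\<in>J. g j * u j x)
        \<le> bil S M (\<lambda>x. \<Sum>j\<in>J. g j * u j x) (\<lambda>x. \<Sum>j\<in>J. g j * u j x)"
  shows "card {i \<in> S. lam i < \<beta>} + card J \<le> card S"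
  using card_eigenvalues_gt_range[OF assms(1) eigensystem_uminus[OF assms(2)] assms(3),
      where \<beta> = "- \<beta>", OF assms(4)] assms(5) by (simp add: bil_uminus)

text \<open>In the term of a permutation \<open>p\<close> the factors \<open>s i / s (p i)\<close>
  multiply to 1, since \<open>p\<close> only reorders the denominators.\<close>

lemma charpoly_diagonal_conjugation:
  fixes s :: "'a \<Rightarrow> real"
  assumes fin: "finite S" and s: "\<And>x. x \<in> S \<Longrightarrow> s x \<noteq> 0"
    and N: "\<And>x y. x \<in> S \<Longrightarrow> y \<in> S \<Longrightarrow> N x y = s x * M x y / s y"
  shows "charpoly S N = charpoly S M"
  unfolding charpoly_def det_on_def
proof (rule sum.cong[OF refl])
  fix p assume "p \<in> {p. p permutes S}"
  then have p: "p permutes S" by simp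
  let ?A = "\<lambda>M i. (if i = p i then [:0, 1:] else 0) - [:M i (p i):] :: real poly"
  have "?A N i = Polynomial.smult (s i / s (p i)) (?A M i)" if "i \<in> S" for i
  proof -
    have "p i \<in> S" using p that by (simp add: permutes_in_image)
    then show ?thesis using s that N[OF that] by (simp add: smult_diff_right)
  qed
  then have "(\<Prod>i\<in>S. ?A N i) = (\<Prod>i\<in>S. Polynomial.smult (s i / s (p i)) (?A M i))" by (rule prod.cong[OF refl])
  also have "\<dots> = Polynomial.smult (\<Prod>i\<in>S. s i / s (p i)) (\<Prod>i\<in>S. ?A M i)" by (rule prod_smult)
  also have "(\<Prod>i\<in>S. s i / s (p i)) = (\<Prod>i\<in>S. s i) / (\<Prod>i\<in>S. s (p i))" by (rule prod_dividef)
  also have "(\<Prod>i\<in>S. s (p i)) = (\<Prod>i\<in>S. s i)"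
    using permutes_imp_bij[OF p] by (rule prod.reindex_bij_betw)
  also have "(\<Prod>i\<in>S. s i) / (\<Prod>i\<in>S. s i) = 1" using s fin by (simp add: prod_zero_iff)
  finally show "of_int (sign p) * (\<Prod>i\<in>S. ?A N i) = of_int (sign p) * (\<Prod>i\<in>S. ?A M i)"
    by simp
qed

section \<open>Signed boundaries and coboundaries\<close>

text \<open>Only vertices strictly below \<open>v\<close> count, so the sign is the same whether or
  not \<open>v\<close> belongs to \<open>F\<close>. This lets one function serve for insertion and
  for removal.\<close>

definition vsgn :: "nat set \<Rightarrow> nat \<Rightarrow> real" where
  "vsgn F v = (-1) ^ card {u \<in> F. u < v}"

definition ksub :: "nat set \<Rightarrow> nat \<Rightarrow> nat set set" where
  "ksub V m = {F. F \<subseteq> V \<and> card F = m}"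

text \<open>The boundary map of the complete complex on \<open>V\<close>, acting on coefficient
  functions.\<close>

definition bd :: "nat set \<Rightarrow> (nat set \<Rightarrow> real) \<Rightarrow> nat set \<Rightarrow> real" where
  "bd V f E = (\<Sum>u\<in>V - E. vsgn E u * f (insert u E))"

text \<open>No complex is mentioned: all facets of a face of the random complex are present, so the
  coboundary is the same one as in the complete complex.\<close>

definition cob :: "(nat set \<Rightarrow> real) \<Rightarrow> nat set \<Rightarrow> real" where
  "cob f H = (\<Sum>u\<in>H. vsgn H u * f (H - {u}))"

text \<open>A weighted adjacency form, grouped by the common face \<open>E\<close> of two adjacent
  faces. The inner double sum is a bilinear form on the link of \<open>E\<close> in signed vectors.
  The weights used are 1 (complete complex), an indicator (random complex), and their centred
  difference.\<close>

definition wform ::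
    "nat set \<Rightarrow> nat \<Rightarrow> (nat set \<Rightarrow> real) \<Rightarrow> (nat set \<Rightarrow> real) \<Rightarrow> (nat set \<Rightarrow> real) \<Rightarrow> real" where
  "wform V k \<omega> f g = (\<Sum>E\<in>ksub V (k - 1). \<Sum>u\<in>V - E. \<Sum>v\<in>V - E - {u}.
     \<omega> (insert u (insert v E)) * (vsgn E u * f (insert u E)) * (vsgn E v * g (insert v E)))"

lemma finite_ksub: "finite V \<Longrightarrow> finite (ksub V m)"
  by (auto simp: ksub_def intro: finite_subset[of _ "Pow V"])

lemma ksub_finite_elem: "finite V \<Longrightarrow> F \<in> ksub V m \<Longrightarrow> finite F"
  by (auto simp: ksub_def intro: finite_subset)

lemma card_ksub: "finite V \<Longrightarrow> card (ksub V m) = card V choose m"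
  by (simp add: ksub_def n_subsets)

lemma vsgn_square [simp]: "vsgn F v * vsgn F v = 1"
  by (simp add: vsgn_def flip: power_add mult_2)

lemma vsgn_square_left [simp]: "vsgn F v * (vsgn F v * x) = x"
  by (simp flip: mult.assoc)

lemma vsgn_insert_self [simp]: "vsgn (insert v F) v = vsgn F v"
  unfolding vsgn_def by (rule arg_cong[of _ _ "\<lambda>A. (-1) ^ card A"]) auto

lemma vsgn_remove_self [simp]: "vsgn (F - {v}) v = vsgn F v"
  unfolding vsgn_def by (rule arg_cong[of _ _ "\<lambda>A. (-1) ^ card A"]) auto

text \<open>Only the larger of \<open>u\<close> and \<open>v\<close> has the other one below it, so
  exactly one of the two signs flips. This is the source of the cancellations in
  \<open>cob_cob\<close>, \<open>bd_bd\<close> and of the sign in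
  \<open>wform_degree\<close>.\<close>

lemma vsgn_insert_insert:
  assumes "finite E" "u \<notin> E" "v \<notin> E" "u \<noteq> v"
  shows "vsgn (insert u E) v * vsgn (insert v E) u = - (vsgn E u * vsgn E v)"
proof -
  have less: "vsgn (insert a E) b = - vsgn E b" "vsgn (insert b E) a = vsgn E a"
    if "a < b" "a \<notin> E" for a b
  proof -
    have "{w \<in> insert a E. w < b} = insert a {w \<in> E. w < b}" using that by auto
    then show "vsgn (insert a E) b = - vsgn E b" using assms that by (simp add: vsgn_def)
    have "{w \<in> insert b E. w < a} = {w \<in> E. w < a}" using that by auto
    then show "vsgn (insert b E) a = vsgn E a" by (simp add: vsgn_def)
  qed
  show ?thesis using less[of u v] less[of v u] assms by (cases "u < v") auto
qed

lemma vsgn_insert_swap: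
  assumes "finite E" "u \<notin> E" "v \<notin> E" "u \<noteq> v"
  shows "vsgn (insert v E) u * vsgn E v = - (vsgn (insert u E) v * vsgn E u)"
proof -
  have "vsgn (insert v E) u * vsgn E v = 
    vsgn (insert u E) v * vsgn E v * (vsgn (insert u E) v * vsgn (insert v E) u)"
    by (simp add: mult_ac)
  then show ?thesis unfolding vsgn_insert_insert[OF assms] by (simp add: mult_ac)
qed

text \<open>Double counting of pairs consisting of a face and one of its facets. It yields the
  adjointness of \<open>bd\<close> and \<open>cob\<close>.\<close>

lemma sum_ksub_insert:
  fixes h :: "nat set \<Rightarrow> nat \<Rightarrow> 'b :: comm_monoid_add"
  assumes V: "finite V"
  shows "(\<Sum>E\<in>ksub V m. \<Sum>u\<in>V - E. h E u) = (\<Sum>F\<in>ksub V (Suc m). \<Sum>u\<in>F. h (F - {u}) u)"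
proof -
  have "(\<Sum>E\<in>ksub V m. \<Sum>u\<in>V - E. h E u) = (\<Sum>(E, u)\<in>Sigma (ksub V m) (\<lambda>E. V - E). h E u)"
    by (rule sum.Sigma) (use V finite_ksub in auto)
  also have "\<dots> = (\<Sum>(F, u)\<in>Sigma (ksub V (Suc m)) (\<lambda>F. F). h (F - {u}) u)"
  proof (rule sum.reindex_bij_witness[of _ "\<lambda>(F, u). (F - {u}, u)" "\<lambda>(E, u). (insert u E, u)"], goal_cases)
    case (2 a)
    then obtain E u where a: "a = (E, u)" "E \<in> ksub V m" "u \<in> V" "u \<notin> E" by auto
    then have "card (insert u E) = Suc m" using ksub_finite_elem[OF V a(2)] by (simp add: ksub_def)
    then show ?case using a by (auto simp: ksub_def)
  next
    case (4 b)
    then obtain F u where b: "b = (F, u)" "F \<in> ksub V (Suc m)" "u \<in> F" by auto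
    then have "card (F - {u}) = m" using ksub_finite_elem[OF V b(2)] by (simp add: ksub_def)
    then show ?case using b by (auto simp: ksub_def)
  qed auto
  also have "\<dots> = (\<Sum>F\<in>ksub V (Suc m). \<Sum>u\<in>F. h (F - {u}) u)"
    by (rule sum.Sigma[symmetric]) (use V finite_ksub ksub_finite_elem in auto)
  finally show ?thesis .
qed

lemma ip_bd_cob:
  assumes "finite V"
  shows "ip (ksub V m) (bd V f) g = ip (ksub V (Suc m)) f (cob g)"
proof -
  have "ip (ksub V m) (bd V f) g = (\<Sum>E\<in>ksub V m. \<Sum>u\<in>V - E. vsgn E u * f (insert u E) * g E)"
    by (simp add: ip_def bd_def sum_distrib_right)
  also have "\<dots> = (\<Sum>F\<in>ksub V (Suc m). \<Sum>u\<in>F. vsgn (F - {u}) u * f (insert u (F - {u})) * g (F - {u}))"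
    using assms by (rule sum_ksub_insert)
  also have "\<dots> = ip (ksub V (Suc m)) f (cob g)"
    unfolding ip_def cob_def sum_distrib_left
    by (intro sum.cong refl) (simp add: insert_absorb mult_ac)
  finally show ?thesis .
qed

lemma sum_ksub_insert_const:
  assumes "finite V"
  shows "(\<Sum>E\<in>ksub V m. \<Sum>u\<in>V - E. h (insert u E)) = real (Suc m) * (\<Sum>F\<in>ksub V (Suc m). h F)"
proof -
  have "(\<Sum>E\<in>ksub V m. \<Sum>u\<in>V - E. h (insert u E)) =
      (\<Sum>F\<in>ksub V (Suc m). \<Sum>u\<in>F. h (insert u (F - {u})))"
    using assms by (rule sum_ksub_insert)
  also have "\<dots> = (\<Sum>F\<in>ksub V (Suc m). \<Sum>u\<in>F. h F)"
    by (intro sum.cong refl) (simp add: insert_absorb)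
  also have "\<dots> = (\<Sum>F\<in>ksub V (Suc m). real (Suc m) * h F)"
    by (intro sum.cong refl) (simp add: ksub_def)
  finally show ?thesis by (simp add: sum_distrib_left)
qed

lemma antisymmetric_sum_zero:
  fixes t :: "'a \<Rightarrow> 'a \<Rightarrow> real"
  assumes "finite A" "\<And>u v. u \<in> A \<Longrightarrow> v \<in> A \<Longrightarrow> u \<noteq> v \<Longrightarrow> t u v = - t v u"
  shows "(\<Sum>u\<in>A. \<Sum>v\<in>A - {u}. t u v) = 0"
proof -
  define s where "s = (\<lambda>u v. if u = v then 0 else t u v)"
  have s: "(\<Sum>u\<in>A. \<Sum>v\<in>A - {u}. t u v) = (\<Sum>u\<in>A. \<Sum>v\<in>A. s u v)"
  proof (rule sum.cong[OF refl])
    fix u assume "u \<in> A"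
    show "(\<Sum>v\<in>A - {u}. t u v) = (\<Sum>v\<in>A. s u v)"
      by (rule sum.mono_neutral_cong_left) (use assms(1) in \<open>auto simp: s_def\<close>)
  qed
  have "(\<Sum>u\<in>A. \<Sum>v\<in>A. s u v) = (\<Sum>v\<in>A. \<Sum>u\<in>A. s u v)" by (rule sum.swap)
  also have "\<dots> = (\<Sum>v\<in>A. \<Sum>u\<in>A. - s v u)"
  proof (intro sum.cong refl)
    fix u v assume "v \<in> A" "u \<in> A"
    then show "s u v = - s v u" using assms(2)[of u v] unfolding s_def by (cases "u = v") auto
  qed
  finally show ?thesis unfolding s by (simp add: sum_negf)
qed

lemma cob_cob: assumes "finite H" shows "cob (cob g) H = 0"
proof -
  have "cob (cob g) H = (\<Sum>u\<in>H. \<Sum>v\<in>H - {u}. vsgn H u * (vsgn (H - {u}) v * g (H - {u} - {v})))"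
    by (simp add: cob_def sum_distrib_left)
  also have "\<dots> = 0"
  proof (rule antisymmetric_sum_zero[OF assms])
    fix u v assume uv: "u \<in> H" "v \<in> H" "u \<noteq> v"
    define E where "E = H - {u} - {v}"
    have E: "finite E" "u \<notin> E" "v \<notin> E" "H = insert u (insert v E)" "H - {u} = insert v E"
      "H - {v} = insert u E" "H - {v} - {u} = E"
      using uv assms by (auto simp: E_def)
    have "vsgn H u = vsgn (insert v E) u" "vsgn H v = vsgn (insert u E) v"
      using vsgn_remove_self[of H u] vsgn_remove_self[of H v] E(5,6) by simp_all
    then show "vsgn H u * (vsgn (H - {u}) v * g (H - {u} - {v})) =
        - (vsgn H v * (vsgn (H - {v}) u * g (H - {v} - {u})))"
      using vsgn_insert_swap[OF E(1-3) uv(3)] unfolding E(7) E_def[symmetric] unfolding E(5,6)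
      by (simp flip: mult.assoc)
  qed
  finally show ?thesis .
qed

lemma bd_bd: assumes "finite V" "finite E" shows "bd V (bd V f) E = 0"
proof -
  have "bd V (bd V f) E = (\<Sum>u\<in>V - E. \<Sum>v\<in>V - E - {u}.
      vsgn E u * (vsgn (insert u E) v * f (insert v (insert u E))))"
    unfolding bd_def sum_distrib_left
    by (intro sum.cong refl) auto
  also have "\<dots> = 0"
  proof (rule antisymmetric_sum_zero)
    fix u v assume uv: "u \<in> V - E" "v \<in> V - E" "u \<noteq> v"
    have "vsgn E u * (vsgn (insert u E) v * f (insert v (insert u E))) =
        (vsgn (insert u E) v * vsgn E u) * f (insert u (insert v E))"
      by (simp add: insert_commute)
    also have "\<dots> = - (vsgn (insert v E) u * vsgn E v) * f (insert u (insert v E))"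
      using vsgn_insert_swap[of E u v] uv assms by simp
    finally show "vsgn E u * (vsgn (insert u E) v * f (insert v (insert u E))) =
       - (vsgn E v * (vsgn (insert v E) u * f (insert u (insert v E))))"
      by simp
  qed (use assms in auto)
  finally show ?thesis .
qed

text \<open>For a face through \<open>a\<close>, evaluate the vanishing double boundary at the face
  without \<open>a\<close>: all terms but that of \<open>a\<close> are zero by assumption. Hence
  being a cycle is tested on the faces avoiding \<open>a\<close>.\<close>

lemma bd_eq_0_from_cone:
  assumes V: "finite V" "a \<in> V"
    and z: "\<And>E. E \<in> ksub (V - {a}) (Suc m) \<Longrightarrow> bd V f E = 0"
    and E: "E \<in> ksub V (Suc m)"
  shows "bd V f E = 0"
proof (cases "a \<in> E")
  case False
  then show ?thesis using E z by (auto simp: ksub_def)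
next
  case True
  define G where "G = E - {a}"
  have G: "finite G" "a \<notin> G" "E = insert a G" "G \<subseteq> V - {a}" "card G = m"
    using E True V by (auto simp: G_def ksub_def finite_subset)
  have "bd V (bd V f) G = 0" using V G by (intro bd_bd) auto
  moreover have "bd V (bd V f) G = (\<Sum>u\<in>{a}. vsgn G u * bd V f (insert u G))"
    unfolding bd_def[of V "bd V f"]
  proof (rule sum.mono_neutral_right)
    show "\<forall>u\<in>V - G - {a}. vsgn G u * bd V f (insert u G) = 0"
      using z G by (auto simp: ksub_def)
  qed (use V G in auto)
  ultimately show ?thesis using G by (simp add: vsgn_def)
qed

text \<open>On a face through \<open>a\<close> only the facet opposite to \<open>a\<close> avoids
  \<open>a\<close>, so \<open>cob g\<close> returns \<open>g\<close> up to sign. The coboundaries of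
  single faces avoiding \<open>a\<close> are therefore linearly independent, and their number is
  that of the tests in \<open>bd_eq_0_from_cone\<close>.\<close>

lemma cob_cone_nonzero:
  assumes V: "finite V" "a \<in> V"
    and g: "\<And>G. G \<notin> ksub (V - {a}) m \<Longrightarrow> g G = 0" and nz: "\<exists>G\<in>ksub (V - {a}) m. g G \<noteq> 0"
  shows "\<exists>F\<in>ksub V (Suc m). cob g F \<noteq> 0"
proof -
  obtain G where G: "G \<in> ksub (V - {a}) m" "g G \<noteq> 0" using nz by blast
  then have G': "finite G" "a \<notin> G" "G \<subseteq> V" "card G = m" using V by (auto simp: ksub_def finite_subset)
  have "cob g (insert a G) = (\<Sum>u\<in>{a}. vsgn (insert a G) u * g (insert a G - {u}))"
    unfolding cob_def
  proof (rule sum.mono_neutral_right)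
    show "\<forall>u\<in>insert a G - {a}. vsgn (insert a G) u * g (insert a G - {u}) = 0"
      by (auto intro!: g simp: ksub_def)
  qed (use G' in auto)
  also have "\<dots> = vsgn G a * g G" using G' by simp
  finally have "cob g (insert a G) \<noteq> 0" using G by (simp add: vsgn_def)
  moreover have "insert a G \<in> ksub V (Suc m)" using G' V by (auto simp: ksub_def)
  ultimately show ?thesis by blast
qed

lemma wform_add: "wform V k (\<lambda>H. c * \<omega> H + \<omega>' H) f g = c * wform V k \<omega> f g + wform V k \<omega>' f g"
  by (simp add: wform_def sum_distrib_left distrib_right sum.distrib mult.assoc)

text \<open>Multiply out the product of the two boundaries at each \<open>E\<close>: pairs of
  distinct vertices give the form, and the diagonal meets each face once for each of its
  \<open>k\<close> facets.\<close>

lemma wform_one: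
  assumes V: "finite V" and k: "k \<ge> 1"
  shows "wform V k (\<lambda>_. 1) f g = ip (ksub V (k - 1)) (bd V f) (bd V g) - real k * ip (ksub V k) f g"
proof -
  have "(\<Sum>u\<in>V - E. \<Sum>v\<in>V - E - {u}. 1 * (vsgn E u * f (insert u E)) * (vsgn E v * g (insert v E))) =
     bd V f E * bd V g E - (\<Sum>u\<in>V - E. f (insert u E) * g (insert u E))" for E
  proof -
    have "(\<Sum>v\<in>V - E - {u}. 1 * (vsgn E u * f (insert u E)) * (vsgn E v * g (insert v E))) =
       (vsgn E u * f (insert u E)) * bd V g E - f (insert u E) * g (insert u E)" if "u \<in> V - E" for u
    proof -
      have "bd V g E = vsgn E u * g (insert u E) + (\<Sum>v\<in>V - E - {u}. vsgn E v * g (insert v E))"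
        unfolding bd_def using V that by (intro sum.remove) auto
      moreover have "vsgn E u * f (insert u E) * (vsgn E u * g (insert u E)) = f (insert u E) * g (insert u E)"
        by (simp add: mult_ac)
      ultimately show ?thesis by (simp add: distrib_left sum_distrib_left mult.assoc)
    qed
    then show ?thesis by (simp add: sum_subtractf bd_def[of V f] sum_distrib_right)
  qed
  then have "wform V k (\<lambda>_. 1) f g = ip (ksub V (k - 1)) (bd V f) (bd V g)
     - (\<Sum>E\<in>ksub V (k - 1). \<Sum>u\<in>V - E. f (insert u E) * g (insert u E))"
    by (simp add: wform_def ip_def sum_subtractf)
  also have "(\<Sum>E\<in>ksub V (k - 1). \<Sum>u\<in>V - E. f (insert u E) * g (insert u E)) =
     real k * ip (ksub V k) f g"
    using sum_ksub_insert_const[OF V, where m = "k - 1" and h = "\<lambda>F. f F * g F"] k by (simp add: ip_def)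
  finally show ?thesis .
qed

text \<open>Expand the product of the two coboundaries at each \<open>H\<close>: equal removed
  vertices contribute the weighted degrees, distinct ones the form with a minus sign. With weight 1
  all degrees are \<open>card V - k\<close>; with an indicator this is the identity of adjacency
  with degrees minus the up-Laplacian.\<close>

lemma wform_degree:
  assumes V: "finite V" and k: "k \<ge> 1"
  shows "wform V k \<omega> f g = (\<Sum>F\<in>ksub V k. (\<Sum>u\<in>V - F. \<omega> (insert u F)) * f F * g F)
      - (\<Sum>H\<in>ksub V (Suc k). \<omega> H * cob f H * cob g H)"
proof -
  let ?T = "\<lambda>H u v. \<omega> H * (vsgn H u * f (H - {u})) * (vsgn H v * g (H - {v}))"
  have "\<omega> H * cob f H * cob g H = (\<Sum>u\<in>H. \<omega> H * (f (H - {u}) * g (H - {u})))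
      + (\<Sum>u\<in>H. \<Sum>v\<in>H - {u}. ?T H u v)" if "H \<in> ksub V (Suc k)" for H
  proof -
    have fH: "finite H" using V that by (rule ksub_finite_elem)
    have "(\<Sum>v\<in>H - {u}. ?T H u v) =
      \<omega> H * (vsgn H u * f (H - {u})) * cob g H - \<omega> H * (f (H - {u}) * g (H - {u}))" if "u \<in> H" for u
    proof -
      have "cob g H = vsgn H u * g (H - {u}) + (\<Sum>v\<in>H - {u}. vsgn H v * g (H - {v}))"
        unfolding cob_def using fH that by (intro sum.remove) auto
      moreover have "\<omega> H * (vsgn H u * f (H - {u})) * (vsgn H u * g (H - {u})) =
         \<omega> H * (f (H - {u}) * g (H - {u}))"
        by (simp add: mult_ac)
      ultimately show ?thesis by (simp add: distrib_left sum_distrib_left)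
    qed
    then have "(\<Sum>u\<in>H. \<Sum>v\<in>H - {u}. ?T H u v) =
        \<omega> H * cob f H * cob g H - (\<Sum>u\<in>H. \<omega> H * (f (H - {u}) * g (H - {u})))"
      by (simp add: sum_subtractf cob_def[of f] sum_distrib_right sum_distrib_left)
    then show ?thesis by simp
  qed
  then have "(\<Sum>H\<in>ksub V (Suc k). \<omega> H * cob f H * cob g H) =
      (\<Sum>H\<in>ksub V (Suc k). \<Sum>u\<in>H. \<omega> H * (f (H - {u}) * g (H - {u})))
      + (\<Sum>H\<in>ksub V (Suc k). \<Sum>u\<in>H. \<Sum>v\<in>H - {u}. ?T H u v)"
    by (simp add: sum.distrib)
  also have "(\<Sum>H\<in>ksub V (Suc k). \<Sum>u\<in>H. \<omega> H * (f (H - {u}) * g (H - {u}))) =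
     (\<Sum>F\<in>ksub V k. (\<Sum>u\<in>V - F. \<omega> (insert u F)) * f F * g F)"
    using sum_ksub_insert[OF V, where m = k and h = "\<lambda>F u. \<omega> (insert u F) * (f F * g F)"]
    by (simp add: insert_absorb sum_distrib_right mult.assoc)
  also have "(\<Sum>H\<in>ksub V (Suc k). \<Sum>u\<in>H. \<Sum>v\<in>H - {u}. ?T H u v) =
     (\<Sum>H\<in>ksub V (Suc k). \<Sum>(u, v)\<in>Sigma H (\<lambda>u. H - {u}). ?T H u v)"
    by (intro sum.cong[OF refl] sum.Sigma) (use V ksub_finite_elem in auto)
  also have "\<dots> = (\<Sum>(H, u, v)\<in>Sigma (ksub V (Suc k)) (\<lambda>H. Sigma H (\<lambda>u. H - {u})). ?T H u v)"
    by (rule sum.Sigma) (use V finite_ksub ksub_finite_elem in auto)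
  \<comment> \<open>With \<open>E = H - {u} - {v}\<close>, removing \<open>u\<close> from
    \<open>H\<close> is inserting \<open>v\<close> into \<open>E\<close>; the roles of the two
    vertices are exchanged, and the sign product changes sign.\<close>
  also have "\<dots> = (\<Sum>(E, v, u)\<in>Sigma (ksub V (k - 1)) (\<lambda>E. Sigma (V - E) (\<lambda>v. V - E - {v})).
     - (\<omega> (insert v (insert u E)) * (vsgn E v * f (insert v E)) * (vsgn E u * g (insert u E))))"
  proof (rule sum.reindex_bij_witness[of _ "\<lambda>(E, v, u). (insert v (insert u E), u, v)"
          "\<lambda>(H, u, v). (H - {u} - {v}, v, u)"], goal_cases)
    case (1 a)
    then show ?case by auto
  next
    case (2 a)
    then obtain H u v where a: "a = (H, u, v)" "H \<in> ksub V (Suc k)" "u \<in> H" "v \<in> H" "u \<noteq> v" by auto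
    then have "card (H - {u} - {v}) = k - 1" using V ksub_finite_elem[OF V a(2)]
      by (simp add: ksub_def card_Diff_singleton_if)
    then show ?case using a by (auto simp: ksub_def)
  next
    case (3 b)
    then show ?case by auto
  next
    case (4 b)
    then obtain E u v where b: "b = (E, v, u)" "E \<in> ksub V (k - 1)" "u \<in> V - E" "v \<in> V - E" "u \<noteq> v" by auto
    then have "card (insert v (insert u E)) = Suc k" using k ksub_finite_elem[OF V b(2)]
      by (simp add: ksub_def)
    then show ?case using b by (auto simp: ksub_def)
  next
    case (5 a)
    then obtain H u v where a: "a = (H, u, v)" "H \<in> ksub V (Suc k)" "u \<in> H" "v \<in> H" "u \<noteq> v" by auto
    define E where "E = H - {u} - {v}"
    have E: "finite E" "u \<notin> E" "v \<notin> E" "insert v (insert u E) = H" "H - {u} = insert v E"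
      "H - {v} = insert u E"
      using a ksub_finite_elem[OF V a(2)] by (auto simp: E_def)
    have "vsgn H u = vsgn (insert v E) u" "vsgn H v = vsgn (insert u E) v"
      using vsgn_remove_self[of H u] vsgn_remove_self[of H v] E(5,6) by simp_all
    then have s: "vsgn H v * vsgn H u = - (vsgn E u * vsgn E v)"
      using vsgn_insert_insert[OF E(1-3) a(5)] by simp
    have "?T H u v = \<omega> H * (vsgn H v * vsgn H u) * (f (H - {u}) * g (H - {v}))" by simp
    then have "?T H u v = - (\<omega> H * (vsgn E v * f (insert v E)) * (vsgn E u * g (insert u E)))"
      unfolding E(5,6) s by simp
    then show ?case unfolding a(1) by (simp add: E E_def[symmetric])
  qed
  also have "\<dots> = - (\<Sum>(E, v, u)\<in>Sigma (ksub V (k - 1)) (\<lambda>E. Sigma (V - E) (\<lambda>v. V - E - {v})).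
     \<omega> (insert v (insert u E)) * (vsgn E v * f (insert v E)) * (vsgn E u * g (insert u E)))"
    by (simp add: split_def sum_negf)
  also have "(\<Sum>(E, v, u)\<in>Sigma (ksub V (k - 1)) (\<lambda>E. Sigma (V - E) (\<lambda>v. V - E - {v})).
     \<omega> (insert v (insert u E)) * (vsgn E v * f (insert v E)) * (vsgn E u * g (insert u E))) =
     wform V k \<omega> f g"
  proof -
    have "wform V k \<omega> f g = (\<Sum>E\<in>ksub V (k - 1). \<Sum>(v, u)\<in>Sigma (V - E) (\<lambda>v. V - E - {v}).
       \<omega> (insert v (insert u E)) * (vsgn E v * f (insert v E)) * (vsgn E u * g (insert u E)))"
      unfolding wform_def by (intro sum.cong[OF refl] sum.Sigma) (use V in auto)
    also have "\<dots> = (\<Sum>(E, v, u)\<in>Sigma (ksub V (k - 1)) (\<lambda>E. Sigma (V - E) (\<lambda>v. V - E - {v})).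
     \<omega> (insert v (insert u E)) * (vsgn E v * f (insert v E)) * (vsgn E u * g (insert u E)))"
      by (rule sum.Sigma) (use V finite_ksub in auto)
    finally show ?thesis by simp
  qed
  finally show ?thesis by simp
qed

section \<open>The matrices and maps of the statement in terms of signed sums\<close>

definition ind :: "'a set \<Rightarrow> 'a \<Rightarrow> real" where
  "ind S H = (if H \<in> S then 1 else 0)"

lemma incid_insert:
  assumes "u \<notin> E"
  shows "incid (insert u E) E = vsgn E u"
proof -
  have *: "insert u E - E = {u}" using assms by auto
  show ?thesis unfolding incid_def * using vsgn_insert_self[of u E] by (auto simp: vsgn_def)
qed

text \<open>Two faces with a common facet \<open>E\<close> are \<open>insert u E\<close> and
  \<open>insert v E\<close> for unique distinct \<open>u\<close>, \<open>v\<close>, and their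
  incidence numbers with \<open>E\<close> are the signs in \<open>wform\<close>.\<close>

lemma bil_adj:
  assumes V: "finite V" and k: "k \<ge> 1"
  shows "bil (ksub V k) (Defs.adj X k) f g = wform V k (ind (faces X k)) f g"
proof -
  let ?A = "ksub V k"
  let ?P = "{(F, G). F \<in> ?A \<and> G \<in> ?A \<and> card (F \<inter> G) = k - 1}"
  have fin: "finite ?A" using V by (rule finite_ksub)
  have "bil ?A (Defs.adj X k) f g = (\<Sum>(F, G)\<in>?A \<times> ?A. Defs.adj X k F G * f F * g G)"
    unfolding bil_def by (rule sum.cartesian_product)
  also have "\<dots> = (\<Sum>(F, G)\<in>?P. Defs.adj X k F G * f F * g G)"
    by (rule sum.mono_neutral_right) (use fin in \<open>auto simp: Defs.adj_def split: if_splits\<close>)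
  also have "\<dots> = (\<Sum>(E, u, v)\<in>Sigma (ksub V (k - 1)) (\<lambda>E. Sigma (V - E) (\<lambda>u. V - E - {u})).
     ind (faces X k) (insert u (insert v E)) * (vsgn E u * f (insert u E)) * (vsgn E v * g (insert v E)))"
  proof (rule sum.reindex_bij_witness[of _ "\<lambda>(E, u, v). (insert u E, insert v E)"
          "\<lambda>(F, G). (F \<inter> G, the_elem (F - G), the_elem (G - F))"])
    fix a assume "a \<in> ?P"
    then obtain F G where a: "a = (F, G)" "F \<in> ?A" "G \<in> ?A" "card (F \<inter> G) = k - 1" by auto
    have finFG: "finite F" "finite G" using a V ksub_finite_elem by auto
    have "card (F - G) = 1" "card (G - F) = 1"
      using a k finFG card_Diff_subset_Int[of F G] card_Diff_subset_Int[of G F]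
      by (auto simp: ksub_def Int_commute)
    then obtain u v where uv: "F - G = {u}" "G - F = {v}" by (auto simp: card_1_singleton_iff)
    define E where "E = F \<inter> G"
    have E: "F = insert u E" "G = insert v E" "u \<notin> E" "v \<notin> E" "u \<noteq> v" "u \<in> V" "v \<in> V"
      "E \<in> ksub V (k - 1)"
      using uv a by (auto simp: E_def ksub_def)
    have i: "F \<inter> G = E" "F \<union> G = insert u (insert v E)" using E by auto
    show "(case case a of (F, G) \<Rightarrow> (F \<inter> G, the_elem (F - G), the_elem (G - F)) of
           (E, u, v) \<Rightarrow> (insert u E, insert v E)) = a"
      using E uv by (simp add: a i)
    show "(case a of (F, G) \<Rightarrow> (F \<inter> G, the_elem (F - G), the_elem (G - F)))
       \<in> Sigma (ksub V (k - 1)) (\<lambda>E. Sigma (V - E) (\<lambda>u. V - E - {u}))"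
      using E uv by (simp add: a i)
    have "Defs.adj X k F G = ind (faces X k) (insert u (insert v E)) * vsgn E u * vsgn E v"
      unfolding Defs.adj_def i using a(4) E incid_insert[of u E] incid_insert[of v E]
      by (simp add: i ind_def)
    then show "(case case a of (F, G) \<Rightarrow> (F \<inter> G, the_elem (F - G), the_elem (G - F)) of
           (E, u, v) \<Rightarrow> ind (faces X k) (insert u (insert v E)) * (vsgn E u * f (insert u E)) *
             (vsgn E v * g (insert v E))) = (case a of (F, G) \<Rightarrow> Defs.adj X k F G * f F * g G)"
      using uv by (simp add: a(1) i) (simp add: E(1,2))
  next
    fix b assume "b \<in> Sigma (ksub V (k - 1)) (\<lambda>E. Sigma (V - E) (\<lambda>u. V - E - {u}))"
    then obtain E u v where b: "b = (E, u, v)" "E \<in> ksub V (k - 1)" "u \<in> V" "v \<in> V" "u \<notin> E" "v \<notin> E" "u \<noteq> v"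
      by auto
    have i: "insert u E \<inter> insert v E = E" "insert u E - insert v E = {u}" "insert v E - insert u E = {v}"
      using b by auto
    show "(case case b of (E, u, v) \<Rightarrow> (insert u E, insert v E) of
          (F, G) \<Rightarrow> (F \<inter> G, the_elem (F - G), the_elem (G - F))) = b"
      by (simp add: b(1) i)
    have "card (insert u E) = k" "card (insert v E) = k" "card E = k - 1"
      using b ksub_finite_elem[OF V b(2)] k by (auto simp: ksub_def)
    then show "(case b of (E, u, v) \<Rightarrow> (insert u E, insert v E)) \<in> ?P"
      using b by (auto simp: i ksub_def)
  qed
  also have "\<dots> = (\<Sum>E\<in>ksub V (k - 1). \<Sum>(u, v)\<in>Sigma (V - E) (\<lambda>u. V - E - {u}).
       ind (faces X k) (insert u (insert v E)) * (vsgn E u * f (insert u E)) * (vsgn E v * g (insert v E)))"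
    by (rule sum.Sigma[symmetric]) (use V finite_ksub in auto)
  also have "\<dots> = wform V k (ind (faces X k)) f g"
    unfolding wform_def by (intro sum.cong[OF refl] sum.Sigma[symmetric]) (use V in auto)
  finally show ?thesis .
qed

lemma adj_symmetric: "Defs.adj X k F G = Defs.adj X k G F"
  by (simp add: Defs.adj_def Int_commute Un_commute mult.commute)

lemma deg_eq_sum_ind:
  assumes V: "finite V" and F: "F \<in> ksub V k" and S: "faces X k \<subseteq> ksub V (Suc k)"
  shows "real (Defs.deg X k F) = (\<Sum>u\<in>V - F. ind (faces X k) (insert u F))"
proof -
  have "(\<Sum>u\<in>V - F. ind (faces X k) (insert u F)) = (\<Sum>u\<in>{u \<in> V - F. insert u F \<in> faces X k}. 1)"
    using V by (intro sum.mono_neutral_cong_right) (auto simp: ind_def)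
  also have "\<dots> = real (card {u \<in> V - F. insert u F \<in> faces X k})" by simp
  also have "card {u \<in> V - F. insert u F \<in> faces X k} = card {H \<in> faces X k. F \<subseteq> H}"
  proof (rule bij_betw_same_card[of "\<lambda>u. insert u F"], rule bij_betw_imageI)
    show "inj_on (\<lambda>u. insert u F) {u \<in> V - F. insert u F \<in> faces X k}"
      by (auto simp: inj_on_def)
    show "(\<lambda>u. insert u F) ` {u \<in> V - F. insert u F \<in> faces X k} = {H \<in> faces X k. F \<subseteq> H}"
    proof (intro equalityI subsetI)
      fix H assume "H \<in> {H \<in> faces X k. F \<subseteq> H}"
      then have H: "H \<in> faces X k" "F \<subseteq> H" by auto
      then have H': "H \<subseteq> V" "card H = Suc k" "card F = k" using S F by (auto simp: ksub_def)
      have "card (H - F) = 1" using H H' V by (subst card_Diff_subset) (auto intro: finite_subset)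
      then obtain u where u: "H - F = {u}" by (auto simp: card_1_singleton_iff)
      then have "H = insert u F" using H by auto
      then show "H \<in> (\<lambda>u. insert u F) ` {u \<in> V - F. insert u F \<in> faces X k}"
        using H H' u by auto
    qed auto
  qed
  finally show ?thesis by (simp add: Defs.deg_def)
qed

lemma cobound_eq_cob:
  assumes "finite H" "finite (faces X i)" "\<And>u. u \<in> H \<Longrightarrow> H - {u} \<in> faces X i"
  shows "cobound X i f H = cob f H"
proof -
  let ?I = "(\<lambda>u. H - {u}) ` H"
  have "incid H G = 0" if "G \<notin> ?I" for G
  proof (rule ccontr)
    assume "incid H G \<noteq> 0"
    then have G: "G \<subseteq> H" "card (H - G) = 1" by (auto simp: incid_def split: if_splits)
    then obtain u where "H - G = {u}" by (auto simp: card_1_singleton_iff)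
    then have "G = H - {u}" "u \<in> H" using G by auto
    then show False using that by blast
  qed
  then have "cobound X i f H = (\<Sum>G\<in>?I. incid H G * f G)"
    unfolding cobound_def using assms by (intro sum.mono_neutral_right) auto
  also have "\<dots> = (\<Sum>u\<in>H. incid H (H - {u}) * f (H - {u}))"
    by (subst sum.reindex) (auto simp: inj_on_def)
  also have "\<dots> = cob f H"
    unfolding cob_def
  proof (intro sum.cong refl)
    fix u assume "u \<in> H"
    then show "incid H (H - {u}) * f (H - {u}) = vsgn H u * f (H - {u})"
      using incid_insert[of u "H - {u}"] by (simp add: insert_absorb)
  qed
  finally show ?thesis .
qed

lemma cob_sum: "cob (\<lambda>G. \<Sum>j\<in>J. c j * g j G) F = (\<Sum>j\<in>J. c j * cob (g j) F)"
proof -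
  have "cob (\<lambda>G. \<Sum>j\<in>J. c j * g j G) F = (\<Sum>u\<in>F. \<Sum>j\<in>J. c j * (vsgn F u * g j (F - {u})))"
    by (simp add: cob_def sum_distrib_left mult_ac)
  also have "\<dots> = (\<Sum>j\<in>J. \<Sum>u\<in>F. c j * (vsgn F u * g j (F - {u})))" by (rule sum.swap)
  finally show ?thesis by (simp add: cob_def sum_distrib_left)
qed

lemma cob_add_scaled: "cob (\<lambda>G. g G + t * h G) F = cob g F + t * cob h F"
  by (simp add: cob_def distrib_left sum.distrib sum_distrib_left mult_ac)

lemma sum_cob_ind:
  assumes "finite J"
  shows "(\<Sum>G\<in>J. g G * cob (ind {G}) F) = cob (\<lambda>G. if G \<in> J then g G else 0) F"
proof -
  have "(\<lambda>G. \<Sum>j\<in>J. g j * ind {j} G) = (\<lambda>G. if G \<in> J then g G else 0)"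
    using assms by (auto simp: ind_def fun_eq_iff if_distrib[of "\<lambda>x. _ * x"] cong: if_cong)
  then show ?thesis using cob_sum[where J = J and c = g and g = "\<lambda>j. ind {j}" and F = F] by simp
qed

lemma ip_cob_ind:
  assumes "finite V" "G \<in> ksub V m"
  shows "ip (ksub V (Suc m)) (cob (ind {G})) f = bd V f G"
proof -
  have "ip (ksub V (Suc m)) (cob (ind {G})) f = ip (ksub V m) (bd V f) (ind {G})"
    using assms by (simp add: ip_bd_cob ip_commute)
  also have "\<dots> = bd V f G"
    using assms finite_ksub[of V m] by (simp add: ip_def ind_def if_distrib[of "\<lambda>x. _ * x"] cong: if_cong)
  finally show ?thesis .
qed

lemma ip_Cauchy_Schwarz: "\<bar>ip S f g\<bar> \<le> sqrt (ip S f f) * sqrt (ip S g g)"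
proof -
  have "(ip S f g)\<^sup>2 \<le> ip S f f * ip S g g"
    using Cauchy_Schwarz_ineq_sum[of f g S] by (simp add: ip_def power2_eq_square)
  then have "sqrt ((ip S f g)\<^sup>2) \<le> sqrt (ip S f f * ip S g g)" by (rule real_sqrt_le_mono)
  then show ?thesis by (simp add: real_sqrt_mult)
qed

text \<open>The link bound is applied for each \<open>E\<close> to signed vectors, then
  Cauchy-Schwarz over \<open>E\<close>. The factor \<open>k\<close> arises because every face is
  seen from its \<open>k\<close> facets.\<close>

lemma wform_bound:
  assumes V: "finite V" and k: "k \<ge> 1" and \<kappa>: "\<kappa> \<ge> 0"
    and link: "\<And>E x y. E \<in> ksub V (k - 1) \<Longrightarrow>
      \<bar>\<Sum>u\<in>V - E. \<Sum>v\<in>V - E - {u}. \<omega> (insert u (insert v E)) * x u * y v\<bar>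
        \<le> \<kappa> * sqrt (ip (V - E) x x) * sqrt (ip (V - E) y y)"
  shows "\<bar>wform V k \<omega> f g\<bar> \<le> \<kappa> * real k * sqrt (ip (ksub V k) f f) * sqrt (ip (ksub V k) g g)"
proof -
  let ?h = "\<lambda>f E u. vsgn E u * f (insert u E)"
  let ?n = "\<lambda>f E. sqrt (ip (V - E) (?h f E) (?h f E))"
  have n: "(\<Sum>E\<in>ksub V (k - 1). (?n f E)\<^sup>2) = real k * ip (ksub V k) f f" for f
  proof -
    have "(\<Sum>E\<in>ksub V (k - 1). (?n f E)\<^sup>2) = (\<Sum>E\<in>ksub V (k - 1). \<Sum>u\<in>V - E. f (insert u E) * f (insert u E))"
      using ip_self_nonneg by (intro sum.cong) (auto simp: ip_def mult_ac sum_nonneg)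
    also have "\<dots> = real k * ip (ksub V k) f f"
      using sum_ksub_insert_const[OF V, where m = "k - 1" and h = "\<lambda>F. f F * f F"] k by (simp add: ip_def)
    finally show ?thesis .
  qed
  have "\<bar>wform V k \<omega> f g\<bar> \<le> (\<Sum>E\<in>ksub V (k - 1). \<bar>\<Sum>u\<in>V - E. \<Sum>v\<in>V - E - {u}.
     \<omega> (insert u (insert v E)) * ?h f E u * ?h g E v\<bar>)"
    unfolding wform_def by (rule sum_abs)
  also have "\<dots> \<le> (\<Sum>E\<in>ksub V (k - 1). \<kappa> * ?n f E * ?n g E)"
    by (rule sum_mono) (rule link)
  also have "\<dots> = \<kappa> * ip (ksub V (k - 1)) (?n f) (?n g)" by (simp add: ip_def sum_distrib_left mult_ac)
  also have "\<dots> \<le> \<kappa> * (sqrt (ip (ksub V (k - 1)) (?n f) (?n f)) * sqrt (ip (ksub V (k - 1)) (?n g) (?n g)))"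
    using ip_Cauchy_Schwarz[of "ksub V (k - 1)" "?n f" "?n g"] \<kappa> by (intro mult_left_mono) auto
  also have "\<dots> = \<kappa> * (sqrt (real k * ip (ksub V k) f f) * sqrt (real k * ip (ksub V k) g g))"
    using n[of f] n[of g] by (simp add: ip_def power2_eq_square)
  also have "\<dots> = \<kappa> * real k * sqrt (ip (ksub V k) f f) * sqrt (ip (ksub V k) g g)"
    by (simp add: real_sqrt_mult mult_ac)
  finally show ?thesis .
qed

section \<open>Complexes whose adjacency form is close to its mean\<close>

text \<open>The deterministic part: all randomness is condensed into the norm bound
  \<open>err\<close>, later used with \<open>\<kappa>\<close> of order sqrt d. From
  \<open>n \<ge> 2 * k\<close> comes the comparison of \<open>n\<close> with \<open>n - k\<close> up
  to a factor 2.\<close>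

locale concentrated_complex =
  fixes n k :: nat and p \<kappa> :: real and S :: "nat set set"
  assumes k2: "k \<ge> 2" and nk: "n \<ge> 2 * k" and p01: "0 \<le> p" "p \<le> 1"
    and S_cands: "S \<subseteq> LM_cands k n" and \<kappa>0: "\<kappa> \<ge> 0"
    and err: "\<And>f g. \<bar>wform {1..n} k (\<lambda>H. ind S H - p) f g\<bar>
        \<le> \<kappa> * sqrt (ip (ksub {1..n} k) f f) * sqrt (ip (ksub {1..n} k) g g)"
begin

definition "V = {1..n}"
definition "B = ksub V (k - 1)"
text \<open>The faces avoiding vertex 1, the apex of the cone lemmas: they index a linearly
  independent family of coboundaries and the constraints that define its orthogonal complement, the
  cycles.\<close>

definition "J = ksub (V - {1}) (k - 1)"
abbreviation "A \<equiv> ksub V k"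
definition "X = LM_complex k n S"
definition "d = p * real (n - k)"
definition "Q f g = wform V k (ind S) f g"

lemma k1: "k \<ge> 1" and n1: "1 \<in> V" using k2 nk by (auto simp: V_def)

lemma finV [simp]: "finite V" and card_V [simp]: "card V = n"
  by (simp_all add: V_def)

lemma S_ksub: "S \<subseteq> ksub V (Suc k)"
  using S_cands by (auto simp: LM_cands_def ksub_def V_def)

lemma faces_k: "faces X k = S"
  using S_ksub by (auto simp: faces_def X_def LM_complex_def ksub_def V_def)

lemma faces_lower: assumes "i < k" shows "faces X i = ksub V (Suc i)"
  using S_ksub assms by (auto simp: faces_def X_def LM_complex_def ksub_def V_def)

lemma faces_A: "faces X (k - 1) = A"
  using faces_lower[of "k - 1"] k2 by simp

lemma finA: "finite A" and finJ: "finite J"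
  by (simp_all add: finite_ksub J_def)

lemma card_A: "card A = n choose k"
  by (simp add: card_ksub)

lemma card_J: "card J = (n - 1) choose (k - 1)"
  using n1 by (simp add: card_ksub J_def)

lemma choose_split: "n choose k = ((n - 1) choose (k - 1)) + ((n - 1) choose k)"
  using k2 nk by (intro choose_reduce_nat) auto

lemma bil_adj_X: "bil A (Defs.adj X k) f g = Q f g"
  using bil_adj[of V k X f g] k1 by (simp add: Q_def faces_k)

lemma Q_split: "Q f g = p * wform V k (\<lambda>_. 1) f g + wform V k (\<lambda>H. ind S H - p) f g"
  using wform_add[of V k p "\<lambda>_. 1" "\<lambda>H. ind S H - p" f g] by (simp add: Q_def)

lemma W_bd: "wform V k (\<lambda>_. 1) f g = ip (B) (bd V f) (bd V g) - real k * ip A f g"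
  unfolding B_def by (rule wform_one) (use k1 in auto)

lemma W_cob: "wform V k (\<lambda>_. 1) f g = real (n - k) * ip A f g - ip (ksub V (Suc k)) (cob f) (cob g)"
proof -
  have "(\<Sum>F\<in>A. (\<Sum>u\<in>V - F. 1) * f F * g F) = (\<Sum>F\<in>A. real (n - k) * (f F * g F))"
  proof (rule sum.cong[OF refl])
    fix F assume "F \<in> A"
    then have "card (V - F) = n - k"
      using ksub_finite_elem[of V F k] by (subst card_Diff_subset) (auto simp: ksub_def)
    then show "(\<Sum>u\<in>V - F. 1) * f F * g F = real (n - k) * (f F * g F)" by simp
  qed
  then show ?thesis using wform_degree[of V k "\<lambda>_. 1" f g] k1
    by (simp add: ip_def sum_distrib_left)
qed

lemma cob_cob_ksub: "H \<in> ksub V m \<Longrightarrow> cob (cob g) H = 0"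
  by (rule cob_cob) (rule ksub_finite_elem, auto)

lemma err_self: "\<bar>wform V k (\<lambda>H. ind S H - p) f f\<bar> \<le> \<kappa> * ip A f f"
  using err[of f f, folded V_def] ip_self_nonneg[of A f] by (simp add: mult.assoc)

text \<open>The square of the coboundary in \<open>W_cob\<close> is dropped here;
  \<open>Q_ge\<close> drops the square of the boundary in \<open>W_bd\<close>.\<close>

lemma Q_le: "Q f f \<le> (d + \<kappa>) * ip A f f"
proof -
  have "p * wform V k (\<lambda>_. 1) f f \<le> p * (real (n - k) * ip A f f)"
    using p01 ip_self_nonneg by (intro mult_left_mono) (auto simp: W_cob)
  then show ?thesis using err_self[of f] by (simp add: Q_split d_def algebra_simps)
qed

lemma Q_ge: "- (real k + \<kappa>) * ip A f f \<le> Q f f"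
proof -
  have "p * (- (real k * ip A f f)) \<le> p * wform V k (\<lambda>_. 1) f f"
    using p01 ip_self_nonneg[of _ "bd V f"] by (intro mult_left_mono) (auto simp: W_bd)
  moreover have "p * (real k * ip A f f) \<le> 1 * (real k * ip A f f)"
    using p01 ip_self_nonneg[of A f] by (intro mult_right_mono) auto
  ultimately show ?thesis using err_self[of f] by (simp add: Q_split algebra_simps)
qed

lemma W_coboundary: "wform V k (\<lambda>_. 1) f (cob g) = real (n - k) * ip A f (cob g)"
proof -
  have "ip (ksub V (Suc k)) (cob f) (cob (cob g)) = 0"
    unfolding ip_def by (rule sum.neutral) (simp add: cob_cob_ksub)
  then show ?thesis by (simp add: W_cob)
qed

lemma Q_coboundary: "(d - \<kappa>) * ip A (cob g) (cob g) \<le> Q (cob g) (cob g)"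
  using err_self[of "cob g"] by (simp add: Q_split W_coboundary d_def algebra_simps)

lemma Q_cycle:
  assumes "\<And>E. E \<in> B \<Longrightarrow> bd V f E = 0"
  shows "Q f f \<le> \<kappa> * ip A f f"
proof -
  have "ip (B) (bd V f) (bd V f) = 0"
    unfolding ip_def by (rule sum.neutral) (simp add: assms)
  then have "p * wform V k (\<lambda>_. 1) f f \<le> 0"
    using p01 ip_self_nonneg[of A f] by (simp add: W_bd)
  then show ?thesis using err_self[of f] by (simp add: Q_split)
qed

lemma bd_0_from_J:
  assumes "\<And>G. G \<in> J \<Longrightarrow> bd V f G = 0" "E \<in> B"
  shows "bd V f E = 0"
  using bd_eq_0_from_cone[of V 1 "k - 2" f E] n1 assms k2 by (simp add: J_def B_def numeral_2_eq_2 Suc_diff_Suc)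

lemma J_sub: "G \<in> J \<Longrightarrow> G \<in> B"
  by (auto simp: ksub_def J_def B_def)

lemma ip_cob_ind_A: "G \<in> J \<Longrightarrow> ip A (cob (ind {G})) f = bd V f G"
  using ip_cob_ind[of V G "k - 1" f] J_sub k1 by (simp add: B_def)

lemma cob_J_nonzero:
  assumes "\<exists>G\<in>J. g G \<noteq> 0"
  shows "\<exists>F\<in>A. (\<Sum>G\<in>J. g G * cob (ind {G}) F) \<noteq> 0"
proof -
  have "\<exists>F\<in>ksub V (Suc (k - 1)). cob (\<lambda>G. if G \<in> J then g G else 0) F \<noteq> 0"
    by (rule cob_cone_nonzero[of V 1]) (use n1 assms in \<open>auto simp: J_def\<close>)
  then show ?thesis using k1 by (simp add: sum_cob_ind[OF finJ])
qed

text \<open>Four counts suffice: form bounds on the whole space for the two extremes, the span of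
  the coboundaries indexed by \<open>J\<close> for \<open>d - \<gamma>A\<close>, and the cycles, cut
  out by \<open>card J\<close> constraints, for \<open>\<gamma>A\<close>.\<close>

theorem spec_A_holds:
  assumes "real k + \<kappa> \<le> \<gamma>A"
  shows "spec_A k n d \<gamma>A X"
proof -
  obtain v lam where E: "eigensystem A (Defs.adj X k) v lam"
    by (rule symmetric_eigensystem[OF finA]) (rule adj_symmetric)
  let ?b = "(n - 1) choose (k - 1)"
  let ?ev = "eigs_asc A (Defs.adj X k)"
  have len: "length ?ev = card A" using length_eigs_asc[OF finA E] .
  have mono: "c * ip A f f \<le> c' * ip A f f" if "c \<le> c'" for c c' f
    using that ip_self_nonneg by (rule mult_right_mono)
  \<comment> \<open>An empty family of constraints: a form bound on the whole space leaves no
    eigenvalue beyond it. The type \<open>unit\<close> merely names an index type.\<close>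
  have "card {i \<in> A. lam i > d + \<gamma>A} \<le> card ({} :: unit set)"
  proof (rule card_eigenvalues_gt_constraints[OF finA E])
    fix x
    show "bil A (Defs.adj X k) x x \<le> (d + \<gamma>A) * ip A x x"
      using Q_le[of x] mono[of "d + \<kappa>" "d + \<gamma>A" x] assms by (simp add: bil_adj_X)
  qed auto
  then have c1: "card {i \<in> A. lam i > d + \<gamma>A} = 0" by simp
  have "card {i \<in> A. lam i < - \<gamma>A} \<le> card ({} :: unit set)"
  proof (rule card_eigenvalues_lt_constraints[OF finA E])
    fix x
    show "- \<gamma>A * ip A x x \<le> bil A (Defs.adj X k) x x"
      using Q_ge[of x] mono[of "- \<gamma>A" "- (real k + \<kappa>)" x] assms by (simp add: bil_adj_X)
  qed auto
  then have c2: "card {i \<in> A. lam i < - \<gamma>A} = 0" by simp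
  have c3: "card {i \<in> A. lam i < d - \<gamma>A} + card J \<le> card A"
  proof (rule card_eigenvalues_lt_range[OF finA E finJ cob_J_nonzero])
    fix g :: "nat set \<Rightarrow> real"
    let ?g = "\<lambda>G. if G \<in> J then g G else 0"
    have *: "(\<lambda>x. \<Sum>j\<in>J. g j * cob (ind {j}) x) = cob ?g" by (simp add: sum_cob_ind[OF finJ])
    show "(d - \<gamma>A) * ip A (\<lambda>x. \<Sum>j\<in>J. g j * cob (ind {j}) x) (\<lambda>x. \<Sum>j\<in>J. g j * cob (ind {j}) x)
       \<le> bil A (Defs.adj X k) (\<lambda>x. \<Sum>j\<in>J. g j * cob (ind {j}) x) (\<lambda>x. \<Sum>j\<in>J. g j * cob (ind {j}) x)"
      unfolding * bil_adj_X
      using Q_coboundary[of ?g] mono[of "d - \<gamma>A" "d - \<kappa>" "cob ?g"] assms by simp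
  qed
  have c4: "card {i \<in> A. lam i > \<gamma>A} \<le> card J"
  proof (rule card_eigenvalues_gt_constraints[OF finA E finJ])
    fix x assume x: "\<And>j. j \<in> J \<Longrightarrow> ip A (cob (ind {j})) x = 0"
    have "Q x x \<le> \<kappa> * ip A x x"
      by (rule Q_cycle, rule bd_0_from_J) (use x ip_cob_ind_A in auto)
    then show "bil A (Defs.adj X k) x x \<le> \<gamma>A * ip A x x"
      using mono[of \<kappa> \<gamma>A x] assms by (simp add: bil_adj_X)
  qed
  have ev: "eigs_desc A (Defs.adj X k) ! i = ?ev ! (card A - Suc i)" if "i < card A" for i
    using that len by (simp add: eigs_desc_def rev_nth)
  have bN: "?b + ((n - 1) choose k) = card A" by (simp add: card_A choose_split)
  have all: "?ev ! i \<le> d + \<gamma>A" "- \<gamma>A \<le> ?ev ! i" if "i < card A" for i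
    using eigs_asc_le[OF finA E _ that] eigs_asc_ge[OF finA E _ that] c1 c2 by auto
  show ?thesis
    unfolding spec_A_def faces_A Let_def
  proof (intro conjI allI impI)
    show "length (eigs_desc A (Defs.adj X k)) = card A" by (simp add: eigs_desc_def len)
  next
    fix i assume i: "i < ?b"
    then have iA: "i < card A" using bN by simp
    show "d - \<gamma>A \<le> eigs_desc A (Defs.adj X k) ! i"
      unfolding ev[OF iA] by (rule eigs_asc_ge[OF finA E]) (use c3 card_J i iA in auto)
    show "eigs_desc A (Defs.adj X k) ! i \<le> d + \<gamma>A"
      unfolding ev[OF iA] by (rule all) (use iA in auto)
  next
    fix i assume i: "?b \<le> i \<and> i < ?b + ((n - 1) choose k)"
    then have iA: "i < card A" using bN by simp
    show "- \<gamma>A \<le> eigs_desc A (Defs.adj X k) ! i"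
      unfolding ev[OF iA] by (rule all) (use iA in auto)
    show "eigs_desc A (Defs.adj X k) ! i \<le> \<gamma>A"
      unfolding ev[OF iA]
      by (rule eigs_asc_le[OF finA E, where m = "card A - ?b"]) (use c4 card_J i iA bN in arith)+
  qed
qed

end

section \<open>Degree-weighted orthogonality and the gap of the adjacency form\<close>

context concentrated_complex
begin

definition "D F = real (Defs.deg X k F)"

lemma Q_degree:
  "Q f g = (\<Sum>F\<in>A. D F * f F * g F) - (\<Sum>H\<in>ksub V (Suc k). ind S H * cob f H * cob g H)"
proof -
  have "D F = (\<Sum>u\<in>V - F. ind S (insert u F))" if "F \<in> A" for F
    using deg_eq_sum_ind[OF finV that, of X] S_ksub by (simp add: D_def faces_k)
  then show ?thesis unfolding Q_def by (subst wform_degree) (use k1 in auto)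
qed

lemma Q_coboundary_degree: "Q f (cob g) = (\<Sum>F\<in>A. D F * f F * cob g F)"
proof -
  have "(\<Sum>H\<in>ksub V (Suc k). ind S H * cob f H * cob (cob g) H) = 0"
    by (rule sum.neutral) (simp add: cob_cob_ksub)
  then show ?thesis by (simp add: Q_degree)
qed

lemma Q_le_degree: "Q f f \<le> (\<Sum>F\<in>A. D F * f F * f F)"
proof -
  have "0 \<le> (\<Sum>H\<in>ksub V (Suc k). ind S H * cob f H * cob f H)"
    by (rule sum_nonneg) (auto simp: ind_def)
  then show ?thesis by (simp add: Q_degree)
qed

lemma ip_bd_cob_A: "ip B (bd V f) g = ip A f (cob g)"
  using ip_bd_cob[of V "k - 1" f g] k1 by (simp add: B_def)

text \<open>Coboundaries \<open>b\<close> satisfy both \<open>A b = D b\<close> and, up to the error term, \<open>A b = d b\<close>. Hence a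
  cochain that is orthogonal to them in the degree-weighted inner product is almost orthogonal
  to them in the unweighted one, although individual degrees may deviate from \<open>d\<close> by a
  constant factor.\<close>

lemma bd_norm_bound:
  assumes d: "d > 0" and orth: "\<And>g. (\<Sum>F\<in>A. D F * f F * cob g F) = 0"
  shows "p * ip B (bd V f) (bd V f) \<le> 2 * \<kappa>\<^sup>2 / d * ip A f f"
proof -
  define b where "b = cob (bd V f)"
  define \<beta> where "\<beta> = ip B (bd V f) (bd V f)"
  have \<beta>: "\<beta> = ip A f b" "\<beta> \<ge> 0"
    unfolding \<beta>_def b_def by (rule ip_bd_cob_A) (rule ip_self_nonneg)
  have W: "wform V k (\<lambda>_. 1) f b = real (n - k) * \<beta>" by (simp add: b_def W_coboundary \<beta>(1))
  \<comment> \<open>Paired with a coboundary, the complete form is both \<open>n - k\<close> times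
    the inner product and the boundary product minus \<open>k\<close> times it. So the boundary
    product is \<open>n\<close> times the inner product.\<close>
  have "ip A b b = ip B (bd V f) (bd V b)"
    unfolding b_def by (subst ip_commute[of B]) (simp add: ip_bd_cob_A)
  also have "\<dots> = real (n - k) * \<beta> + real k * \<beta>" using W by (simp add: W_bd \<beta>(1))
  also have "\<dots> = real n * \<beta>" using nk by (simp add: of_nat_diff algebra_simps)
  finally have bb: "ip A b b = real n * \<beta>" .
  \<comment> \<open>This vanishing compared with \<open>Q f b = d * \<beta> + error\<close> bounds
    \<open>d * \<beta>\<close> by \<open>\<kappa>\<close> times the norms of \<open>f\<close> and
    \<open>b\<close>. As the latter is the root of \<open>n * \<beta>\<close>, squaring and
    cancelling one \<open>\<beta>\<close> gives the estimate.\<close>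
  have "Q f b = 0" using orth[of "bd V f"] Q_coboundary_degree[of f "bd V f"] by (simp add: b_def)
  then have "0 = d * \<beta> + wform V k (\<lambda>H. ind S H - p) f b"
    using Q_split[of f b] W by (simp add: d_def)
  then have "d * \<beta> \<le> \<kappa> * sqrt (ip A f f) * sqrt (real n * \<beta>)"
    using err[of f b, folded V_def] unfolding bb by linarith
  then have "(d * \<beta>)\<^sup>2 \<le> (\<kappa> * sqrt (ip A f f) * sqrt (real n * \<beta>))\<^sup>2"
    using d \<beta> by (intro power_mono) auto
  also have "\<dots> = \<kappa>\<^sup>2 * ip A f f * (real n * \<beta>)"
    using \<beta> ip_self_nonneg[of A f] by (simp add: power_mult_distrib)
  finally have *: "(d\<^sup>2 * \<beta>) * \<beta> \<le> (\<kappa>\<^sup>2 * ip A f f * real n) * \<beta>"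
    by (simp add: power2_eq_square mult_ac)
  have "d\<^sup>2 * \<beta> \<le> \<kappa>\<^sup>2 * ip A f f * real n"
  proof (cases "\<beta> = 0")
    case False
    then show ?thesis using * \<beta>(2) by (simp add: mult_le_cancel_right)
  qed (simp add: ip_self_nonneg)
  then have "p * (d\<^sup>2 * \<beta>) \<le> p * (\<kappa>\<^sup>2 * ip A f f * real n)" using p01 by (intro mult_left_mono)
  also have "\<dots> = (p * real n) * (\<kappa>\<^sup>2 * ip A f f)" by simp
  also have "\<dots> \<le> (2 * d) * (\<kappa>\<^sup>2 * ip A f f)"
  proof (intro mult_right_mono)
    have "p * real n \<le> p * (2 * real (n - k))"
      using p01 nk by (intro mult_left_mono) (auto simp: of_nat_diff)
    then show "p * real n \<le> 2 * d" by (simp add: d_def)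
  qed (simp add: ip_self_nonneg)
  finally have "d * (d * (p * \<beta>)) \<le> d * (2 * \<kappa>\<^sup>2 * ip A f f)" by (simp add: power2_eq_square mult_ac)
  then have "d * (p * \<beta>) \<le> 2 * \<kappa>\<^sup>2 * ip A f f" using d by simp
  then show ?thesis using d by (simp add: \<beta>_def field_simps)
qed

text \<open>By \<open>W_bd\<close> the form consists of \<open>p\<close> times the boundary square,
  just bounded, a term between \<open>- k\<close> and 0 times the squared norm, and the
  error.\<close>

lemma Q_gap:
  assumes d: "d > 0" and orth: "\<And>g. (\<Sum>F\<in>A. D F * f F * cob g F) = 0"
  shows "\<bar>Q f f\<bar> \<le> (real k + \<kappa> + 2 * \<kappa>\<^sup>2 / d) * ip A f f"
proof -
  have "p * (real k * ip A f f) \<le> 1 * (real k * ip A f f)"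
    using p01 ip_self_nonneg[of A f] by (intro mult_right_mono) auto
  moreover have "0 \<le> p * (real k * ip A f f)" "0 \<le> p * ip B (bd V f) (bd V f)"
    by (simp_all add: p01 ip_self_nonneg)
  ultimately show ?thesis using bd_norm_bound[OF assms] err_self[of f]
    by (simp add: Q_split W_bd algebra_simps)
qed

text \<open>Weighted orthogonality of \<open>f\<close> to all coboundaries says that
  \<open>D F * f F\<close> is a cycle, and cycles are tested on \<open>J\<close>.\<close>

lemma orth_from_J:
  assumes "\<And>G. G \<in> J \<Longrightarrow> (\<Sum>F\<in>A. D F * f F * cob (ind {G}) F) = 0"
  shows "(\<Sum>F\<in>A. D F * f F * cob g F) = 0"
proof -
  let ?h = "\<lambda>F. D F * f F"
  have "bd V ?h G = 0" if "G \<in> J" for G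
    using assms[OF that] ip_cob_ind_A[OF that, of ?h] by (simp add: ip_def mult_ac)
  then have "bd V ?h E = 0" if "E \<in> B" for E using bd_0_from_J that by blast
  then have "ip B (bd V ?h) g = 0" by (simp add: ip_def)
  then show ?thesis by (simp add: ip_bd_cob_A) (simp add: ip_def)
qed

end

text \<open>The bound on \<open>\<gamma>D\<close> is the constant of \<open>Q_gap\<close> divided by
  the smallest degree. With \<open>\<kappa>\<close> of order sqrt d and \<open>\<delta>\<close> of
  order d it is of order 1 / sqrt d.\<close>

locale concentrated_complex_degree = concentrated_complex +
  fixes \<delta> \<gamma>D :: real
  assumes d_pos: "p * real (n - k) > 0" and \<delta>: "\<delta> > 0"
    and deg_ge: "\<And>F. F \<in> ksub {1..n} k \<Longrightarrow> real (Defs.deg (LM_complex k n S) k F) \<ge> \<delta>"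
    and \<gamma>D: "(real k + \<kappa> + 2 * \<kappa>\<^sup>2 / (p * real (n - k))) / \<delta> \<le> \<gamma>D"
begin

lemma D_ge: "F \<in> A \<Longrightarrow> D F \<ge> \<delta>"
  using deg_ge by (simp add: D_def X_def V_def)

lemma D_pos: "F \<in> A \<Longrightarrow> D F > 0"
  using D_ge \<delta> by fastforce

lemma Q_gap_degree:
  assumes "\<And>G. G \<in> J \<Longrightarrow> (\<Sum>F\<in>A. D F * f F * cob (ind {G}) F) = 0"
  shows "\<bar>Q f f\<bar> \<le> \<gamma>D * (\<Sum>F\<in>A. D F * f F * f F)"
proof -
  let ?c = "real k + \<kappa> + 2 * \<kappa>\<^sup>2 / d"
  have d: "d > 0" using d_pos unfolding d_def .
  have "\<delta> * ip A f f \<le> (\<Sum>F\<in>A. D F * f F * f F)"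
    unfolding ip_def sum_distrib_left
    by (rule sum_mono) (use D_ge in \<open>auto intro!: mult_right_mono simp: mult.assoc\<close>)
  then have "ip A f f \<le> (\<Sum>F\<in>A. D F * f F * f F) / \<delta>" using \<delta> by (simp add: field_simps)
  moreover have "?c \<ge> 0" using \<kappa>0 d by simp
  moreover have "\<bar>Q f f\<bar> \<le> ?c * ip A f f" using d orth_from_J[OF assms] by (rule Q_gap)
  ultimately have "\<bar>Q f f\<bar> \<le> ?c * ((\<Sum>F\<in>A. D F * f F * f F) / \<delta>)"
    by (meson mult_left_mono order_trans)
  also have "\<dots> = ?c / \<delta> * (\<Sum>F\<in>A. D F * f F * f F)" by simp
  also have "\<dots> \<le> \<gamma>D * (\<Sum>F\<in>A. D F * f F * f F)"
  proof (rule mult_right_mono)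
    show "?c / \<delta> \<le> \<gamma>D" using \<gamma>D unfolding d_def .
    show "0 \<le> (\<Sum>F\<in>A. D F * f F * f F)"
      by (rule sum_nonneg) (auto simp: mult.assoc D_def)
  qed
  finally show ?thesis .
qed

lemma \<gamma>D_nonneg: "\<gamma>D \<ge> 0"
proof -
  have "0 \<le> (real k + \<kappa> + 2 * \<kappa>\<^sup>2 / (p * real (n - k))) / \<delta>"
    using \<kappa>0 less_imp_le[OF d_pos] \<delta> by (intro divide_nonneg_pos add_nonneg_nonneg divide_nonneg_nonneg) auto
  then show ?thesis using \<gamma>D by linarith
qed

text \<open>Conjugating by the square roots of the degrees makes the up-Laplacian symmetric.\<close>

definition "sD F = sqrt (D F)"
definition "symlap F G = (if F = G then 1 else 0) - Defs.adj X k F G / (sD F * sD G)"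

lemma sD: "F \<in> A \<Longrightarrow> sD F > 0" "F \<in> A \<Longrightarrow> sD F * sD F = D F"
  using D_pos by (simp_all add: sD_def less_imp_le)

lemma eigs_asc_uplap: "eigs_asc A (uplap X k) = eigs_asc A symlap"
proof -
  have "charpoly A symlap = charpoly A (uplap X k)"
  proof (rule charpoly_diagonal_conjugation[OF finA])
    fix F G assume F: "F \<in> A" and G: "G \<in> A"
    show "symlap F G = sD F * uplap X k F G / sD G"
    proof (cases "F = G")
      case True
      then show ?thesis using sD[OF F] sD[OF G]
        by (simp add: symlap_def uplap_def flip: D_def)
    next
      case False
      have "uplap X k F G = - Defs.adj X k F G / (sD F * sD F)"
        using False sD[OF F] by (simp add: uplap_def flip: D_def)
      then show ?thesis using False sD(1)[OF F] sD(1)[OF G] by (simp add: symlap_def)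
    qed
  qed (use sD(1) in force)
  then show ?thesis by (simp add: eigs_asc_def)
qed

lemma bil_symlap: "bil A symlap x y = ip A x y - Q (\<lambda>F. x F / sD F) (\<lambda>F. y F / sD F)"
proof -
  have "bil A symlap x y = (\<Sum>F\<in>A. \<Sum>G\<in>A. (if F = G then x F * y G else 0) -
      Defs.adj X k F G * (x F / sD F) * (y G / sD G))"
    unfolding bil_def by (intro sum.cong refl) (auto simp: symlap_def left_diff_distrib)
  also have "\<dots> = (\<Sum>F\<in>A. \<Sum>G\<in>A. (if F = G then x F * y G else 0)) -
      bil A (Defs.adj X k) (\<lambda>F. x F / sD F) (\<lambda>F. y F / sD F)"
    by (simp add: sum_subtractf bil_def)
  also have "(\<Sum>F\<in>A. \<Sum>G\<in>A. (if F = G then x F * y G else 0)) = ip A x y"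
    using finA by (simp add: ip_def)
  finally show ?thesis by (simp add: bil_adj_X)
qed

lemma ip_sD: "ip A x y = (\<Sum>F\<in>A. D F * (x F / sD F) * (y F / sD F))"
  unfolding ip_def
proof (rule sum.cong[OF refl])
  fix F assume F: "F \<in> A"
  show "x F * y F = D F * (x F / sD F) * (y F / sD F)"
    using sD[OF F] by (simp flip: sD(2)[OF F])
qed

text \<open>Against a coboundary the adjacency form equals the degree form, which in the symmetrised
  coordinates is \<open>ip\<close>; the two terms of \<open>bil_symlap\<close> cancel. These vectors
  thus lie in the kernel.\<close>

lemma bil_symlap_coboundary: "bil A symlap x (\<lambda>F. sD F * cob g F) = 0"
proof -
  let ?y = "\<lambda>F. sD F * cob g F"
  have y: "?y F / sD F = cob g F" if "F \<in> A" for F using sD[OF that] by simp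
  have "Q (\<lambda>F. x F / sD F) (\<lambda>F. ?y F / sD F) = Q (\<lambda>F. x F / sD F) (cob g)"
    unfolding bil_adj_X[symmetric] bil_def by (intro sum.cong refl) (simp add: y)
  also have "\<dots> = (\<Sum>F\<in>A. D F * (x F / sD F) * cob g F)" by (rule Q_coboundary_degree)
  also have "\<dots> = ip A x ?y" unfolding ip_sD by (intro sum.cong refl) (simp add: y)
  finally show ?thesis by (simp add: bil_symlap)
qed

lemma symlap_gap:
  assumes "\<And>G. G \<in> J \<Longrightarrow> ip A (\<lambda>F. sD F * cob (ind {G}) F) x = 0"
  shows "(1 - \<gamma>D) * ip A x x \<le> bil A symlap x x" "bil A symlap x x \<le> (1 + \<gamma>D) * ip A x x"
proof -
  let ?f = "\<lambda>F. x F / sD F"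
  have "(\<Sum>F\<in>A. D F * ?f F * cob (ind {G}) F) = 0" if "G \<in> J" for G
  proof -
    have "(\<Sum>F\<in>A. D F * ?f F * cob (ind {G}) F) = ip A (\<lambda>F. sD F * cob (ind {G}) F) x"
      unfolding ip_def
    proof (rule sum.cong[OF refl])
      fix F assume F: "F \<in> A"
      show "D F * ?f F * cob (ind {G}) F = sD F * cob (ind {G}) F * x F"
        using sD[OF F] by (simp flip: sD(2)[OF F])
    qed
    then show ?thesis using assms that by simp
  qed
  then have "\<bar>Q ?f ?f\<bar> \<le> \<gamma>D * ip A x x" unfolding ip_sD by (rule Q_gap_degree)
  then show "(1 - \<gamma>D) * ip A x x \<le> bil A symlap x x" "bil A symlap x x \<le> (1 + \<gamma>D) * ip A x x"
    by (simp_all add: bil_symlap algebra_simps abs_le_iff)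
qed

lemma symlap_nonneg: "0 \<le> bil A symlap x x"
  using Q_le_degree[of "\<lambda>F. x F / sD F"] by (simp add: bil_symlap ip_sD)

lemma sum_sD_cob:
  "(\<Sum>G\<in>J. g G * (sD F * cob (ind {G}) F)) = sD F * cob (\<lambda>G. if G \<in> J then g G else 0) F"
proof -
  have "(\<Sum>G\<in>J. g G * (sD F * cob (ind {G}) F)) = sD F * (\<Sum>G\<in>J. g G * cob (ind {G}) F)"
    by (simp add: sum_distrib_left mult.left_commute)
  then show ?thesis by (simp add: sum_cob_ind[OF finJ])
qed

text \<open>The symmetrised matrix is positive semidefinite and its form vanishes on a space of
  dimension \<open>card J\<close>, which gives the zeros. On the orthogonal complement
  \<open>symlap_gap\<close> applies.\<close>

lemma uplap_spectrum:
  "length (eigs_asc A (uplap X k)) = card A"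
  "i < (n - 1) choose (k - 1) \<Longrightarrow> eigs_asc A (uplap X k) ! i = 0"
  "(n - 1) choose (k - 1) \<le> i \<Longrightarrow> i < card A \<Longrightarrow> 1 - \<gamma>D \<le> eigs_asc A (uplap X k) ! i"
  "i < card A \<Longrightarrow> eigs_asc A (uplap X k) ! i \<le> 1 + \<gamma>D"
proof -
  have sym: "symlap F G = symlap G F" for F G
    using adj_symmetric[of X k F G] by (simp add: symlap_def mult.commute)
  obtain v lam where E: "eigensystem A symlap v lam"
    by (rule symmetric_eigensystem[OF finA]) (rule sym)
  show "length (eigs_asc A (uplap X k)) = card A"
    unfolding eigs_asc_uplap by (rule length_eigs_asc[OF finA E])
  have lam: "lam i = bil A symlap (v i) (v i)" "ip A (v i) (v i) = 1"
    "bil A symlap w (v i) = lam i * ip A w (v i)" if "i \<in> A" for i w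
  proof -
    show *: "bil A symlap w (v i) = lam i * ip A w (v i)" for w
    proof -
      have "(\<Sum>G\<in>A. symlap F G * v i G) = lam i * v i F" if "F \<in> A" for F
        using E that \<open>i \<in> A\<close> unfolding eigensystem_def by blast
      then have "bil A symlap w (v i) = ip A w (\<lambda>x. lam i * v i x)"
        unfolding bil_eq_ip ip_def by (intro sum.cong) simp_all
      then show ?thesis by (simp add: ip_def sum_distrib_left mult_ac)
    qed
    show **: "ip A (v i) (v i) = 1" using E that by (simp add: eigensystem_def)
    show "lam i = bil A symlap (v i) (v i)" by (simp add: * **)
  qed
  have lam0: "lam i \<ge> 0" if "i \<in> A" for i using lam(1)[OF that] symlap_nonneg by simp
  \<comment> \<open>An eigenvector with nonzero eigenvalue is orthogonal to the kernel, hence to all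
    rescaled coboundaries, so the upper half of the gap applies to it.\<close>
  have lam_le: "lam i \<le> 1 + \<gamma>D" if i: "i \<in> A" for i
  proof (cases "lam i = 0")
    case True
    then show ?thesis using \<gamma>D_nonneg by simp
  next
    case False
    have "ip A (\<lambda>F. sD F * cob g F) (v i) = 0" for g
    proof -
      have "lam i * ip A (\<lambda>F. sD F * cob g F) (v i) = bil A symlap (\<lambda>F. sD F * cob g F) (v i)"
        using lam(3)[OF i] by simp
      also have "\<dots> = bil A symlap (v i) (\<lambda>F. sD F * cob g F)" using sym by (intro bil_commute)
      finally show ?thesis using False by (simp add: bil_symlap_coboundary)
    qed
    then have "bil A symlap (v i) (v i) \<le> (1 + \<gamma>D) * ip A (v i) (v i)" by (rule symlap_gap(2))
    then show ?thesis unfolding lam(1)[OF i, symmetric] lam(2)[OF i] by simp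
  qed
  have "\<not> (i \<in> A \<and> lam i < 0)" "\<not> (i \<in> A \<and> lam i > 1 + \<gamma>D)" for i
    using lam0[of i] lam_le[of i] by auto
  then have "{i \<in> A. lam i < 0} = {}" "{i \<in> A. lam i > 1 + \<gamma>D} = {}" by blast+
  then have c: "card {i \<in> A. lam i < 0} = 0" "card {i \<in> A. lam i > 1 + \<gamma>D} = 0"
    by (simp_all only: card.empty)
  have c3: "card {i \<in> A. lam i > 0} + card J \<le> card A"
  proof (rule card_eigenvalues_gt_range[OF finA E finJ, where u = "\<lambda>G F. sD F * cob (ind {G}) F"])
    fix g :: "nat set \<Rightarrow> real"
    assume "\<exists>G\<in>J. g G \<noteq> 0"
    from cob_J_nonzero[OF this] obtain F where F: "F \<in> A" "cob (\<lambda>G. if G \<in> J then g G else 0) F \<noteq> 0"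
      unfolding sum_cob_ind[OF finJ] by blast
    then show "\<exists>F\<in>A. (\<Sum>G\<in>J. g G * (sD F * cob (ind {G}) F)) \<noteq> 0"
      unfolding sum_sD_cob using sD(1)[OF F(1)] by (intro bexI[of _ F]) auto
  next
    fix g :: "nat set \<Rightarrow> real"
    show "bil A symlap (\<lambda>F. \<Sum>G\<in>J. g G * (sD F * cob (ind {G}) F)) (\<lambda>F. \<Sum>G\<in>J. g G * (sD F * cob (ind {G}) F))
       \<le> 0 * ip A (\<lambda>F. \<Sum>G\<in>J. g G * (sD F * cob (ind {G}) F)) (\<lambda>F. \<Sum>G\<in>J. g G * (sD F * cob (ind {G}) F))"
      unfolding sum_sD_cob by (simp add: bil_symlap_coboundary)
  qed
  have c4: "card {i \<in> A. lam i < 1 - \<gamma>D} \<le> card J"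
    by (rule card_eigenvalues_lt_constraints[OF finA E finJ]) (rule symlap_gap(1))
  show "eigs_asc A (uplap X k) ! i = 0" if "i < (n - 1) choose (k - 1)" for i
  proof -
    have "card {i \<in> A. lam i > 0} + (n - 1 choose (k - 1)) \<le> card A" using c3 card_J by simp
    from eigs_asc_le[OF finA E this that] have "eigs_asc A symlap ! i \<le> 0" .
    moreover have "i < card A" using that by (simp add: card_A choose_split)
    then have "0 \<le> eigs_asc A symlap ! i" by (intro eigs_asc_ge[OF finA E]) (simp_all add: c)
    ultimately show ?thesis by (simp add: eigs_asc_uplap)
  qed
  show "1 - \<gamma>D \<le> eigs_asc A (uplap X k) ! i" if "(n - 1) choose (k - 1) \<le> i" "i < card A" for i
    unfolding eigs_asc_uplap by (rule eigs_asc_ge[OF finA E]) (use that c4 card_J in auto)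
  show "eigs_asc A (uplap X k) ! i \<le> 1 + \<gamma>D" if "i < card A" for i
    unfolding eigs_asc_uplap by (rule eigs_asc_le[OF finA E _ that]) (simp add: c)
qed

text \<open>Some nontrivial combination \<open>h\<close> of a cocycle \<open>f\<close> and the
  coboundaries indexed by \<open>J\<close> is weighted-orthogonal to all coboundaries. Since
  \<open>h\<close> is a cocycle, \<open>Q h h\<close> equals its degree norm; a gap constant below 1
  then forces \<open>h = 0\<close>. The coefficient of \<open>f\<close> is nonzero because the
  coboundaries are independent, so \<open>f\<close> is a coboundary.\<close>

lemma cohom_vanishes_X:
  assumes "\<gamma>D < 1"
  shows "cohom_vanishes X (k - 2)"
proof -
  have kk: "k - 2 + 2 = k" "k - 2 + 1 = k - 1" "Suc (k - 2) = k - 1" using k2 by auto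
  have fB: "faces X (k - 2) = B" using faces_lower[of "k - 2"] k2 kk by (simp add: B_def)
  have cob_k: "cobound X (k - 1) f H = cob f H" if "H \<in> S" for f H
  proof (rule cobound_eq_cob)
    show "finite H" using that S_ksub ksub_finite_elem[of V H "Suc k"] by auto
    then show "H - {u} \<in> faces X (k - 1)" if "u \<in> H" for u
      using that \<open>H \<in> S\<close> S_ksub unfolding faces_A by (auto simp: ksub_def)
    show "finite (faces X (k - 1))" unfolding faces_A by (rule finA)
  qed
  have cob_k1: "cobound X (k - 2) g F = cob g F" if "F \<in> A" for g F
  proof (rule cobound_eq_cob)
    show "finite F" using that ksub_finite_elem[of V F k] by auto
    then show "F - {u} \<in> faces X (k - 2)" if "u \<in> F" for u
      using that \<open>F \<in> A\<close> k1 unfolding fB B_def by (auto simp: ksub_def)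
  qed (simp add: fB B_def finite_ksub)
  have "\<exists>g. \<forall>F\<in>A. f F = cob g F" if f: "\<And>H. H \<in> S \<Longrightarrow> cob f H = 0" for f
  proof -
    \<comment> \<open>\<open>None\<close> labels the cocycle and \<open>Some G\<close> the
      generators: one unknown more than there are constraints.\<close>
    define I where "I = insert None (Some ` J)"
    define w where "w j = (case j of None \<Rightarrow> f | Some G \<Rightarrow> cob (ind {G}))" for j
    have "card J < card I" using finJ by (simp add: I_def card_image)
    then obtain c where c: "\<exists>j\<in>I. c j \<noteq> 0"
      "\<forall>G\<in>J. (\<Sum>j\<in>I. (\<Sum>F\<in>A. D F * w j F * cob (ind {G}) F) * c j) = 0"
      using homogeneous_system_nontrivial[of J I "\<lambda>G j. \<Sum>F\<in>A. D F * w j F * cob (ind {G}) F"] finJ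
      by (auto simp: I_def)
    define g where "g = (\<lambda>G. if G \<in> J then c (Some G) else 0)"
    define h where "h = (\<lambda>F. cob g F + c None * f F)"
    have h: "(\<Sum>j\<in>I. w j F * c j) = h F" for F
    proof -
      have "(\<Sum>j\<in>I. w j F * c j) = f F * c None + (\<Sum>j\<in>Some ` J. w j F * c j)"
        unfolding I_def using finJ by (subst sum.insert) (auto simp: w_def)
      also have "(\<Sum>j\<in>Some ` J. w j F * c j) = (\<Sum>G\<in>J. c (Some G) * cob (ind {G}) F)"
        by (subst sum.reindex) (auto simp: w_def mult.commute)
      also have "\<dots> = cob g F" unfolding g_def by (rule sum_cob_ind[OF finJ])
      finally show ?thesis by (simp add: h_def)
    qed
    have "(\<Sum>F\<in>A. D F * h F * cob (ind {G}) F) = 0" if "G \<in> J" for G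
    proof -
      have "0 = (\<Sum>j\<in>I. \<Sum>F\<in>A. D F * w j F * cob (ind {G}) F * c j)"
        using c(2) that by (simp add: sum_distrib_right)
      also have "\<dots> = (\<Sum>F\<in>A. \<Sum>j\<in>I. D F * w j F * cob (ind {G}) F * c j)" by (rule sum.swap)
      also have "\<dots> = (\<Sum>F\<in>A. D F * (\<Sum>j\<in>I. w j F * c j) * cob (ind {G}) F)"
        by (simp add: sum_distrib_left sum_distrib_right mult_ac)
      finally show ?thesis by (simp add: h)
    qed
    then have "\<bar>Q h h\<bar> \<le> \<gamma>D * (\<Sum>F\<in>A. D F * h F * h F)" by (rule Q_gap_degree)
    moreover have "Q h h = (\<Sum>F\<in>A. D F * h F * h F)"
    proof -
      have "cob h H = 0" if "H \<in> S" for H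
        using that f[OF that] S_ksub cob_cob_ksub[of H "Suc k" g]
        by (auto simp: h_def cob_add_scaled)
      then have "(\<Sum>H\<in>ksub V (Suc k). ind S H * cob h H * cob h H) = 0"
        by (intro sum.neutral) (auto simp: ind_def)
      then show ?thesis by (simp add: Q_degree)
    qed
    moreover have nn: "0 \<le> D F * h F * h F" for F by (simp add: D_def mult.assoc)
    moreover have "0 \<le> (\<Sum>F\<in>A. D F * h F * h F)" by (rule sum_nonneg) (rule nn)
    ultimately have "(\<Sum>F\<in>A. D F * h F * h F) * (1 - \<gamma>D) \<le> 0" by (simp add: algebra_simps)
    then have "(\<Sum>F\<in>A. D F * h F * h F) \<le> 0" using assms by (simp add: mult_le_0_iff)
    with \<open>0 \<le> (\<Sum>F\<in>A. D F * h F * h F)\<close> have "(\<Sum>F\<in>A. D F * h F * h F) = 0" by simp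
    then have "\<forall>F\<in>A. D F * h F * h F = 0" using finA nn by (simp add: sum_nonneg_eq_0_iff)
    then have h0: "h F = 0" if "F \<in> A" for F using that D_pos[OF that] by auto
    have "c None \<noteq> 0"
    proof
      assume cN: "c None = 0"
      then have "\<exists>G\<in>J. c (Some G) \<noteq> 0" using c(1) by (auto simp: I_def)
      from cob_J_nonzero[OF this] obtain F where "F \<in> A" "cob g F \<noteq> 0"
        unfolding sum_cob_ind[OF finJ] g_def by blast
      then show False using h0[of F] cN by (simp add: h_def)
    qed
    then have "f F = cob (\<lambda>G. 0 + (- 1 / c None) * g G) F" if "F \<in> A" for F
      unfolding cob_add_scaled using h0[OF that]
      by (simp add: h_def field_simps add_eq_0_iff) (simp add: cob_def)
    then show ?thesis by blast
  qed
  note exact = this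
  show ?thesis
    unfolding cohom_vanishes_def kk faces_k faces_A
  proof (intro allI impI)
    fix f assume "\<forall>H\<in>S. cobound X (k - 1) f H = 0"
    then have "\<exists>g. \<forall>F\<in>A. f F = cob g F" by (intro exact) (simp add: cob_k[simplified])
    then show "\<exists>g. \<forall>F\<in>A. f F = cobound X (k - 2) g F" by (simp add: cob_k1)
  qed
qed

text \<open>The complete lower skeleton extends every smaller face to a set of size
  \<open>k\<close>, and its positive degree puts it into a face of size
  \<open>k + 1\<close>.\<close>

lemma pure_X: "pure X k"
  unfolding pure_def
proof (intro ballI impI)
  fix F assume F: "F \<in> X" and max: "\<forall>H\<in>X. F \<subseteq> H \<longrightarrow> H = F"
  show "card F = k + 1"
  proof (cases "F \<in> S")
    case True
    then show ?thesis using S_ksub by (auto simp: ksub_def)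
  next
    case False
    then have F': "F \<subseteq> V" "card F \<le> k" using F by (auto simp: X_def LM_complex_def V_def)
    have "\<exists>G. F \<subseteq> G \<and> G \<subseteq> V \<and> card G = k"
      using F' nk by (intro exists_subset_between) auto
    then obtain G where G: "F \<subseteq> G" "G \<in> A" by (auto simp: ksub_def)
    have "Defs.deg X k G > 0" using D_pos[OF G(2)] by (simp add: D_def)
    then obtain H where H: "H \<in> faces X k" "G \<subseteq> H"
      unfolding Defs.deg_def card_gt_0_iff by blast
    then have "H \<in> X" "card H = k + 1" by (auto simp: faces_def)
    then show ?thesis using max G H by auto
  qed
qed

theorem spec_L_holds:
  assumes "\<gamma>D < 1"
  shows "spec_L k n \<gamma>D X"
  unfolding spec_L_def faces_A Let_def
  using pure_X cohom_vanishes_X[OF assms] uplap_spectrum card_A choose_split by auto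

end

section \<open>Expectations over binomial random subsets\<close>

text \<open>The weights are those of \<open>LM_prob\<close>, so probabilities there are values of
  \<open>bexp\<close> at indicators.\<close>

definition bexp :: "'a set \<Rightarrow> real \<Rightarrow> ('a set \<Rightarrow> real) \<Rightarrow> real" where
  "bexp U p f = (\<Sum>S\<in>Pow U. p ^ card S * (1 - p) ^ (card U - card S) * f S)"

lemma bexp_sum: "bexp U p (\<lambda>S. \<Sum>i\<in>I. f i S) = (\<Sum>i\<in>I. bexp U p (f i))"
  unfolding bexp_def sum_distrib_left by (rule sum.swap)

lemma bexp_cmult: "bexp U p (\<lambda>S. c * f S) = c * bexp U p f"
  by (simp add: bexp_def sum_distrib_left mult_ac)

lemma bexp_add: "bexp U p (\<lambda>S. f S + g S) = bexp U p f + bexp U p g"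
  by (simp add: bexp_def distrib_left sum.distrib)

lemma bexp_mono:
  assumes "0 \<le> p" "p \<le> 1" "\<And>S. S \<subseteq> U \<Longrightarrow> f S \<le> g S"
  shows "bexp U p f \<le> bexp U p g"
  unfolding bexp_def using assms by (intro sum_mono mult_left_mono) auto

lemma bexp_cong: "(\<And>S. S \<subseteq> U \<Longrightarrow> f S = g S) \<Longrightarrow> bexp U p f = bexp U p g"
  unfolding bexp_def by (intro sum.cong) auto

text \<open>Independence: expanding the product of two-term factors yields one summand for each
  subset of \<open>U\<close>.\<close>

lemma bexp_prod:
  fixes g :: "'a \<Rightarrow> bool \<Rightarrow> real"
  assumes U: "finite U"
  shows "bexp U p (\<lambda>S. \<Prod>u\<in>U. g u (u \<in> S)) = (\<Prod>u\<in>U. p * g u True + (1 - p) * g u False)"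
proof -
  have "p ^ card S * (1 - p) ^ (card U - card S) * (\<Prod>u\<in>U. g u (u \<in> S)) =
      (\<Prod>u\<in>S. p * g u True) * (\<Prod>u\<in>U - S. (1 - p) * g u False)" if S: "S \<subseteq> U" for S
  proof -
    have fS: "finite S" using S U by (rule finite_subset)
    have "(\<Prod>u\<in>U. g u (u \<in> S)) = (\<Prod>u\<in>U - S. g u (u \<in> S)) * (\<Prod>u\<in>S. g u (u \<in> S))"
      using U S by (intro prod.subset_diff) auto
    also have "\<dots> = (\<Prod>u\<in>U - S. g u False) * (\<Prod>u\<in>S. g u True)" by simp
    finally show ?thesis using S U fS by (simp add: prod.distrib card_Diff_subset)
  qed
  then show ?thesis unfolding bexp_def prod_add[OF U] by (intro sum.cong) auto
qed

text \<open>Random elements are addressed through \<open>h\<close>: in a link, an edge is tested by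
  whether its union with the fixed face is present.\<close>

lemma bexp_prod_image:
  fixes g :: "'b \<Rightarrow> bool \<Rightarrow> real"
  assumes U: "finite U" and h: "inj_on h I" "h ` I \<subseteq> U"
  shows "bexp U p (\<lambda>S. \<Prod>e\<in>I. g e (h e \<in> S)) = (\<Prod>e\<in>I. p * g e True + (1 - p) * g e False)"
proof -
  define g' where "g' = (\<lambda>u b. if u \<in> h ` I then g (the_inv_into I h u) b else 1)"
  have g': "g' (h e) b = g e b" if "e \<in> I" for e b
    using h(1) that by (simp add: g'_def the_inv_into_f_f)
  have *: "(\<Prod>u\<in>U. r u) = (\<Prod>e\<in>I. r (h e))" if "\<And>u. u \<notin> h ` I \<Longrightarrow> r u = 1" for r :: "'a \<Rightarrow> real"
  proof -
    have "(\<Prod>u\<in>U. r u) = (\<Prod>u\<in>h ` I. r u)"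
      using U h(2) that by (intro prod.mono_neutral_right) auto
    then show ?thesis using h(1) by (simp add: prod.reindex)
  qed
  have "(\<Prod>e\<in>I. g e (h e \<in> S)) = (\<Prod>u\<in>U. g' u (u \<in> S))" for S
    by (subst *) (auto simp: g'_def the_inv_into_f_f[OF h(1)])
  then have "bexp U p (\<lambda>S. \<Prod>e\<in>I. g e (h e \<in> S)) = bexp U p (\<lambda>S. \<Prod>u\<in>U. g' u (u \<in> S))" by simp
  also have "\<dots> = (\<Prod>u\<in>U. p * g' u True + (1 - p) * g' u False)" using U by (rule bexp_prod)
  also have "\<dots> = (\<Prod>e\<in>I. p * g e True + (1 - p) * g e False)"
    by (subst *) (auto simp: g'_def the_inv_into_f_f[OF h(1)])
  finally show ?thesis .
qed

lemma bexp_const: "finite U \<Longrightarrow> bexp U p (\<lambda>_. c) = c"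
  using bexp_cmult[of U p c "\<lambda>_. 1"] bexp_prod_image[of U "\<lambda>u. u" "{}" p "\<lambda>_ _. 1"] by simp

lemma bexp_power_card:
  assumes "finite U" shows "bexp U p (\<lambda>S. c ^ card S) = (1 + p * (c - 1)) ^ card U"
proof -
  have "bexp U p (\<lambda>S. c ^ card S) = bexp U p (\<lambda>S. \<Prod>u\<in>U. if u \<in> S then c else 1)"
  proof (rule bexp_cong)
    fix S assume "S \<subseteq> U"
    then show "c ^ card S = (\<Prod>u\<in>U. if u \<in> S then c else 1)"
      using assms by (simp add: prod.If_cases Int_absorb1)
  qed
  also have "\<dots> = (\<Prod>u\<in>U. 1 + p * (c - 1))"
    using bexp_prod[OF assms, of p "\<lambda>_ b. if b then c else 1"] by (simp add: algebra_simps)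
  finally show ?thesis by simp
qed

section \<open>Closed walks and traces\<close>

fun elist :: "'v \<Rightarrow> 'v list \<Rightarrow> 'v set list" where
  "elist u [] = []"
| "elist u (x # xs) = {u, x} # elist x xs"

definition lst :: "'v set \<Rightarrow> nat \<Rightarrow> 'v list set" where
  "lst V L = {xs. set xs \<subseteq> V \<and> length xs = L}"

text \<open>A closed walk of length \<open>L\<close> is the list of its \<open>L\<close> vertices,
  with the last one also serving as the start; for \<open>L > 0\<close> this is the trace of the
  \<open>L\<close>-th matrix power. \<open>Z\<close> is a function of the edge as a set, so the
  matrix is symmetric by construction and a loop is a singleton.\<close>

definition ctr :: "'v set \<Rightarrow> ('v set \<Rightarrow> real) \<Rightarrow> nat \<Rightarrow> real" where
  "ctr V Z L = (\<Sum>xs\<in>lst V L. prod_list (map Z (elist (last xs) xs)))"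

fun mpow :: "'v set \<Rightarrow> ('v set \<Rightarrow> real) \<Rightarrow> nat \<Rightarrow> 'v \<Rightarrow> 'v \<Rightarrow> real" where
  "mpow V Z 0 u v = (if u = v then 1 else 0)"
| "mpow V Z (Suc l) u v = (\<Sum>w\<in>V. Z {u, w} * mpow V Z l w v)"

definition app :: "'v set \<Rightarrow> ('v \<Rightarrow> 'v \<Rightarrow> real) \<Rightarrow> ('v \<Rightarrow> real) \<Rightarrow> 'v \<Rightarrow> real" where
  "app V M x u = (\<Sum>v\<in>V. M u v * x v)"

lemma finite_lst: "finite V \<Longrightarrow> finite (lst V L)"
  unfolding lst_def by (rule finite_lists_length_eq)

lemma lst_Suc: "lst V (Suc L) = (\<lambda>(x, xs). x # xs) ` (V \<times> lst V L)"
  by (auto simp: lst_def length_Suc_conv image_iff)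

lemma mpow_eq_walks:
  assumes "finite V" "u \<in> V"
  shows "mpow V Z L u v = (\<Sum>xs\<in>lst V L. if last (u # xs) = v then prod_list (map Z (elist u xs)) else 0)"
  using assms(2)
proof (induction L arbitrary: u)
  case 0
  have "lst V 0 = {[]}" by (auto simp: lst_def)
  then show ?case by simp
next
  case (Suc L)
  have "(\<Sum>xs\<in>lst V (Suc L). if last (u # xs) = v then prod_list (map Z (elist u xs)) else 0) =
    (\<Sum>(x, xs)\<in>V \<times> lst V L. if last (x # xs) = v then Z {u, x} * prod_list (map Z (elist x xs)) else 0)"
    unfolding lst_Suc by (subst sum.reindex) (auto simp: inj_on_def intro!: sum.cong)
  also have "\<dots> = (\<Sum>x\<in>V. \<Sum>xs\<in>lst V L. if last (x # xs) = v then Z {u, x} * prod_list (map Z (elist x xs)) else 0)"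
    by (rule sum.cartesian_product[symmetric])
  also have "\<dots> = (\<Sum>x\<in>V. Z {u, x} * (\<Sum>xs\<in>lst V L. if last (x # xs) = v then prod_list (map Z (elist x xs)) else 0))"
    unfolding sum_distrib_left by (intro sum.cong refl) simp
  also have "\<dots> = (\<Sum>x\<in>V. Z {u, x} * mpow V Z L x v)"
    by (intro sum.cong refl) (simp only: Suc.IH)
  finally show ?case by simp
qed

lemma ctr_eq_trace:
  assumes V: "finite V" and L: "L > 0"
  shows "ctr V Z L = (\<Sum>u\<in>V. mpow V Z L u u)"
proof -
  have "(\<Sum>u\<in>V. mpow V Z L u u) =
     (\<Sum>u\<in>V. \<Sum>xs\<in>lst V L. if last (u # xs) = u then prod_list (map Z (elist u xs)) else 0)"
    using V by (intro sum.cong refl mpow_eq_walks)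
  also have "\<dots> = (\<Sum>xs\<in>lst V L. \<Sum>u\<in>V. if last (u # xs) = u then prod_list (map Z (elist u xs)) else 0)"
    by (rule sum.swap)
  also have "\<dots> = ctr V Z L"
    unfolding ctr_def
  proof (rule sum.cong[OF refl])
    fix xs assume xs: "xs \<in> lst V L"
    then have "xs \<noteq> []" using L by (auto simp: lst_def)
    then have "last xs \<in> V" using xs last_in_set by (fastforce simp: lst_def)
    then show "(\<Sum>u\<in>V. if last (u # xs) = u then prod_list (map Z (elist u xs)) else 0) =
        prod_list (map Z (elist (last xs) xs))"
      using V \<open>xs \<noteq> []\<close> by simp
  qed
  finally show ?thesis by simp
qed

lemma mpow_add:
  assumes "finite V" "u \<in> V"
  shows "mpow V Z (a + b) u v = (\<Sum>w\<in>V. mpow V Z a u w * mpow V Z b w v)"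
  using assms(2)
proof (induction a arbitrary: u)
  case 0
  then show ?case using assms(1)
    by (simp add: if_distrib[of "\<lambda>x. x * _"] cong: if_cong)
next
  case (Suc a)
  have "mpow V Z (Suc a + b) u v = (\<Sum>x\<in>V. Z {u, x} * (\<Sum>w\<in>V. mpow V Z a x w * mpow V Z b w v))"
    using Suc by simp
  also have "\<dots> = (\<Sum>x\<in>V. \<Sum>w\<in>V. Z {u, x} * mpow V Z a x w * mpow V Z b w v)"
    by (simp add: sum_distrib_left mult_ac)
  also have "\<dots> = (\<Sum>w\<in>V. \<Sum>x\<in>V. Z {u, x} * mpow V Z a x w * mpow V Z b w v)" by (rule sum.swap)
  finally show ?case by (simp add: sum_distrib_right)
qed

lemma mpow_1: "finite V \<Longrightarrow> v \<in> V \<Longrightarrow> mpow V Z (Suc 0) u v = Z {u, v}"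
  by (simp add: if_distrib[of "\<lambda>x. _ * x"] cong: if_cong)

lemma mpow_sym:
  assumes "finite V" "u \<in> V" "v \<in> V"
  shows "mpow V Z l u v = mpow V Z l v u"
  using assms(2,3)
proof (induction l arbitrary: u v)
  case (Suc l)
  have "mpow V Z (Suc l) v u = (\<Sum>w\<in>V. mpow V Z l v w * mpow V Z (Suc 0) w u)"
    using mpow_add[OF assms(1) Suc.prems(2), of Z l "Suc 0" u] by simp
  also have "\<dots> = (\<Sum>w\<in>V. mpow V Z l w v * Z {u, w})"
    using assms(1) Suc by (intro sum.cong refl) (simp add: mpow_1 insert_commute del: mpow.simps)
  finally show ?case by (simp add: mult.commute)
qed auto

lemma ctr_eq_square_sum:
  assumes "finite V" "q > 0"
  shows "ctr V Z (2 * q) = (\<Sum>u\<in>V. \<Sum>v\<in>V. (mpow V Z q u v)\<^sup>2)"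
proof -
  have "ctr V Z (2 * q) = (\<Sum>u\<in>V. mpow V Z (q + q) u u)"
    using assms by (simp add: ctr_eq_trace mult_2)
  also have "\<dots> = (\<Sum>u\<in>V. \<Sum>v\<in>V. mpow V Z q u v * mpow V Z q v u)"
    using assms by (intro sum.cong refl mpow_add)
  also have "\<dots> = (\<Sum>u\<in>V. \<Sum>v\<in>V. (mpow V Z q u v)\<^sup>2)"
    using mpow_sym[OF assms(1)] by (intro sum.cong refl) (simp add: power2_eq_square)
  finally show ?thesis .
qed

section \<open>Traces of powers against the operator norm\<close>

abbreviation (input) "wmat Z \<equiv> (\<lambda>u v. Z {u, v})"

lemma app_app_mpow:
  assumes "finite V" "u \<in> V"
  shows "app V (mpow V Z (a + b)) x u = app V (mpow V Z a) (app V (mpow V Z b) x) u"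
proof -
  have "app V (mpow V Z (a + b)) x u = (\<Sum>v\<in>V. \<Sum>w\<in>V. mpow V Z a u w * mpow V Z b w v * x v)"
    using assms by (simp add: app_def mpow_add sum_distrib_right)
  also have "\<dots> = (\<Sum>w\<in>V. \<Sum>v\<in>V. mpow V Z a u w * mpow V Z b w v * x v)" by (rule sum.swap)
  finally show ?thesis by (simp add: app_def sum_distrib_left mult.assoc)
qed

lemma ip_app_mpow:
  assumes "finite V"
  shows "ip V (app V (mpow V Z l) x) y = ip V x (app V (mpow V Z l) y)"
proof -
  have "ip V (app V (mpow V Z l) x) y = (\<Sum>u\<in>V. \<Sum>v\<in>V. mpow V Z l u v * x v * y u)"
    by (simp add: ip_def app_def sum_distrib_right)
  also have "\<dots> = (\<Sum>v\<in>V. \<Sum>u\<in>V. mpow V Z l u v * x v * y u)" by (rule sum.swap)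
  also have "\<dots> = (\<Sum>v\<in>V. \<Sum>u\<in>V. x v * (mpow V Z l v u * y u))"
    using mpow_sym[OF assms] by (intro sum.cong refl) simp
  finally show ?thesis by (simp add: ip_def app_def sum_distrib_left)
qed

lemma ip_CS_square: "(ip S f g)\<^sup>2 \<le> ip S f f * ip S g g"
  using Cauchy_Schwarz_ineq_sum[of f g S] by (simp add: ip_def power2_eq_square)

lemma ip_cong: "(\<And>x. x \<in> S \<Longrightarrow> f x = f' x) \<Longrightarrow> (\<And>x. x \<in> S \<Longrightarrow> g x = g' x) \<Longrightarrow> ip S f g = ip S f' g'"
  by (simp add: ip_def)

text \<open>Write \<open>T l\<close> for the squared norm of the \<open>l\<close>-th power applied
  to \<open>x\<close>. Symmetry and Cauchy-Schwarz bound the square of \<open>T l\<close> by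
  \<open>T (2 * l)\<close> times the squared norm of \<open>x\<close>; iterating gives exponents
  that are powers of two.\<close>

lemma app_power_bound:
  assumes V: "finite V"
  shows "ip V (app V (wmat Z) x) (app V (wmat Z) x) ^ 2 ^ j * ip V x x
     \<le> ip V (app V (mpow V Z (2 ^ j)) x) (app V (mpow V Z (2 ^ j)) x) * ip V x x ^ 2 ^ j"
proof (induction j)
  case 0
  have "app V (mpow V Z (Suc 0)) x u = app V (wmat Z) x u" for u
    unfolding app_def using V by (intro sum.cong refl) (simp add: mpow_1 del: mpow.simps)
  then show ?case by (simp add: ip_def del: mpow.simps)
next
  case (Suc j)
  let ?T = "\<lambda>l. ip V (app V (mpow V Z l) x) (app V (mpow V Z l) x)"
  let ?a = "ip V (app V (wmat Z) x) (app V (wmat Z) x)"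
  let ?n = "ip V x x"
  have n: "?n \<ge> 0" "?T l \<ge> 0" "?a \<ge> 0" for l by (rule ip_self_nonneg)+
  show ?case
  proof (cases "?n = 0")
    case True
    then show ?thesis using n by simp
  next
    case False
    have "(?T (2 ^ j))\<^sup>2 = (ip V x (app V (mpow V Z (2 ^ j + 2 ^ j)) x))\<^sup>2"
    proof -
      have "?T (2 ^ j) = ip V x (app V (mpow V Z (2 ^ j)) (app V (mpow V Z (2 ^ j)) x))"
        using V by (rule ip_app_mpow)
      also have "\<dots> = ip V x (app V (mpow V Z (2 ^ j + 2 ^ j)) x)"
        using V by (intro ip_cong refl app_app_mpow[symmetric])
      finally show ?thesis by simp
    qed
    also have "\<dots> \<le> ?n * ?T (2 ^ j + 2 ^ j)" by (rule ip_CS_square)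
    finally have T: "(?T (2 ^ j))\<^sup>2 \<le> ?n * ?T (2 ^ Suc j)" by (simp add: mult_2)
    have "(?a ^ 2 ^ j * ?n)\<^sup>2 \<le> (?T (2 ^ j) * ?n ^ 2 ^ j)\<^sup>2"
      using Suc.IH n by (intro power_mono) auto
    also have "\<dots> = (?T (2 ^ j))\<^sup>2 * ?n ^ 2 ^ Suc j"
      by (simp add: power_mult_distrib mult.commute flip: power_mult)
    also have "\<dots> \<le> ?n * ?T (2 ^ Suc j) * ?n ^ 2 ^ Suc j"
      using T n by (intro mult_right_mono) auto
    also have "(?a ^ 2 ^ j * ?n)\<^sup>2 = ?n * (?a ^ 2 ^ Suc j * ?n)"
      by (simp add: power_mult_distrib mult.commute power2_eq_square flip: power_mult power_add mult_2)
    finally show ?thesis using False n(1) by (simp add: mult.assoc mult_le_cancel_left)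
  qed
qed

text \<open>Repeated Cauchy--Schwarz replaces the spectral theorem in the trace bound.\<close>

lemma app_norm_le_trace:
  assumes V: "finite V" and tr: "ctr V Z (2 * 2 ^ j) \<le> \<tau> ^ 2 ^ j" and \<tau>: "\<tau> \<ge> 0"
  shows "ip V (app V (wmat Z) x) (app V (wmat Z) x) \<le> \<tau> * ip V x x"
proof -
  let ?q = "2 ^ j :: nat"
  let ?a = "ip V (app V (wmat Z) x) (app V (wmat Z) x)"
  let ?n = "ip V x x"
  show ?thesis
  proof (cases "?n = 0")
    case True
    then have "\<And>v. v \<in> V \<Longrightarrow> x v = 0" using V by (simp add: ip_self_eq_0_iff)
    then show ?thesis by (simp add: ip_def app_def)
  next
    case False
    then have n: "?n > 0" using ip_self_nonneg[of V x] by simp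
    have "ip V (app V (mpow V Z ?q) x) (app V (mpow V Z ?q) x) \<le> (\<Sum>u\<in>V. (\<Sum>v\<in>V. (mpow V Z ?q u v)\<^sup>2) * ?n)"
      unfolding ip_def[of V "app V _ x"]
    proof (rule sum_mono)
      fix u assume "u \<in> V"
      have "(ip V (mpow V Z ?q u) x)\<^sup>2 \<le> ip V (mpow V Z ?q u) (mpow V Z ?q u) * ?n" by (rule ip_CS_square)
      then show "app V (mpow V Z ?q) x u * app V (mpow V Z ?q) x u \<le> (\<Sum>v\<in>V. (mpow V Z ?q u v)\<^sup>2) * ?n"
        by (simp add: ip_def app_def power2_eq_square)
    qed
    also have "\<dots> = ctr V Z (2 * ?q) * ?n"
      using V by (simp add: ctr_eq_square_sum sum_distrib_right)
    also have "\<dots> \<le> \<tau> ^ ?q * ?n" using tr n by (intro mult_right_mono) auto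
    finally have "?a ^ ?q * ?n \<le> (\<tau> ^ ?q * ?n) * ?n ^ ?q"
      using app_power_bound[OF V, of Z x j] n by (meson mult_right_mono order_trans zero_le_power less_imp_le)
    then have "?a ^ ?q \<le> (\<tau> * ?n) ^ ?q" using n by (simp add: power_mult_distrib mult_ac)
    then show ?thesis using \<tau> n ip_self_nonneg[of V "app V (wmat Z) x"]
      by (subst (asm) power_mono_iff) auto
  qed
qed

lemma bil_le_trace:
  assumes V: "finite V" and tr: "ctr V Z (2 * 2 ^ j) \<le> \<tau> ^ 2 ^ j" and \<tau>: "\<tau> \<ge> 0"
  shows "\<bar>bil V (wmat Z) x y\<bar> \<le> sqrt \<tau> * sqrt (ip V x x) * sqrt (ip V y y)"
proof -
  have "bil V (wmat Z) x y = ip V x (app V (wmat Z) y)" unfolding bil_eq_ip app_def ..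
  then have "\<bar>bil V (wmat Z) x y\<bar> \<le> sqrt (ip V x x) * sqrt (ip V (app V (wmat Z) y) (app V (wmat Z) y))"
    using ip_Cauchy_Schwarz[of V x "app V (wmat Z) y"] by simp
  also have "\<dots> \<le> sqrt (ip V x x) * sqrt (\<tau> * ip V y y)"
    using app_norm_le_trace[OF assms] ip_self_nonneg[of V x] by (intro mult_left_mono) auto
  finally show ?thesis by (simp add: real_sqrt_mult mult_ac)
qed

text \<open>The trace is the sum of the squared norms of the \<open>q\<close>-th power applied to
  the \<open>card V\<close> unit vectors.\<close>

lemma trace_le_norm:
  assumes V: "finite V" and q: "q > 0" and N: "N \<ge> 0"
    and le: "\<And>x. ip V (app V (wmat Z) x) (app V (wmat Z) x) \<le> N * ip V x x"
  shows "ctr V Z (2 * q) \<le> real (card V) * N ^ q"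
proof -
  have *: "ip V (app V (mpow V Z l) x) (app V (mpow V Z l) x) \<le> N ^ l * ip V x x" for l x
  proof (induction l)
    case 0
    have "app V (mpow V Z 0) x u = x u" if "u \<in> V" for u
      using V that by (simp add: app_def if_distrib[of "\<lambda>x. x * _"] cong: if_cong)
    then have "ip V (app V (mpow V Z 0) x) (app V (mpow V Z 0) x) = ip V x x" by (intro ip_cong)
    then show ?case by (simp del: mpow.simps)
  next
    case (Suc l)
    have "app V (mpow V Z (Suc l)) x u = app V (wmat Z) (app V (mpow V Z l) x) u" if "u \<in> V" for u
    proof -
      have "app V (mpow V Z (Suc 0)) y u = app V (wmat Z) y u" for y
        unfolding app_def using V by (intro sum.cong refl) (simp add: mpow_1 del: mpow.simps)
      then show ?thesis using app_app_mpow[OF V that, of Z "Suc 0" l x] by simp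
    qed
    then have "ip V (app V (mpow V Z (Suc l)) x) (app V (mpow V Z (Suc l)) x) =
      ip V (app V (wmat Z) (app V (mpow V Z l) x)) (app V (wmat Z) (app V (mpow V Z l) x))"
      by (intro ip_cong)
    also have "\<dots> \<le> N * ip V (app V (mpow V Z l) x) (app V (mpow V Z l) x)" by (rule le)
    also have "\<dots> \<le> N * (N ^ l * ip V x x)" using Suc N by (rule mult_left_mono)
    finally show ?case by (simp add: mult.assoc del: mpow.simps)
  qed
  have "ctr V Z (2 * q) = (\<Sum>w\<in>V. \<Sum>v\<in>V. (mpow V Z q v w)\<^sup>2)"
    unfolding ctr_eq_square_sum[OF V q] using mpow_sym[OF V] by (intro sum.cong refl) simp
  also have "\<dots> \<le> (\<Sum>w\<in>V. N ^ q)"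
  proof (rule sum_mono)
    fix w assume w: "w \<in> V"
    have e: "app V (mpow V Z q) (ind {w}) v = mpow V Z q v w" for v
      using V w by (simp add: app_def ind_def if_distrib[of "\<lambda>x. _ * x"] cong: if_cong)
    have "ip V (ind {w}) (ind {w}) = 1"
      using V w by (simp add: ip_def ind_def if_distrib[of "\<lambda>x. _ * x"] cong: if_cong)
    then show "(\<Sum>v\<in>V. (mpow V Z q v w)\<^sup>2) \<le> N ^ q"
      using *[of q "ind {w}"] by (simp add: e ip_def power2_eq_square)
  qed
  finally show ?thesis by simp
qed

section \<open>Comparison with a dense random matrix\<close>

definition pairs :: "'v set \<Rightarrow> 'v set set" where
  "pairs V = {e. e \<subseteq> V \<and> card e = 2}"

lemma finite_pairs: "finite V \<Longrightarrow> finite (pairs V)"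
  by (auto simp: pairs_def intro: finite_subset[of _ "Pow V"])

lemma prod_list_map_eq_prod_count:
  fixes Z :: "'a \<Rightarrow> real"
  shows "prod_list (map Z es) = (\<Prod>e\<in>set es. Z e ^ count_list es e)"
proof (induction es)
  case (Cons x es)
  show ?case
  proof (cases "x \<in> set es")
    case True
    have "(\<Prod>e\<in>set (x # es). Z e ^ count_list (x # es) e) =
       Z x ^ count_list (x # es) x * (\<Prod>e\<in>set es - {x}. Z e ^ count_list (x # es) e)"
      using True by (subst prod.remove[of _ x]) (auto simp: insert_absorb)
    also have "(\<Prod>e\<in>set es - {x}. Z e ^ count_list (x # es) e) = (\<Prod>e\<in>set es - {x}. Z e ^ count_list es e)"
      by (intro prod.cong) auto
    also have "Z x ^ count_list (x # es) x * \<dots> = Z x * (\<Prod>e\<in>set es. Z e ^ count_list es e)"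
      using True by (subst (2) prod.remove[of _ x]) auto
    finally show ?thesis by (simp add: Cons.IH)
  next
    case False
    then have "(\<Prod>e\<in>set es. Z e ^ count_list (x # es) e) = (\<Prod>e\<in>set es. Z e ^ count_list es e)"
      by (intro prod.cong) auto
    then show ?thesis using False by (simp add: Cons.IH)
  qed
qed simp

lemma elist_subset: "e \<in> set (elist u xs) \<Longrightarrow> e \<subseteq> insert u (set xs)"
  by (induction xs arbitrary: u) auto

lemma card_vertices_le_edges: "card (insert u (set xs)) \<le> card (set (elist u xs)) + 1"
proof (induction xs arbitrary: u)
  case (Cons x xs)
  show ?case
  proof (cases "u \<in> set (x # xs)")
    case True
    then have "insert u (set (x # xs)) = insert x (set xs)" by auto
    moreover have "card (set (elist x xs)) \<le> card (set (elist u (x # xs)))"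
      by (intro card_mono) auto
    ultimately show ?thesis using Cons[of x] by simp
  next
    case False
    then have "{u, x} \<notin> set (elist x xs)" using elist_subset[of "{u, x}" x xs] by auto
    then show ?thesis using False Cons[of x] by simp
  qed
qed simp

text \<open>Value \<open>a\<close> for present edges and \<open>b\<close> for absent ones; sets that
  are not of size 2, in particular loops, get weight 0.\<close>

definition bweight :: "('v set \<Rightarrow> 'b) \<Rightarrow> real \<Rightarrow> real \<Rightarrow> 'b set \<Rightarrow> 'v set \<Rightarrow> real" where
  "bweight h a b S e = (if card e = 2 then if h e \<in> S then a else b else 0)"

lemma bexp_walk:
  assumes U: "finite U" and h: "inj_on h (pairs V)" "h ` pairs V \<subseteq> U"
    and es: "\<And>e. e \<in> set es \<Longrightarrow> e \<subseteq> V"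
  shows "bexp U p (\<lambda>S. prod_list (map (bweight h a b S) es)) =
     (if \<forall>e\<in>set es. card e = 2
      then \<Prod>e\<in>set es. p * a ^ count_list es e + (1 - p) * b ^ count_list es e else 0)"
proof (cases "\<forall>e\<in>set es. card e = 2")
  case True
  have sub: "set es \<subseteq> pairs V" using True es by (auto simp: pairs_def)
  then have hsub: "h ` set es \<subseteq> U" using h(2) by blast
  have "prod_list (map (bweight h a b S) es) =
      (\<Prod>e\<in>set es. if h e \<in> S then a ^ count_list es e else b ^ count_list es e)" for S
    unfolding prod_list_map_eq_prod_count using True by (intro prod.cong) (auto simp: bweight_def)
  then show ?thesis
    using bexp_prod_image[OF U, of h "set es" p
        "\<lambda>e t. if t then a ^ count_list es e else b ^ count_list es e"] True
      inj_on_subset[OF h(1) sub] hsub by simp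
next
  case False
  then obtain e where e: "e \<in> set es" "card e \<noteq> 2" by blast
  have "prod_list (map (bweight h a b S) es) = 0" for S
    using e by (force simp: prod_list_zero_iff bweight_def)
  then have eq: "(\<lambda>S. prod_list (map (bweight h a b S) es)) = (\<lambda>_. 0)" by (intro ext)
  show ?thesis unfolding eq bexp_const[OF U] by (simp only: False if_False)
qed

text \<open>The walks that survive in expectation: an edge traversed once is killed by centring, a
  loop by \<open>bweight\<close>.\<close>

definition TW :: "'v set \<Rightarrow> nat \<Rightarrow> 'v list set" where
  "TW V L = {xs \<in> lst V L. \<forall>e\<in>set (elist (last xs) xs).
     card e = 2 \<and> count_list (elist (last xs) xs) e \<ge> 2}"

lemma walk_edges_subset:
  assumes "xs \<in> lst V L" "L > 0" "e \<in> set (elist (last xs) xs)"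
  shows "e \<subseteq> V"
proof -
  have "xs \<noteq> []" using assms by (auto simp: lst_def)
  then have "insert (last xs) (set xs) = set xs" by auto
  then show ?thesis using elist_subset[OF assms(3)] assms(1) by (auto simp: lst_def)
qed

lemma centred_Bernoulli_moment:
  fixes p :: real
  assumes p: "0 \<le> p" "p \<le> 1" and c: "c \<ge> 1"
  shows "\<bar>p * (1 - p) ^ c + (1 - p) * (- p) ^ c\<bar> \<le> (if c \<ge> 2 then p else 0)"
proof (cases "c \<ge> 2")
  case False
  then have "c = 1" using c by simp
  then show ?thesis by (simp add: algebra_simps)
next
  case True
  have "\<bar>p * (1 - p) ^ c + (1 - p) * (- p) ^ c\<bar> \<le> p * (1 - p) ^ c + (1 - p) * p ^ c"
    using p by (intro order_trans[OF abs_triangle_ineq]) (simp add: abs_mult power_abs)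
  also have "\<dots> \<le> p * (1 - p) ^ 2 + (1 - p) * p ^ 2"
    using p True by (intro add_mono mult_left_mono power_decreasing) auto
  also have "\<dots> = p * (1 - p)" by (simp add: power2_eq_square algebra_simps)
  also have "\<dots> \<le> p" using p by (simp add: mult_left_le)
  finally show ?thesis using True by simp
qed

text \<open>The law giving \<open>2\<close> with probability \<open>1/3\<close> and \<open>-1\<close> with probability \<open>2/3\<close> is centred, and
  all its higher moments are at least \<open>1\<close>, so every walk using each edge twice keeps weight at least \<open>1\<close>.\<close>

lemma comparison_moment:
  fixes c :: nat
  assumes "c \<ge> 1"
  shows "(if c \<ge> 2 then 1 else 0 :: real) \<le> 1 / 3 * 2 ^ c + (1 - 1 / 3) * (- 1) ^ c" (is "_ \<le> ?m")
proof (cases "c \<ge> 2")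
  case False
  then have "c = 1" using assms by simp
  then show ?thesis by simp
next
  case True
  show ?thesis
  proof (cases "even c")
    case even: True
    have "(2::real) ^ 2 \<le> 2 ^ c" using True by (intro power_increasing) auto
    then show ?thesis using True even by simp
  next
    \<comment> \<open>For odd \<open>c\<close> the second summand is -2/3, so \<open>2 ^ c\<close>
      must be at least 5; oddness excludes \<open>c = 2\<close>.\<close>
    case odd: False
    then have "c \<ge> 3" using True by (metis One_nat_def Suc_1 le_antisym not_less_eq_eq numeral_3_eq_3 even_numeral)
    then have "(2::real) ^ 3 \<le> 2 ^ c" by (intro power_increasing) auto
    then show ?thesis using True odd by simp
  qed
qed

text \<open>The prefactor \<open>p\<close> makes up for the fact that a walk may have one vertex
  more than it has edges.\<close>

lemma bexp_ctr_le:
  assumes V: "finite V" and U: "finite U" and h: "inj_on h (pairs V)" "h ` pairs V \<subseteq> U"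
    and p: "0 \<le> p" "p \<le> 1" and L: "L > 0"
  shows "p * bexp U p (\<lambda>S. ctr V (bweight h (1 - p) (- p) S) L) \<le> (\<Sum>xs\<in>TW V L. p ^ card (set xs))"
proof -
  let ?E = "\<lambda>xs. elist (last xs) xs"
  have "bexp U p (\<lambda>S. ctr V (bweight h (1 - p) (- p) S) L) =
      (\<Sum>xs\<in>lst V L. bexp U p (\<lambda>S. prod_list (map (bweight h (1 - p) (- p) S) (?E xs))))"
    unfolding ctr_def by (rule bexp_sum)
  then have "p * bexp U p (\<lambda>S. ctr V (bweight h (1 - p) (- p) S) L) =
      (\<Sum>xs\<in>lst V L. p * bexp U p (\<lambda>S. prod_list (map (bweight h (1 - p) (- p) S) (?E xs))))"
    by (simp add: sum_distrib_left)
  also have "\<dots> \<le> (\<Sum>xs\<in>lst V L. if xs \<in> TW V L then p ^ card (set xs) else 0)"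
  proof (rule sum_mono)
    fix xs assume xs: "xs \<in> lst V L"
    let ?m = "\<lambda>e. p * (1 - p) ^ count_list (?E xs) e + (1 - p) * (- p) ^ count_list (?E xs) e"
    have eq: "bexp U p (\<lambda>S. prod_list (map (bweight h (1 - p) (- p) S) (?E xs))) =
      (if \<forall>e\<in>set (?E xs). card e = 2 then \<Prod>e\<in>set (?E xs). ?m e else 0)"
      by (rule bexp_walk[OF U h]) (rule walk_edges_subset[OF xs L])
    have ne: "xs \<noteq> []" using xs L by (auto simp: lst_def)
    have c1: "count_list (?E xs) e \<ge> 1" if "e \<in> set (?E xs)" for e
      using that count_list_0_iff[of "?E xs" e] by (metis Suc_leI One_nat_def neq0_conv)
    have le: "(\<Prod>e\<in>set (?E xs). ?m e) \<le> (\<Prod>e\<in>set (?E xs). if count_list (?E xs) e \<ge> 2 then p else 0)"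
    proof -
      have "(\<Prod>e\<in>set (?E xs). ?m e) \<le> \<bar>\<Prod>e\<in>set (?E xs). ?m e\<bar>" by simp
      also have "\<dots> = (\<Prod>e\<in>set (?E xs). \<bar>?m e\<bar>)" by (rule abs_prod)
      also have "\<dots> \<le> (\<Prod>e\<in>set (?E xs). if count_list (?E xs) e \<ge> 2 then p else 0)"
        by (rule prod_mono) (use centred_Bernoulli_moment[OF p c1] in auto)
      finally show ?thesis .
    qed
    show "p * bexp U p (\<lambda>S. prod_list (map (bweight h (1 - p) (- p) S) (?E xs)))
        \<le> (if xs \<in> TW V L then p ^ card (set xs) else 0)"
    proof (cases "xs \<in> TW V L")
      case True
      then have *: "\<And>e. e \<in> set (?E xs) \<Longrightarrow> card e = 2 \<and> count_list (?E xs) e \<ge> 2" by (simp add: TW_def)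
      have "p * (\<Prod>e\<in>set (?E xs). ?m e) \<le> p * p ^ card (set (?E xs))"
        using le * p by (intro mult_left_mono) auto
      also have "\<dots> = p ^ Suc (card (set (?E xs)))" by simp
      also have "\<dots> \<le> p ^ card (set xs)"
      proof (rule power_decreasing)
        have "insert (last xs) (set xs) = set xs" using ne by auto
        then show "card (set xs) \<le> Suc (card (set (?E xs)))"
          using card_vertices_le_edges[of "last xs" xs] by simp
      qed (use p in auto)
      finally show ?thesis using True * by (simp add: eq)
    next
      case False
      show ?thesis
      proof (cases "\<forall>e\<in>set (?E xs). card e = 2")
        case True
        then obtain e where e: "e \<in> set (?E xs)" "\<not> count_list (?E xs) e \<ge> 2"
          using False xs by (auto simp: TW_def)
        then have "(\<Prod>e\<in>set (?E xs). if count_list (?E xs) e \<ge> 2 then p else 0) = 0"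
          by (intro prod_zero) auto
        then have "(\<Prod>e\<in>set (?E xs). ?m e) \<le> 0" using le by linarith
        then show ?thesis using False True p by (simp add: eq mult_nonneg_nonpos)
      next
        case F: False
        then show ?thesis using False unfolding eq by auto
      qed
    qed
  qed
  also have "\<dots> = (\<Sum>xs\<in>TW V L. p ^ card (set xs))"
    using finite_lst[OF V, of L] by (simp add: sum.If_cases TW_def Int_def)
  finally show ?thesis .
qed

text \<open>The factor \<open>p ^ card (set xs)\<close> is the probability that a binomial random vertex set contains
  the walk \<open>xs\<close>; this trades a sparse matrix on \<open>V\<close> for a dense one on about \<open>p * card V\<close> vertices.\<close>

lemma sum_TW_eq_bexp:
  assumes V: "finite V"
  shows "(\<Sum>xs\<in>TW V L. p ^ card (set xs)) = bexp V p (\<lambda>R. real (card (TW R L)))"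
proof -
  have fTW: "finite (TW V L)" using finite_lst[OF V, of L] by (auto simp: TW_def)
  have "real (card (TW R L)) = (\<Sum>xs\<in>TW V L. if set xs \<subseteq> R then 1 else 0)" if "R \<subseteq> V" for R
  proof -
    have "TW R L = {xs \<in> TW V L. set xs \<subseteq> R}" using that by (auto simp: TW_def lst_def)
    then show ?thesis using fTW by (simp add: sum.If_cases Int_def)
  qed
  then have "bexp V p (\<lambda>R. real (card (TW R L))) = bexp V p (\<lambda>R. \<Sum>xs\<in>TW V L. if set xs \<subseteq> R then 1 else 0)"
    by (rule bexp_cong)
  also have "\<dots> = (\<Sum>xs\<in>TW V L. bexp V p (\<lambda>R. if set xs \<subseteq> R then 1 else 0))" by (rule bexp_sum)
  also have "\<dots> = (\<Sum>xs\<in>TW V L. p ^ card (set xs))"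
  proof (rule sum.cong[OF refl])
    fix xs assume "xs \<in> TW V L"
    then have xs: "set xs \<subseteq> V" by (auto simp: TW_def lst_def)
    have "(if set xs \<subseteq> R then 1 else 0 :: real) = (\<Prod>u\<in>set xs. if u \<in> R then 1 else 0)" for R
      by (auto simp: subset_iff prod_zero_iff)
    then have "bexp V p (\<lambda>R. if set xs \<subseteq> R then 1 else 0) = bexp V p (\<lambda>R. \<Prod>u\<in>set xs. if u \<in> R then 1 else 0)"
      by simp
    also have "\<dots> = p ^ card (set xs)"
      using bexp_prod_image[OF V, of "\<lambda>u. u" "set xs" p "\<lambda>_ b. if b then 1 else 0"] xs by simp
    finally show "bexp V p (\<lambda>R. if set xs \<subseteq> R then 1 else 0) = p ^ card (set xs)" .
  qed
  finally show ?thesis by simp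
qed

text \<open>Under the comparison law each walk in \<open>TW\<close> has expected weight at least 1,
  and no walk has a negative one, so the trace overcounts.\<close>

lemma card_TW_le:
  assumes R: "finite R" and L: "L > 0"
  shows "real (card (TW R L)) \<le> bexp (pairs R) (1 / 3) (\<lambda>S. ctr R (bweight (\<lambda>e. e) 2 (- 1) S) L)"
proof -
  let ?E = "\<lambda>xs. elist (last xs) xs"
  have "real (card (TW R L)) = (\<Sum>xs\<in>lst R L. if xs \<in> TW R L then 1 else 0)"
    using finite_lst[OF R, of L] by (simp add: sum.If_cases TW_def Int_def)
  also have "\<dots> \<le> (\<Sum>xs\<in>lst R L. bexp (pairs R) (1 / 3) (\<lambda>S. prod_list (map (bweight (\<lambda>e. e) 2 (- 1) S) (?E xs))))"
  proof (rule sum_mono)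
    fix xs assume xs: "xs \<in> lst R L"
    let ?m = "\<lambda>e. 1 / 3 * 2 ^ count_list (?E xs) e + (1 - 1 / 3) * (- 1) ^ count_list (?E xs) e :: real"
    have eq: "bexp (pairs R) (1 / 3) (\<lambda>S. prod_list (map (bweight (\<lambda>e. e) 2 (- 1) S) (?E xs))) =
      (if \<forall>e\<in>set (?E xs). card e = 2 then \<Prod>e\<in>set (?E xs). ?m e else 0)"
      by (rule bexp_walk[OF finite_pairs[OF R]]) (use walk_edges_subset[OF xs L] in auto)
    have c1: "count_list (?E xs) e \<ge> 1" if "e \<in> set (?E xs)" for e
      using that count_list_0_iff[of "?E xs" e] by (metis Suc_leI One_nat_def neq0_conv)
    have "0 \<le> ?m e" if "e \<in> set (?E xs)" for e
      using comparison_moment[OF c1[OF that]] by (auto split: if_splits)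
    then have nn: "0 \<le> (\<Prod>e\<in>set (?E xs). ?m e)" by (rule prod_nonneg)
    show "(if xs \<in> TW R L then 1 else 0)
       \<le> bexp (pairs R) (1 / 3) (\<lambda>S. prod_list (map (bweight (\<lambda>e. e) 2 (- 1) S) (?E xs)))"
    proof (cases "xs \<in> TW R L")
      case True
      then have *: "\<And>e. e \<in> set (?E xs) \<Longrightarrow> card e = 2 \<and> count_list (?E xs) e \<ge> 2" by (simp add: TW_def)
      have "1 \<le> (\<Prod>e\<in>set (?E xs). ?m e)"
      proof (rule prod_ge_1)
        fix e assume e: "e \<in> set (?E xs)"
        show "1 \<le> ?m e" using comparison_moment[OF c1[OF e]] *[OF e] by simp
      qed
      then show ?thesis using True * unfolding eq by auto
    next
      case False
      then show ?thesis using nn unfolding eq by auto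
    qed
  qed
  also have "\<dots> = bexp (pairs R) (1 / 3) (\<lambda>S. ctr R (bweight (\<lambda>e. e) 2 (- 1) S) L)"
    unfolding ctr_def by (rule bexp_sum[symmetric])
  finally show ?thesis .
qed

section \<open>Moments of the dense random matrix\<close>

text \<open>For a centred variable the linear term averages out, which leaves a subgaussian
  bound.\<close>

lemma exp_le_add_exp_square: "exp x \<le> x + exp (x\<^sup>2)" for x :: real
proof -
  have sq: "1 + x\<^sup>2 \<le> exp (x\<^sup>2)" by (rule exp_ge_add_one_self)
  consider "x > 1" | "0 \<le> x" "x \<le> 1" | "- 1 \<le> x" "x < 0" | "x < - 1" by linarith
  then show ?thesis
  proof cases
    case 1
    then have "x \<le> x\<^sup>2" by (simp add: power2_eq_square)
    then have "exp x \<le> exp (x\<^sup>2)" by simp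
    then show ?thesis using 1 by linarith
  next
    case 2
    then show ?thesis using exp_bound[of x] sq by linarith
  next
    case 3
    \<comment> \<open>The upper bound on \<open>exp (- y)\<close> is equivalent to a lower bound on
      \<open>exp y\<close> times a quadratic, supplied by the quadratic Taylor polynomial.\<close>
    define y where "y = - x"
    have y: "0 \<le> y" "y \<le> 1" using 3 by (auto simp: y_def)
    have "1 \<le> (1 - y + y\<^sup>2) * (1 + y + y\<^sup>2 / 2)"
    proof -
      have "(1 - y + y\<^sup>2) * (1 + y + y\<^sup>2 / 2) = 1 + (y\<^sup>2 + y ^ 3 + y ^ 4) / 2"
        by (simp add: field_simps power2_eq_square power3_eq_cube power4_eq_xxxx)
      then show ?thesis using y by simp
    qed
    also have "\<dots> \<le> (1 - y + y\<^sup>2) * exp y"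
      using y exp_lower_Taylor_quadratic[of y] by (intro mult_left_mono) auto
    finally have "exp (- y) \<le> 1 - y + y\<^sup>2" by (simp add: exp_minus field_simps)
    then have "exp x \<le> 1 + x + x\<^sup>2" by (simp add: y_def)
    then show ?thesis using sq by linarith
  next
    case 4
    have "0 \<le> (- x) * (- x - 1)" using 4 by (intro mult_nonneg_nonneg) auto
    then have "x + x\<^sup>2 \<ge> 0" by (simp add: power2_eq_square algebra_simps)
    moreover have "exp x \<le> 1" using 4 by simp
    ultimately show ?thesis using sq by linarith
  qed
qed

lemma comparison_mgf: "1 / 3 * exp (s * 2) + (1 - 1 / 3) * exp (s * - 1) \<le> exp (4 * s\<^sup>2)" for s :: real
proof -
  have "exp (s * 2) \<le> s * 2 + exp (4 * s\<^sup>2)"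
    using exp_le_add_exp_square[of "s * 2"] by (simp add: power_mult_distrib mult.commute)
  moreover have "exp (s * - 1) \<le> s * - 1 + exp (s\<^sup>2)"
    using exp_le_add_exp_square[of "s * - 1"] by simp
  moreover have "exp (s\<^sup>2) \<le> exp (4 * s\<^sup>2)" by simp
  moreover have "(1 - 1 / 3 :: real) = 2 / 3" by simp
  ultimately show ?thesis by (simp only:)
qed

text \<open>A single term of the exponential series is at most the whole; evenness lets the absolute
  value be split into both signs.\<close>

lemma even_power_le_exp:
  fixes t y :: real
  assumes "t > 0"
  shows "y ^ (2 * q) \<le> fact (2 * q) / t ^ (2 * q) * (exp (t * y) + exp (t * - y))"
proof -
  have *: "x ^ m / fact m \<le> exp x" if "x \<ge> 0" for x :: real and m
  proof -
    have "summable (\<lambda>n. x ^ n /\<^sub>R fact n)" by (rule summable_exp_generic)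
    then have "(\<Sum>n\<in>{m}. x ^ n /\<^sub>R fact n) \<le> (\<Sum>n. x ^ n /\<^sub>R fact n)"
      using that by (intro sum_le_suminf) auto
    then show ?thesis by (simp add: exp_def divide_inverse mult.commute)
  qed
  have "(t * y) ^ (2 * q) = \<bar>t * y\<bar> ^ (2 * q)" by (simp add: power_even_abs)
  also have "\<dots> \<le> fact (2 * q) * exp \<bar>t * y\<bar>" using *[of "\<bar>t * y\<bar>" "2 * q"] by (simp add: field_simps)
  also have "exp \<bar>t * y\<bar> \<le> exp (t * y) + exp (t * - y)" by (simp add: abs_if)
  finally have "t ^ (2 * q) * y ^ (2 * q) \<le> fact (2 * q) * (exp (t * y) + exp (t * - y))"
    by (simp add: power_mult_distrib)
  then show ?thesis using assms by (simp add: field_simps)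
qed

lemma bexp_mgf:
  assumes U: "finite U" and A: "(\<Sum>e\<in>U. (A e)\<^sup>2) \<le> s"
  shows "bexp U (1 / 3) (\<lambda>S. exp (t * (\<Sum>e\<in>U. (if e \<in> S then 2 else - 1) * A e))) \<le> exp (4 * t\<^sup>2 * s)"
proof -
  have "exp (t * (\<Sum>e\<in>U. (if e \<in> S then 2 else - 1) * A e)) =
     (\<Prod>e\<in>U. exp (t * A e * (if e \<in> S then 2 else - 1)))" for S
    using U by (simp add: sum_distrib_left exp_sum mult_ac)
  then have "bexp U (1 / 3) (\<lambda>S. exp (t * (\<Sum>e\<in>U. (if e \<in> S then 2 else - 1) * A e))) =
     (\<Prod>e\<in>U. 1 / 3 * exp (t * A e * 2) + (1 - 1 / 3) * exp (t * A e * - 1))"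
    using bexp_prod[OF U, of "1 / 3" "\<lambda>e b. exp (t * A e * (if b then 2 else - 1))"] by simp
  also have "\<dots> \<le> (\<Prod>e\<in>U. exp (4 * (t * A e)\<^sup>2))"
    by (rule prod_mono) (use comparison_mgf in \<open>auto intro!: add_nonneg_nonneg\<close>)
  also have "\<dots> = exp (4 * t\<^sup>2 * (\<Sum>e\<in>U. (A e)\<^sup>2))"
    using U by (simp add: exp_sum[symmetric] sum_distrib_left power_mult_distrib mult_ac)
  also have "\<dots> \<le> exp (4 * t\<^sup>2 * s)" using A by (simp add: mult_left_mono)
  finally show ?thesis .
qed

lemma bexp_subgaussian_moment:
  assumes U: "finite U" and A: "(\<Sum>e\<in>U. (A e)\<^sup>2) \<le> s" and q: "q > 0"
  shows "bexp U (1 / 3) (\<lambda>S. (\<Sum>e\<in>U. (if e \<in> S then 2 else - 1) * A e) ^ (2 * q))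
     \<le> 2 * (4 * exp (4 * s) * real q) ^ q"
proof -
  let ?Y = "\<lambda>S. \<Sum>e\<in>U. (if e \<in> S then 2 else - 1) * A e"
  \<comment> \<open>This \<open>t\<close> balances the two factors: the exponential becomes a
    \<open>q\<close>-th power, and \<open>fact (2 * q)\<close> divided by \<open>q ^ q\<close> is at
    most \<open>(4 * q) ^ q\<close>.\<close>
  define t where "t = sqrt (real q)"
  have t: "t > 0" "t\<^sup>2 = real q" using q by (auto simp: t_def)
  have tq: "t ^ (2 * q) = real q ^ q" unfolding power_mult t(2) ..
  let ?c = "fact (2 * q) / t ^ (2 * q)"
  have "bexp U (1 / 3) (\<lambda>S. ?Y S ^ (2 * q))
     \<le> bexp U (1 / 3) (\<lambda>S. ?c * (exp (t * ?Y S) + exp (t * - ?Y S)))"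
    by (rule bexp_mono) (use even_power_le_exp[OF t(1)] in auto)
  also have "\<dots> = ?c * (bexp U (1 / 3) (\<lambda>S. exp (t * ?Y S)) + bexp U (1 / 3) (\<lambda>S. exp ((- t) * ?Y S)))"
    unfolding bexp_cmult bexp_add by simp
  also have "\<dots> \<le> ?c * (exp (4 * t\<^sup>2 * s) + exp (4 * (- t)\<^sup>2 * s))"
    using t by (intro mult_left_mono add_mono bexp_mgf[OF U A]) auto
  also have "\<dots> = fact (2 * q) / real q ^ q * (2 * exp (4 * s) ^ q)"
    unfolding tq power2_minus t(2) by (simp add: exp_of_nat_mult[symmetric] mult_ac)
  also have "fact (2 * q) \<le> real ((2 * q) ^ (2 * q))"
    by (rule fact_le_power)
  then have "fact (2 * q) / real q ^ q * (2 * exp (4 * s) ^ q)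
     \<le> real ((2 * q) ^ (2 * q)) / real q ^ q * (2 * exp (4 * s) ^ q)"
    by (intro mult_right_mono divide_right_mono) auto
  also have "real ((2 * q) ^ (2 * q)) / real q ^ q = (4 * real q) ^ q"
    using q by (simp add: power_mult power_mult_distrib power2_eq_square flip: power_divide)
  also have "(4 * real q) ^ q * (2 * exp (4 * s) ^ q) = 2 * (4 * exp (4 * s) * real q) ^ q"
    by (simp add: power_mult_distrib mult_ac)
  finally show ?thesis .
qed

text \<open>A net of the unit ball scaled by \<open>s = 4 * sqrt (card R)\<close>, whence the
  squared radius \<open>16 * card R\<close>. The mesh \<open>1 / s\<close> in each of the
  \<open>card R\<close> coordinates gives rounding errors of squared norm at most 1/16. The box
  places the grid in a finite product, over which sums factorise.\<close>

definition grid :: "'v set \<Rightarrow> ('v \<Rightarrow> int) set" where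
  "grid R = {z \<in> PiE R (\<lambda>_. {- 16 * int (card R)..16 * int (card R)}). (\<Sum>u\<in>R. (z u)\<^sup>2) \<le> 16 * int (card R)}"

lemma finite_grid: "finite R \<Longrightarrow> finite (grid R)"
  unfolding grid_def by (rule finite_subset[of _ "PiE R (\<lambda>_. {- 16 * int (card R)..16 * int (card R)})"])
    (auto intro: finite_PiE)

lemma sum_half_power_square_le: "(\<Sum>j\<in>{- int m..int m}. (1 / 2 :: real) ^ nat (j\<^sup>2)) \<le> 3"
proof -
  have "(\<Sum>j\<in>{- int m..int m}. (1 / 2 :: real) ^ nat (j\<^sup>2)) \<le> (\<Sum>j\<in>{- int m..int m}. (1 / 2) ^ nat \<bar>j\<bar>)"
  proof (rule sum_mono)
    fix j :: int
    have "\<bar>j\<bar> \<le> j\<^sup>2"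
    proof (cases "j = 0")
      case False
      then have "\<bar>j\<bar> * 1 \<le> \<bar>j\<bar> * \<bar>j\<bar>" by (intro mult_left_mono) auto
      then show ?thesis by (simp add: power2_eq_square flip: abs_mult)
    qed simp
    then show "(1 / 2 :: real) ^ nat (j\<^sup>2) \<le> (1 / 2) ^ nat \<bar>j\<bar>" by (intro power_decreasing) auto
  qed
  also have "\<dots> \<le> 3 - 2 * (1 / 2) ^ m"
  proof (induction m)
    case (Suc m)
    have "{- int (Suc m)..int (Suc m)} = insert (- int (Suc m)) (insert (int (Suc m)) {- int m..int m})"
      by auto
    then have "(\<Sum>j\<in>{- int (Suc m)..int (Suc m)}. (1 / 2 :: real) ^ nat \<bar>j\<bar>) =
        2 * (1 / 2) ^ Suc m + (\<Sum>j\<in>{- int m..int m}. (1 / 2) ^ nat \<bar>j\<bar>)"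
      by (simp add: nat_add_distrib)
    then show ?case using Suc by simp
  qed simp
  also have "\<dots> \<le> 3" by simp
  finally show ?thesis .
qed

text \<open>Each grid point has weight at least 1 under \<open>2 ^ (16 * card R)\<close> times the
  product of \<open>2\<close> to the power minus \<open>z u\<close> squared; the total weight
  factorises into one-dimensional sums, each at most 3.\<close>

lemma card_grid_le:
  assumes R: "finite R"
  shows "real (card (grid R)) \<le> (2 ^ 16 * 3) ^ card R"
proof -
  let ?m = "16 * card R"
  let ?P = "PiE R (\<lambda>_. {- int ?m..int ?m})"
  have fP: "finite ?P" using R by (intro finite_PiE) auto
  have "real (card (grid R)) = (\<Sum>z\<in>grid R. 1)" by simp
  also have "\<dots> \<le> (\<Sum>z\<in>grid R. 2 ^ (16 * card R) * (\<Prod>u\<in>R. (1 / 2) ^ nat ((z u)\<^sup>2)))"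
  proof (rule sum_mono)
    fix z assume "z \<in> grid R"
    then have le: "(\<Sum>u\<in>R. (z u)\<^sup>2) \<le> 16 * int (card R)" by (simp add: grid_def)
    have "int (\<Sum>u\<in>R. nat ((z u)\<^sup>2)) = (\<Sum>u\<in>R. (z u)\<^sup>2)" by simp
    then have "(\<Sum>u\<in>R. nat ((z u)\<^sup>2)) \<le> 16 * card R" using le by linarith
    then have "(1 / 2 :: real) ^ (16 * card R) \<le> (1 / 2) ^ (\<Sum>u\<in>R. nat ((z u)\<^sup>2))"
      by (intro power_decreasing) auto
    also have "\<dots> = (\<Prod>u\<in>R. (1 / 2) ^ nat ((z u)\<^sup>2))" by (rule power_sum)
    finally have "2 ^ (16 * card R) * (1 / 2 :: real) ^ (16 * card R)
       \<le> 2 ^ (16 * card R) * (\<Prod>u\<in>R. (1 / 2) ^ nat ((z u)\<^sup>2))" by (intro mult_left_mono) auto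
    then show "1 \<le> 2 ^ (16 * card R) * (\<Prod>u\<in>R. (1 / 2 :: real) ^ nat ((z u)\<^sup>2))"
      by (simp flip: power_mult_distrib)
  qed
  also have "\<dots> \<le> (\<Sum>z\<in>?P. 2 ^ (16 * card R) * (\<Prod>u\<in>R. (1 / 2) ^ nat ((z u)\<^sup>2)))"
    using fP by (intro sum_mono2) (auto simp: grid_def intro!: prod_nonneg mult_nonneg_nonneg)
  also have "\<dots> = 2 ^ (16 * card R) * (\<Sum>z\<in>?P. \<Prod>u\<in>R. (1 / 2) ^ nat ((z u)\<^sup>2))"
    by (simp add: sum_distrib_left)
  also have "(\<Sum>z\<in>?P. \<Prod>u\<in>R. (1 / 2 :: real) ^ nat ((z u)\<^sup>2)) = (\<Prod>u\<in>R. \<Sum>j\<in>{- int ?m..int ?m}. (1 / 2) ^ nat (j\<^sup>2))"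
    using R by (intro prod_sum_PiE[symmetric]) auto
  also have "\<dots> \<le> (\<Prod>u\<in>R. 3)"
    using sum_half_power_square_le[of ?m] by (intro prod_mono) (auto intro!: sum_nonneg)
  also have "2 ^ (16 * card R) * (\<Prod>u\<in>R. 3) = (2 ^ 16 * 3 :: real) ^ card R"
    by (simp only: power_mult power_mult_distrib prod_constant)
  finally show ?thesis by simp
qed

lemma bil_scale: "bil R M (\<lambda>u. a * x u) (\<lambda>u. b * y u) = a * b * bil R M x y"
  by (simp add: bil_def sum_distrib_left mult_ac)

lemma ip_scale: "ip R (\<lambda>u. a * x u) (\<lambda>u. b * y u) = a * b * ip R x y"
  by (simp add: ip_def sum_distrib_left mult_ac)

lemma grid_rounding:
  assumes R: "finite R" "R \<noteq> {}" and x: "ip R x x \<le> 1"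
  defines "s \<equiv> 4 * sqrt (real (card R))"
  obtains z where "z \<in> grid R" "ip R (\<lambda>u. 1 / s * z u) (\<lambda>u. 1 / s * z u) \<le> 1"
    "ip R (\<lambda>u. x u - 1 / s * z u) (\<lambda>u. x u - 1 / s * z u) \<le> 1 / 16"
proof -
  let ?r = "real (card R)"
  have r: "?r > 0" using R by (simp add: card_gt_0_iff)
  have s: "s > 0" "s * s = 16 * ?r" using r by (auto simp: s_def)
  \<comment> \<open>Rounding is towards zero, so that it does not increase the norm and the rounded
    point stays in the ball.\<close>
  define tr where "tr = (\<lambda>t :: real. if t \<ge> 0 then \<lfloor>t\<rfloor> else \<lceil>t\<rceil>)"
  have tr: "\<bar>real_of_int (tr t)\<bar> \<le> \<bar>t\<bar> \<and> \<bar>t - real_of_int (tr t)\<bar> \<le> 1" for t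
  proof (cases "t \<ge> 0")
    case True
    then have "real_of_int (tr t) \<ge> 0" "real_of_int (tr t) \<le> t" "t \<le> real_of_int (tr t) + 1"
      using floor_correct[of t] by (auto simp: tr_def)
    then show ?thesis by linarith
  next
    case False
    then have "real_of_int (tr t) \<le> 0" "t \<le> real_of_int (tr t)" "real_of_int (tr t) \<le> t + 1"
      using ceiling_correct[of t] by (auto simp: tr_def)
    then show ?thesis by linarith
  qed
  define z where "z = (\<lambda>u\<in>R. tr (s * x u))"
  have z: "\<bar>real_of_int (z u)\<bar> \<le> \<bar>s * x u\<bar>" "\<bar>s * x u - real_of_int (z u)\<bar> \<le> 1" if "u \<in> R" for u
    using tr that by (auto simp: z_def)
  have "(\<Sum>u\<in>R. (real_of_int (z u))\<^sup>2) \<le> (\<Sum>u\<in>R. (s * x u)\<^sup>2)"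
    by (rule sum_mono) (use z(1) in \<open>simp add: abs_le_square_iff\<close>)
  also have "\<dots> = s * s * ip R x x" by (simp add: ip_def sum_distrib_left power2_eq_square mult_ac)
  also have "\<dots> \<le> 16 * ?r" using s x r by simp
  finally have zs: "(\<Sum>u\<in>R. (real_of_int (z u))\<^sup>2) \<le> 16 * ?r" .
  then have "real_of_int (\<Sum>u\<in>R. (z u)\<^sup>2) \<le> real_of_int (16 * int (card R))" by simp
  then have zi: "(\<Sum>u\<in>R. (z u)\<^sup>2) \<le> 16 * int (card R)" by (simp only: of_int_le_iff)
  have zb: "\<bar>z u\<bar> \<le> 16 * int (card R)" if "u \<in> R" for u
  proof -
    have "\<bar>z u\<bar> \<le> (z u)\<^sup>2"
    proof (cases "z u = 0")
      case False
      then have "\<bar>z u\<bar> * 1 \<le> \<bar>z u\<bar> * \<bar>z u\<bar>" by (intro mult_left_mono) auto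
      then show ?thesis by (simp add: power2_eq_square flip: abs_mult)
    qed simp
    also have "(z u)\<^sup>2 \<le> (\<Sum>u\<in>R. (z u)\<^sup>2)" using R that by (intro member_le_sum) auto
    finally show ?thesis using zi by linarith
  qed
  have "z \<in> PiE R (\<lambda>_. {- 16 * int (card R)..16 * int (card R)})"
  proof (rule PiE_I)
    fix u assume "u \<in> R"
    from zb[OF this] show "z u \<in> {- 16 * int (card R)..16 * int (card R)}" by (simp add: abs_le_iff)
  qed (simp add: z_def)
  then have "z \<in> grid R" using zi by (simp add: grid_def)
  moreover have "ip R (\<lambda>u. 1 / s * z u) (\<lambda>u. 1 / s * z u) \<le> 1"
  proof -
    have "ip R (\<lambda>u. 1 / s * z u) (\<lambda>u. 1 / s * z u) = (\<Sum>u\<in>R. (real_of_int (z u))\<^sup>2) / (s * s)"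
      unfolding ip_scale by (simp add: ip_def power2_eq_square)
    then show ?thesis using zs s r by simp
  qed
  moreover have "ip R (\<lambda>u. x u - 1 / s * z u) (\<lambda>u. x u - 1 / s * z u) \<le> 1 / 16"
  proof -
    have "ip R (\<lambda>u. x u - 1 / s * z u) (\<lambda>u. x u - 1 / s * z u) \<le> (\<Sum>u\<in>R. 1 / (s * s))"
      unfolding ip_def
    proof (rule sum_mono)
      fix u assume u: "u \<in> R"
      have "x u - 1 / s * z u = (s * x u - z u) / s" using s by (simp add: field_simps)
      moreover have "(s * x u - z u)\<^sup>2 \<le> 1" using z(2)[OF u] by (simp add: abs_square_le_1)
      ultimately show "(x u - 1 / s * z u) * (x u - 1 / s * z u) \<le> 1 / (s * s)"
        using s by (simp add: power2_eq_square divide_right_mono)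
    qed
    also have "\<dots> = 1 / 16" using s r by simp
    finally show ?thesis .
  qed
  ultimately show thesis by (rule that)
qed

text \<open>Rounding both arguments changes the form by at most two quarters of its supremum over
  the unit balls, so the supremum is at most \<open>\<beta>\<close> plus half of itself. The factor
  \<open>16 * card R\<close> is the rescaling \<open>s * s\<close> of the grid.\<close>

lemma bilinear_grid_bound:
  assumes R: "finite R" "R \<noteq> {}"
    and grid: "\<And>z z'. z \<in> grid R \<Longrightarrow> z' \<in> grid R \<Longrightarrow>
      \<bar>bil R M (\<lambda>u. real_of_int (z u)) (\<lambda>u. real_of_int (z' u))\<bar> \<le> 16 * real (card R) * \<beta>"
    and xy: "ip R x x \<le> 1" "ip R y y \<le> 1"
  shows "bil R M x y \<le> 2 * \<beta>"
proof -
  define B where "B = {bil R M x y | x y. ip R x x \<le> 1 \<and> ip R y y \<le> 1}"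
  have coord: "\<bar>x u\<bar> \<le> 1" if "ip R x x \<le> 1" "u \<in> R" for x u
  proof -
    have "x u * x u \<le> ip R x x" unfolding ip_def using R that by (intro member_le_sum) auto
    then have "(x u)\<^sup>2 \<le> 1" using that by (simp add: power2_eq_square)
    then show ?thesis by (simp add: abs_square_le_1)
  qed
  have bdd: "bdd_above B"
  proof (rule bdd_aboveI)
    fix b assume "b \<in> B"
    then obtain x y where b: "b = bil R M x y" "ip R x x \<le> 1" "ip R y y \<le> 1" by (auto simp: B_def)
    have "M u v * x u * y v \<le> \<bar>M u v\<bar>" if "u \<in> R" "v \<in> R" for u v
    proof -
      have "\<bar>M u v * x u * y v\<bar> = \<bar>M u v\<bar> * (\<bar>x u\<bar> * \<bar>y v\<bar>)" by (simp add: abs_mult)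
      also have "\<dots> \<le> \<bar>M u v\<bar> * (1 * 1)"
        using coord b that by (intro mult_left_mono mult_mono) auto
      finally show ?thesis by simp
    qed
    then show "b \<le> (\<Sum>u\<in>R. \<Sum>v\<in>R. \<bar>M u v\<bar>)" unfolding b bil_def by (intro sum_mono)
  qed
  have upper: "bil R M x y \<le> Sup B" if "ip R x x \<le> 1" "ip R y y \<le> 1" for x y
    using that bdd by (intro cSup_upper) (auto simp: B_def)
  have quarter: "bil R M e y \<le> Sup B / 4" if "ip R e e \<le> 1 / 16" "ip R y y \<le> 1" for e y
    using upper[of "\<lambda>u. 4 * e u" "\<lambda>u. 1 * y u"] that unfolding bil_scale ip_scale by simp
  have quarter': "bil R M x e \<le> Sup B / 4" if "ip R e e \<le> 1 / 16" "ip R x x \<le> 1" for e x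
    using upper[of "\<lambda>u. 1 * x u" "\<lambda>u. 4 * e u"] that unfolding bil_scale ip_scale by simp
  have "Sup B \<le> \<beta> + Sup B / 2"
  proof (rule cSup_least)
    show "B \<noteq> {}" using xy by (auto simp: B_def)
    fix b assume "b \<in> B"
    then obtain x y where b: "b = bil R M x y" "ip R x x \<le> 1" "ip R y y \<le> 1" by (auto simp: B_def)
    define s where "s = 4 * sqrt (real (card R))"
    obtain z where z: "z \<in> grid R" "ip R (\<lambda>u. 1 / s * z u) (\<lambda>u. 1 / s * z u) \<le> 1"
      "ip R (\<lambda>u. x u - 1 / s * z u) (\<lambda>u. x u - 1 / s * z u) \<le> 1 / 16"
      unfolding s_def by (rule grid_rounding[OF R b(2)])
    obtain z' where z': "z' \<in> grid R" "ip R (\<lambda>u. 1 / s * z' u) (\<lambda>u. 1 / s * z' u) \<le> 1"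
      "ip R (\<lambda>u. y u - 1 / s * z' u) (\<lambda>u. y u - 1 / s * z' u) \<le> 1 / 16"
      unfolding s_def by (rule grid_rounding[OF R b(3)])
    have r: "real (card R) > 0" using R by (simp add: card_gt_0_iff)
    have s: "s * s = 16 * real (card R)" by (simp add: s_def)
    have "bil R M (\<lambda>u. 1 / s * z u) (\<lambda>u. 1 / s * z' u) =
       bil R M (\<lambda>u. real_of_int (z u)) (\<lambda>u. real_of_int (z' u)) / (16 * real (card R))"
      unfolding bil_scale by (simp flip: s)
    also have "\<dots> \<le> \<beta>" using grid[OF z(1) z'(1)] r by (simp add: divide_le_eq abs_le_iff mult_ac)
    finally have 1: "bil R M (\<lambda>u. 1 / s * z u) (\<lambda>u. 1 / s * z' u) \<le> \<beta>" .
    have "bil R M x y = bil R M (\<lambda>u. 1 / s * z u + 1 * (x u - 1 / s * z u)) y" by simp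
    also have "\<dots> = bil R M (\<lambda>u. 1 / s * z u) y + 1 * bil R M (\<lambda>u. x u - 1 / s * z u) y"
      by (rule bil_add_scaled_left)
    also have "bil R M (\<lambda>u. 1 / s * z u) y =
        bil R M (\<lambda>u. 1 / s * z u) (\<lambda>u. 1 / s * z' u + 1 * (y u - 1 / s * z' u))" by simp
    also have "\<dots> = bil R M (\<lambda>u. 1 / s * z u) (\<lambda>u. 1 / s * z' u)
        + 1 * bil R M (\<lambda>u. 1 / s * z u) (\<lambda>u. y u - 1 / s * z' u)"
      by (rule bil_add_scaled_right)
    finally show "b \<le> \<beta> + Sup B / 2"
      using 1 quarter[OF z(3) b(3)] quarter'[OF z'(3) z(2)] unfolding b(1) by linarith
  qed
  then show ?thesis using upper[OF xy] by linarith
qed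

lemma app_norm_grid_bound:
  assumes R: "finite R" "R \<noteq> {}" and \<beta>: "\<beta> \<ge> 0"
    and grid: "\<And>z z'. z \<in> grid R \<Longrightarrow> z' \<in> grid R \<Longrightarrow>
      \<bar>bil R M (\<lambda>u. real_of_int (z u)) (\<lambda>u. real_of_int (z' u))\<bar> \<le> 16 * real (card R) * \<beta>"
  shows "ip R (app R M x) (app R M x) \<le> (2 * \<beta>)\<^sup>2 * ip R x x"
proof (cases "ip R x x = 0 \<or> ip R (app R M x) (app R M x) = 0")
  case True
  then show ?thesis
  proof
    assume "ip R x x = 0"
    then have "\<forall>u\<in>R. x u = 0" using R by (simp add: ip_self_eq_0_iff)
    then show ?thesis by (simp add: ip_def app_def)
  qed (simp add: ip_self_nonneg)
next
  case False
  define a where "a = app R M x"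
  define na where "na = sqrt (ip R a a)"
  define nx where "nx = sqrt (ip R x x)"
  have n: "na > 0" "nx > 0" "na * na = ip R a a" "nx * nx = ip R x x"
    using False ip_self_nonneg[of R a] ip_self_nonneg[of R x]
    by (auto simp: na_def nx_def a_def less_le)
  have "bil R M (\<lambda>u. 1 / na * a u) (\<lambda>u. 1 / nx * x u) \<le> 2 * \<beta>"
    by (rule bilinear_grid_bound[OF R grid]) (unfold ip_scale, use n False in \<open>auto simp: a_def\<close>)
  moreover have "bil R M a x = na * na" unfolding bil_eq_ip n(3) a_def app_def ..
  ultimately have "1 / na * (1 / nx) * (na * na) \<le> 2 * \<beta>" by (simp only: bil_scale)
  moreover have "1 / na * (1 / nx) * (na * na) = na / nx" using n(1,2) by (simp add: field_simps)
  ultimately have "na / nx \<le> 2 * \<beta>" by simp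
  then have "na \<le> 2 * \<beta> * nx" using n by (simp add: field_simps)
  then have "na * na \<le> (2 * \<beta> * nx) * (2 * \<beta> * nx)" using n \<beta> by (intro mult_mono) auto
  also have "\<dots> = (2 * \<beta>)\<^sup>2 * (nx * nx)" by (simp add: power2_eq_square)
  finally show ?thesis unfolding n(3,4) a_def .
qed

text \<open>The maximum over the grid is replaced by a sum of \<open>2 * q\<close>-th powers, to
  which expectations apply termwise; this is the union bound over the net. Dividing by
  \<open>8 * card R\<close> turns the grid bound \<open>16 * card R * \<beta>\<close> into
  \<open>2 * \<beta>\<close>.\<close>

lemma trace_le_grid:
  assumes R: "finite R" "R \<noteq> {}" and q: "q > 0"
  shows "ctr R Z (2 * q) \<le> real (card R) * (\<Sum>z\<in>grid R. \<Sum>z'\<in>grid R.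
     (bil R (wmat Z) (\<lambda>u. real_of_int (z u)) (\<lambda>u. real_of_int (z' u)) / (8 * real (card R))) ^ (2 * q))"
    (is "_ \<le> _ * ?W")
proof -
  let ?b = "\<lambda>z z'. bil R (wmat Z) (\<lambda>u. real_of_int (z u)) (\<lambda>u. real_of_int (z' u))"
  have r: "real (card R) > 0" using R by (simp add: card_gt_0_iff)
  have nn: "(t :: real) ^ (2 * q) \<ge> 0" for t by (simp add: power_mult)
  have abs2: "\<bar>t :: real\<bar> ^ (2 * q) = t ^ (2 * q)" for t by (simp add: power_mult)
  have W: "?W \<ge> 0" by (intro sum_nonneg nn)
  define \<beta> where "\<beta> = root (2 * q) ?W / 2"
  have \<beta>: "\<beta> \<ge> 0" "(2 * \<beta>) ^ (2 * q) = ?W" using W q by (auto simp: \<beta>_def)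
  have "\<bar>?b z z'\<bar> \<le> 16 * real (card R) * \<beta>" if "z \<in> grid R" "z' \<in> grid R" for z z'
  proof -
    have "(?b z z' / (8 * real (card R))) ^ (2 * q) \<le> (\<Sum>z'\<in>grid R. (?b z z' / (8 * real (card R))) ^ (2 * q))"
      using that finite_grid[OF R(1)] by (intro member_le_sum nn) auto
    also have "\<dots> \<le> ?W" using that finite_grid[OF R(1)] by (intro member_le_sum[where f = "\<lambda>z. \<Sum>z'\<in>grid R. (?b z z' / (8 * real (card R))) ^ (2 * q)"] sum_nonneg nn) auto
    finally have "\<bar>?b z z' / (8 * real (card R))\<bar> ^ (2 * q) \<le> (2 * \<beta>) ^ (2 * q)"
      by (simp only: abs2 \<beta>(2))
    then have "\<bar>?b z z' / (8 * real (card R))\<bar> \<le> 2 * \<beta>"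
      using \<beta>(1) q by (subst (asm) power_mono_iff) auto
    then show ?thesis using r by (simp add: abs_divide divide_le_eq mult_ac)
  qed
  then have "ip R (app R (wmat Z) x) (app R (wmat Z) x) \<le> (2 * \<beta>)\<^sup>2 * ip R x x" for x
    by (intro app_norm_grid_bound[OF R \<beta>(1)])
  then have "ctr R Z (2 * q) \<le> real (card R) * ((2 * \<beta>)\<^sup>2) ^ q"
    by (intro trace_le_norm[OF R(1) q]) auto
  then show ?thesis unfolding power_mult[symmetric] \<beta>(2) .
qed

text \<open>The form is a sum over unordered edges of independent centred entries with coefficients
  \<open>A e\<close>, each collecting the at most two ordered pairs of an edge. Then
  \<open>bexp_subgaussian_moment\<close> applies once the squares of the coefficients are
  summed.\<close>

lemma grid_form_moment:
  assumes R: "finite R" "R \<noteq> {}" and q: "q > 0" and z: "z \<in> grid R" "z' \<in> grid R"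
  shows "bexp (pairs R) (1 / 3) (\<lambda>S. (bil R (wmat (bweight (\<lambda>e. e) 2 (- 1) S))
      (\<lambda>u. real_of_int (z u)) (\<lambda>u. real_of_int (z' u)) / (8 * real (card R))) ^ (2 * q))
     \<le> 2 * (4 * exp 32 * real q) ^ q"
proof -
  let ?r = "real (card R)"
  have r: "?r > 0" using R by (simp add: card_gt_0_iff)
  let ?x = "\<lambda>u. real_of_int (z u)" and ?y = "\<lambda>u. real_of_int (z' u)"
  let ?fib = "\<lambda>e. {w \<in> R \<times> R. {fst w, snd w} = e}"
  let ?t = "\<lambda>w. ?x (fst w) * ?y (snd w) / (8 * ?r)"
  define A where "A = (\<lambda>e. \<Sum>w\<in>?fib e. ?t w)"
  let ?D = "{w \<in> R \<times> R. fst w \<noteq> snd w}"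
  have fD: "finite ?D" using R by auto
  have card_pair: "card {u, v} = 2 \<longleftrightarrow> u \<noteq> v" for u v :: 'a by (cases "u = v") auto
  have img: "(\<lambda>w. {fst w, snd w}) ` ?D \<subseteq> pairs R"
  proof (rule image_subsetI)
    fix w assume "w \<in> ?D"
    then show "{fst w, snd w} \<in> pairs R" by (simp add: pairs_def card_pair mem_Times_iff)
  qed
  have fib: "{w \<in> ?D. {fst w, snd w} = e} = ?fib e" if "e \<in> pairs R" for e
  proof -
    have "fst w \<noteq> snd w" if "{fst w, snd w} = e" for w :: "'a \<times> 'a"
      using \<open>e \<in> pairs R\<close> card_pair[of "fst w" "snd w"] that by (simp add: pairs_def)
    then show ?thesis by (intro Collect_cong) (simp, metis)
  qed
  have Y: "bil R (wmat (bweight (\<lambda>e. e) 2 (- 1) S)) ?x ?y / (8 * ?r) =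
     (\<Sum>e\<in>pairs R. (if e \<in> S then 2 else - 1) * A e)" for S
  proof -
    let ?Z = "bweight (\<lambda>e. e) 2 (- 1) S"
    have "bil R (wmat ?Z) ?x ?y / (8 * ?r) = (\<Sum>w\<in>R \<times> R. ?Z {fst w, snd w} * ?t w)"
    proof -
      have "bil R (wmat ?Z) ?x ?y / (8 * ?r) = (\<Sum>(u, v)\<in>R \<times> R. ?Z {u, v} * ?x u * ?y v) / (8 * ?r)"
        unfolding bil_def sum.cartesian_product ..
      also have "\<dots> = (\<Sum>w\<in>R \<times> R. ?Z {fst w, snd w} * ?t w)"
        unfolding sum_divide_distrib by (intro sum.cong refl) (simp add: split_def)
      finally show ?thesis .
    qed
    also have "\<dots> = (\<Sum>w\<in>?D. ?Z {fst w, snd w} * ?t w)"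
    proof (rule sum.mono_neutral_right)
      show "\<forall>w\<in>R \<times> R - ?D. ?Z {fst w, snd w} * ?t w = 0"
      proof
        fix w assume "w \<in> R \<times> R - ?D"
        then have "{fst w, snd w} = {fst w}" by auto
        then have "?Z {fst w, snd w} = 0" by (simp add: bweight_def)
        then show "?Z {fst w, snd w} * ?t w = 0" by (simp only: mult_zero_left)
      qed
    qed (use R in auto)
    also have "\<dots> = (\<Sum>e\<in>pairs R. \<Sum>w\<in>{w \<in> ?D. {fst w, snd w} = e}. ?Z {fst w, snd w} * ?t w)"
      by (rule sum.group[symmetric, OF fD finite_pairs[OF R(1)] img])
    also have "\<dots> = (\<Sum>e\<in>pairs R. (if e \<in> S then 2 else - 1) * A e)"
    proof (rule sum.cong[OF refl])
      fix e assume e: "e \<in> pairs R"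
      have "(\<Sum>w\<in>?fib e. ?Z {fst w, snd w} * ?t w) = (\<Sum>w\<in>?fib e. (if e \<in> S then 2 else - 1) * ?t w)"
      proof (rule sum.cong[OF refl])
        fix w assume "w \<in> ?fib e"
        then have "?Z {fst w, snd w} = (if e \<in> S then 2 else - 1)"
          using e by (simp add: bweight_def pairs_def)
        then show "?Z {fst w, snd w} * ?t w = (if e \<in> S then 2 else - 1) * ?t w" by (simp only:)
      qed
      then show "(\<Sum>w\<in>{w \<in> ?D. {fst w, snd w} = e}. ?Z {fst w, snd w} * ?t w) =
          (if e \<in> S then 2 else - 1) * A e"
        unfolding fib[OF e] A_def by (simp add: sum_distrib_left)
    qed
    finally show ?thesis .
  qed
  have A2: "(A e)\<^sup>2 \<le> 2 * (\<Sum>w\<in>?fib e. (?t w)\<^sup>2)" if e: "e \<in> pairs R" for e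
  proof -
    obtain a b where ab: "e = {a, b}" "a \<noteq> b" using e by (auto simp: pairs_def card_2_iff)
    have sub: "?fib e \<subseteq> {(a, b), (b, a)}"
    proof
      fix w assume "w \<in> ?fib e"
      then have "{fst w, snd w} = {a, b}" using ab(1) by simp
      then show "w \<in> {(a, b), (b, a)}" by (cases w) (simp add: doubleton_eq_iff)
    qed
    have "card (?fib e) \<le> card {(a, b), (b, a)}" by (rule card_mono[OF _ sub]) simp
    then have "card (?fib e) \<le> 2" using ab(2) by simp
    then have c: "real (card (?fib e)) \<le> 2" by linarith
    have "(A e)\<^sup>2 = (\<Sum>w\<in>?fib e. 1 * ?t w)\<^sup>2" by (simp add: A_def)
    also have "\<dots> \<le> (\<Sum>w\<in>?fib e. 1\<^sup>2) * (\<Sum>w\<in>?fib e. (?t w)\<^sup>2)" by (rule Cauchy_Schwarz_ineq_sum)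
    also have "\<dots> \<le> 2 * (\<Sum>w\<in>?fib e. (?t w)\<^sup>2)"
      using c by (intro mult_right_mono sum_nonneg) auto
    finally show ?thesis .
  qed
  have zs: "(\<Sum>u\<in>R. (real_of_int (z u))\<^sup>2) \<le> 16 * ?r" if "z \<in> grid R" for z
  proof -
    have "(\<Sum>u\<in>R. (z u)\<^sup>2) \<le> 16 * int (card R)" using that by (simp add: grid_def)
    then have "real_of_int (\<Sum>u\<in>R. (z u)\<^sup>2) \<le> real_of_int (16 * int (card R))" by (simp only: of_int_le_iff)
    then show ?thesis by simp
  qed
  have "(\<Sum>e\<in>pairs R. (A e)\<^sup>2) \<le> (\<Sum>e\<in>pairs R. 2 * (\<Sum>w\<in>{w \<in> ?D. {fst w, snd w} = e}. (?t w)\<^sup>2))"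
  proof (rule sum_mono)
    fix e assume e: "e \<in> pairs R"
    show "(A e)\<^sup>2 \<le> 2 * (\<Sum>w\<in>{w \<in> ?D. {fst w, snd w} = e}. (?t w)\<^sup>2)"
      unfolding fib[OF e] by (rule A2[OF e])
  qed
  also have "\<dots> = 2 * (\<Sum>e\<in>pairs R. \<Sum>w\<in>{w \<in> ?D. {fst w, snd w} = e}. (?t w)\<^sup>2)"
    by (rule sum_distrib_left[symmetric])
  also have "(\<Sum>e\<in>pairs R. \<Sum>w\<in>{w \<in> ?D. {fst w, snd w} = e}. (?t w)\<^sup>2) = (\<Sum>w\<in>?D. (?t w)\<^sup>2)"
    by (rule sum.group[OF fD finite_pairs[OF R(1)] img])
  finally have S1: "(\<Sum>e\<in>pairs R. (A e)\<^sup>2) \<le> 2 * (\<Sum>w\<in>?D. (?t w)\<^sup>2)" .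
  have S2: "(\<Sum>w\<in>?D. (?t w)\<^sup>2) \<le> (\<Sum>w\<in>R \<times> R. (?t w)\<^sup>2)"
    using R by (intro sum_mono2) auto
  have "(\<Sum>w\<in>R \<times> R. (?t w)\<^sup>2) = (\<Sum>u\<in>R. (?x u)\<^sup>2) * (\<Sum>v\<in>R. (?y v)\<^sup>2) / (8 * ?r)\<^sup>2"
  proof -
    have "(\<Sum>w\<in>R \<times> R. (?t w)\<^sup>2) = (\<Sum>(u, v)\<in>R \<times> R. (?x u)\<^sup>2 * (?y v)\<^sup>2) / (8 * ?r)\<^sup>2"
      unfolding sum_divide_distrib by (intro sum.cong refl) (simp add: split_def power_mult_distrib power_divide)
    also have "(\<Sum>(u, v)\<in>R \<times> R. (?x u)\<^sup>2 * (?y v)\<^sup>2) = (\<Sum>u\<in>R. (?x u)\<^sup>2) * (\<Sum>v\<in>R. (?y v)\<^sup>2)"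
      unfolding sum_product by (rule sum.cartesian_product[symmetric])
    finally show ?thesis .
  qed
  also have "\<dots> \<le> (16 * ?r) * (16 * ?r) / (8 * ?r)\<^sup>2"
    using zs[OF z(1)] zs[OF z(2)] by (intro divide_right_mono mult_mono sum_nonneg) simp_all
  \<comment> \<open>Doubled by \<open>A2\<close>, the sum of squares is at most 8, which is where
    \<open>exp 32 = exp (4 * 8)\<close> comes from.\<close>
  also have "\<dots> = 4" using r by (simp add: power2_eq_square)
  finally have "(\<Sum>e\<in>pairs R. (A e)\<^sup>2) \<le> 8" using S1 S2 by linarith
  from bexp_subgaussian_moment[OF finite_pairs[OF R(1)] this q] show ?thesis
    unfolding Y by simp
qed

text \<open>Base of the net cost per vertex: a grid of base \<open>2 ^ 16 * 3\<close> for each of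
  the two arguments, and a factor 2 because \<open>card R\<close> is at most
  \<open>2 ^ card R\<close>.\<close>

definition K1 :: real where "K1 = 2 * (2 ^ 16 * 3) ^ 2"

lemma card_TW_bound:
  assumes R: "finite R" and q: "q > 0"
  shows "real (card (TW R (2 * q))) \<le> 2 * (4 * exp 32 * real q) ^ q * K1 ^ card R"
proof (cases "R = {}")
  case True
  then have "lst R (2 * q) = {}" using q by (auto simp: lst_def)
  then have "TW R (2 * q) = {}" by (auto simp: TW_def)
  then show ?thesis using True by simp
next
  case False
  let ?M = "2 * (4 * exp 32 * real q) ^ q"
  let ?f = "\<lambda>S z z'. (bil R (wmat (bweight (\<lambda>e. e) 2 (- 1) S))
      (\<lambda>u. real_of_int (z u)) (\<lambda>u. real_of_int (z' u)) / (8 * real (card R))) ^ (2 * q)"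
  have "real (card (TW R (2 * q))) \<le> bexp (pairs R) (1 / 3) (\<lambda>S. ctr R (bweight (\<lambda>e. e) 2 (- 1) S) (2 * q))"
    using R q by (intro card_TW_le) auto
  also have "\<dots> \<le> bexp (pairs R) (1 / 3) (\<lambda>S. real (card R) * (\<Sum>z\<in>grid R. \<Sum>z'\<in>grid R. ?f S z z'))"
    by (rule bexp_mono) (use trace_le_grid[OF R False q] in auto)
  also have "\<dots> = real (card R) * (\<Sum>z\<in>grid R. \<Sum>z'\<in>grid R. bexp (pairs R) (1 / 3) (\<lambda>S. ?f S z z'))"
    by (simp only: bexp_cmult bexp_sum)
  also have "\<dots> \<le> real (card R) * (\<Sum>z\<in>grid R. \<Sum>z'\<in>grid R. ?M)"
    by (intro mult_left_mono sum_mono grid_form_moment[OF R False q]) auto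
  also have "\<dots> = ?M * (real (card R) * real (card (grid R)) ^ 2)" by (simp add: power2_eq_square)
  also have "\<dots> \<le> ?M * (2 ^ card R * ((2 ^ 16 * 3) ^ card R) ^ 2)"
    using card_grid_le[OF R] of_nat_mono[OF less_imp_le[OF less_exp[of "card R"]], where 'a = real]
    by (intro mult_left_mono mult_mono power_mono) auto
  also have "(2 ^ card R * ((2 ^ 16 * 3) ^ card R) ^ 2 :: real) = K1 ^ card R"
    unfolding K1_def power_mult_distrib[of 2] by (simp only: power_mult[symmetric] mult.commute[of 2])
  finally show ?thesis .
qed

text \<open>The size of the random vertex set is binomial, so the net cost
  \<open>K1 ^ card R\<close> averages to at most \<open>exp (K1 * p * card V)\<close>.\<close>

lemma link_trace_bound:
  assumes V: "finite V" and U: "finite U" and h: "inj_on h (pairs V)" "h ` pairs V \<subseteq> U"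
    and p: "0 \<le> p" "p \<le> 1" and q: "q > 0"
  shows "p * bexp U p (\<lambda>S. ctr V (bweight h (1 - p) (- p) S) (2 * q))
     \<le> 2 * (4 * exp 32 * real q) ^ q * exp (K1 * (p * real (card V)))"
proof -
  let ?M = "2 * (4 * exp 32 * real q) ^ q"
  have "p * bexp U p (\<lambda>S. ctr V (bweight h (1 - p) (- p) S) (2 * q)) \<le> (\<Sum>xs\<in>TW V (2 * q). p ^ card (set xs))"
    using bexp_ctr_le[OF V U h p, of "2 * q"] q by simp
  also have "\<dots> = bexp V p (\<lambda>R. real (card (TW R (2 * q))))" using V by (rule sum_TW_eq_bexp)
  also have "\<dots> \<le> bexp V p (\<lambda>R. ?M * K1 ^ card R)"
    by (rule bexp_mono[OF p]) (use V q in \<open>auto intro: card_TW_bound finite_subset\<close>)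
  also have "\<dots> = ?M * (1 + p * (K1 - 1)) ^ card V" by (simp only: bexp_cmult bexp_power_card[OF V])
  also have "\<dots> \<le> ?M * exp (p * K1) ^ card V"
  proof (intro mult_left_mono power_mono)
    have "1 + p * (K1 - 1) \<le> 1 + p * K1" using p by (simp add: algebra_simps)
    also have "\<dots> \<le> exp (p * K1)" by (rule exp_ge_add_one_self)
    finally show "1 + p * (K1 - 1) \<le> exp (p * K1)" .
    show "0 \<le> 1 + p * (K1 - 1)" using p by (simp add: K1_def)
  qed auto
  also have "exp (p * K1) ^ card V = exp (K1 * (p * real (card V)))"
    by (simp add: exp_of_nat_mult[symmetric] mult_ac)
  finally show ?thesis .
qed

section \<open>The random complex\<close>

lemma finite_LM_cands: "finite (LM_cands k n)"
  by (rule finite_subset[of _ "Pow {1..n}"]) (auto simp: LM_cands_def)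

text \<open>Markov's inequality and the union bound in one: \<open>B\<close> is a sum of nonnegative
  failure terms, and \<open>1 - B\<close> lies below the indicator of the event.\<close>

lemma LM_prob_ge:
  assumes p: "0 \<le> p" "p \<le> 1"
    and B: "\<And>S. S \<subseteq> LM_cands k n \<Longrightarrow> 0 \<le> B S"
    and P: "\<And>S. S \<subseteq> LM_cands k n \<Longrightarrow> B S < 1 \<Longrightarrow> P (LM_complex k n S)"
  shows "1 - bexp (LM_cands k n) p B \<le> LM_prob k n p P"
proof -
  let ?U = "LM_cands k n"
  have fU: "finite ?U" by (rule finite_LM_cands)
  have "1 - bexp ?U p B = bexp ?U p (\<lambda>S. 1 + (- 1) * B S)"
    unfolding bexp_add bexp_cmult bexp_const[OF fU] by simp
  also have "\<dots> \<le> bexp ?U p (\<lambda>S. if P (LM_complex k n S) then 1 else 0)"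
  proof (rule bexp_mono[OF p])
    fix S assume S: "S \<subseteq> ?U"
    show "1 + (- 1) * B S \<le> (if P (LM_complex k n S) then 1 else 0)"
      using B[OF S] P[OF S] by (cases "B S < 1") auto
  qed
  also have "\<dots> = LM_prob k n p P"
    unfolding bexp_def LM_prob_def by (intro sum.cong) auto
  finally show ?thesis .
qed

lemma ctr_nonneg: "finite V \<Longrightarrow> q > 0 \<Longrightarrow> 0 \<le> ctr V Z (2 * q)"
  by (simp add: ctr_eq_square_sum sum_nonneg)

text \<open>A value below 1 bounds the trace of every link by \<open>\<tau> ^ q\<close>.\<close>

definition norm_fail :: "nat \<Rightarrow> nat \<Rightarrow> real \<Rightarrow> real \<Rightarrow> nat \<Rightarrow> nat set set \<Rightarrow> real" where
  "norm_fail k n p \<tau> q S = (\<Sum>E\<in>ksub {1..n} (k - 1).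
     ctr ({1..n} - E) (bweight (\<lambda>e. e \<union> E) (1 - p) (- p) S) (2 * q) / \<tau> ^ q)"

lemma norm_fail_nonneg:
  assumes "q > 0" "\<tau> > 0" shows "0 \<le> norm_fail k n p \<tau> q S"
  unfolding norm_fail_def using assms by (intro sum_nonneg divide_nonneg_pos ctr_nonneg) auto

lemma norm_fail_small_imp_bound:
  assumes k: "k \<ge> 1" and q: "q = 2 ^ j" and \<tau>: "\<tau> > 0" and small: "norm_fail k n p \<tau> q S < 1"
  shows "\<bar>wform {1..n} k (\<lambda>H. ind S H - p) f g\<bar>
        \<le> sqrt \<tau> * real k * sqrt (ip (ksub {1..n} k) f f) * sqrt (ip (ksub {1..n} k) g g)"
proof (rule wform_bound)
  fix E x y assume E: "E \<in> ksub {1..n} (k - 1)"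
  let ?V = "{1..n} - E"
  let ?Z = "bweight (\<lambda>e. e \<union> E) (1 - p) (- p) S"
  let ?c = "\<lambda>E. ctr ({1..n} - E) (bweight (\<lambda>e. e \<union> E) (1 - p) (- p) S) (2 * q) / \<tau> ^ q"
  have "?c E \<le> norm_fail k n p \<tau> q S"
    unfolding norm_fail_def
    using E finite_ksub[of "{1..n}" "k - 1"] q \<tau>
    by (intro member_le_sum[where f = ?c] divide_nonneg_pos ctr_nonneg) auto
  then have "ctr ?V ?Z (2 * q) / \<tau> ^ q \<le> 1" using small by linarith
  then have tr: "ctr ?V ?Z (2 * 2 ^ j) \<le> \<tau> ^ 2 ^ j" using \<tau> by (simp add: q field_simps)
  have "bil ?V (\<lambda>u v. ?Z {u, v}) x y =
      (\<Sum>u\<in>?V. \<Sum>v\<in>?V - {u}. (ind S (insert u (insert v E)) - p) * x u * y v)"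
    unfolding bil_def
  proof (rule sum.cong[OF refl])
    fix u assume "u \<in> ?V"
    show "(\<Sum>v\<in>?V. ?Z {u, v} * x u * y v) =
        (\<Sum>v\<in>?V - {u}. (ind S (insert u (insert v E)) - p) * x u * y v)"
    proof (rule sum.mono_neutral_cong_right)
      fix v assume "v \<in> ?V - {u}"
      then have "card {u, v} = 2" by auto
      then show "?Z {u, v} * x u * y v = (ind S (insert u (insert v E)) - p) * x u * y v"
        by (simp add: bweight_def ind_def)
    qed (auto simp: bweight_def)
  qed
  then show "\<bar>\<Sum>u\<in>?V. \<Sum>v\<in>?V - {u}. (ind S (insert u (insert v E)) - p) * x u * y v\<bar>
      \<le> sqrt \<tau> * sqrt (ip ?V x x) * sqrt (ip ?V y y)"
    using bil_le_trace[OF _ tr, of x y] \<tau> by simp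
qed (use k \<tau> in auto)

text \<open>At most \<open>n ^ (k - 1)\<close> links, one further factor \<open>n\<close> for
  dividing by \<open>p\<close>, and \<open>real n powr (- b)\<close> from the surplus
  \<open>exp b\<close> in \<open>\<tau>\<close>.\<close>

lemma norm_fail_expectation:
  assumes k: "k \<ge> 1" and n: "n \<ge> k" "n \<ge> 1" and p: "0 < p" "p \<le> 1" and pn: "1 \<le> p * real n"
    and q: "p * real n \<le> real q" "ln (real n) \<le> real q"
    and b: "b \<ge> 0" and \<tau>: "\<tau> = 8 * exp (32 + K1 + b) * real q"
  shows "bexp (LM_cands k n) p (norm_fail k n p \<tau> q) \<le> real n powr (real k - b)"
proof -
  let ?U = "LM_cands k n"
  have q1: "real q \<ge> 1" using q(1) pn by linarith
  then have q0: "q > 0" by simp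
  have \<tau>0: "\<tau> > 0" using q0 by (simp add: \<tau>)
  have K1: "K1 \<ge> 0" by (simp add: K1_def)
  let ?c = "\<lambda>E S. ctr ({1..n} - E) (bweight (\<lambda>e. e \<union> E) (1 - p) (- p) S) (2 * q)"
  have one: "bexp ?U p (?c E) / \<tau> ^ q \<le> real n * real n powr (- b)"
    if E: "E \<in> ksub {1..n} (k - 1)" for E
  proof -
    have E': "E \<subseteq> {1..n}" "card E = k - 1" "finite E"
      using E ksub_finite_elem[of "{1..n}" E "k - 1"] by (auto simp: ksub_def)
    have "p * bexp ?U p (?c E) \<le> 2 * (4 * exp 32 * real q) ^ q * exp (K1 * (p * real (card ({1..n} - E))))"
    proof (rule link_trace_bound)
      show "inj_on (\<lambda>e. e \<union> E) (pairs ({1..n} - E))" by (auto simp: inj_on_def pairs_def)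
      show "(\<lambda>e. e \<union> E) ` pairs ({1..n} - E) \<subseteq> ?U"
      proof (rule image_subsetI)
        fix e assume "e \<in> pairs ({1..n} - E)"
        then have e: "e \<subseteq> {1..n}" "e \<inter> E = {}" "card e = 2" "finite e"
          by (auto simp: pairs_def intro: card_ge_0_finite)
        then have "card (e \<union> E) = 2 + (k - 1)" using E' by (simp add: card_Un_disjoint)
        then show "e \<union> E \<in> ?U" using e E' k by (auto simp: LM_cands_def)
      qed
    qed (use p q0 in \<open>auto simp: finite_LM_cands\<close>)
    also have "\<dots> \<le> 2 * (4 * exp 32 * real q) ^ q * exp (K1 * real q)"
    proof (intro mult_left_mono)
      have "p * real (card ({1..n} - E)) \<le> p * real n"
        using p card_mono[of "{1..n}" "{1..n} - E"] by (intro mult_left_mono) auto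
      then have "K1 * (p * real (card ({1..n} - E))) \<le> K1 * real q"
        using q(1) K1 by (intro mult_left_mono) auto
      then show "exp (K1 * (p * real (card ({1..n} - E)))) \<le> exp (K1 * real q)" by simp
    qed auto
    \<comment> \<open>The stray factor 2 is inflated to \<open>2 ^ q\<close>, which makes the 4 of
      the moment bound the 8 in \<open>\<tau>\<close>.\<close>
    also have "\<dots> \<le> 2 ^ q * (4 * exp 32 * real q) ^ q * exp (K1 * real q)"
      using q0 self_le_power[of "2::real" q] by (intro mult_right_mono) auto
    also have "\<dots> = (\<tau> * exp (- b)) ^ q"
    proof -
      have "exp (K1 * real q) = exp K1 ^ q" by (simp add: exp_of_nat_mult[symmetric] mult.commute)
      moreover have "\<tau> * exp (- b) = 2 * (4 * exp 32 * real q) * exp K1"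
        by (simp add: \<tau> exp_add exp_minus)
      ultimately show ?thesis by (simp only: power_mult_distrib)
    qed
    also have "\<dots> = \<tau> ^ q * exp (- b * real q)"
      by (simp add: power_mult_distrib exp_of_nat_mult[symmetric] mult.commute)
    also have "\<dots> \<le> \<tau> ^ q * exp (- b * ln (real n))"
      using \<tau>0 b q(2) by (intro mult_left_mono) (auto intro: mult_left_mono)
    also have "exp (- b * ln (real n)) = real n powr (- b)" using n by (simp add: powr_def)
    finally have "p * (bexp ?U p (?c E) / \<tau> ^ q) \<le> real n powr (- b)"
      using \<tau>0 by (simp add: field_simps)
    then have "real n * (p * (bexp ?U p (?c E) / \<tau> ^ q)) \<le> real n * real n powr (- b)"
      by (intro mult_left_mono) auto
    \<comment> \<open>Division by \<open>p\<close> costs at most \<open>n\<close>, because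
      \<open>p * n\<close> is at least 1.\<close>
    moreover have "1 * (bexp ?U p (?c E) / \<tau> ^ q) \<le> (p * real n) * (bexp ?U p (?c E) / \<tau> ^ q)"
    proof (rule mult_right_mono[OF pn])
      have "bexp ?U p (\<lambda>_. 0) \<le> bexp ?U p (?c E)"
        using p q0 by (intro bexp_mono ctr_nonneg) auto
      then show "0 \<le> bexp ?U p (?c E) / \<tau> ^ q"
        using \<tau>0 by (simp add: bexp_const[OF finite_LM_cands])
    qed
    ultimately show ?thesis by (simp add: mult_ac)
  qed
  have "bexp ?U p (norm_fail k n p \<tau> q) = (\<Sum>E\<in>ksub {1..n} (k - 1). bexp ?U p (?c E) / \<tau> ^ q)"
  proof -
    have "norm_fail k n p \<tau> q = (\<lambda>S. \<Sum>E\<in>ksub {1..n} (k - 1). 1 / \<tau> ^ q * ?c E S)"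
      by (simp add: norm_fail_def fun_eq_iff)
    then show ?thesis by (simp only: bexp_sum bexp_cmult) simp
  qed
  also have "\<dots> \<le> (\<Sum>E\<in>ksub {1..n} (k - 1). real n * real n powr (- b))"
    by (rule sum_mono) (rule one)
  also have "\<dots> = real (n choose (k - 1)) * (real n * real n powr (- b))" by (simp add: card_ksub)
  also have "\<dots> \<le> real n ^ (k - 1) * (real n * real n powr (- b))"
  proof (rule mult_right_mono)
    have "n choose (k - 1) \<le> n ^ (k - 1)" using n by (intro binomial_le_pow) auto
    then show "real (n choose (k - 1)) \<le> real n ^ (k - 1)" by (metis of_nat_le_iff of_nat_power)
  qed auto
  also have "\<dots> = real n ^ k * real n powr (- b)" using k by (simp add: power_eq_if)
  also have "\<dots> = real n powr (real k - b)"
    using n by (simp add: powr_realpow[symmetric] powr_add[symmetric])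
  finally show ?thesis .
qed

text \<open>Exponential Markov terms: a degree below \<open>\<delta>\<close> makes its summand
  exceed 1.\<close>

definition deg_fail :: "nat \<Rightarrow> nat \<Rightarrow> real \<Rightarrow> real \<Rightarrow> nat set set \<Rightarrow> real" where
  "deg_fail k n t \<delta> S = (\<Sum>F\<in>ksub {1..n} k.
     exp (t * (\<delta> - (\<Sum>u\<in>{1..n} - F. ind S (insert u F)))))"

lemma deg_fail_small_imp:
  assumes S: "S \<subseteq> LM_cands k n" and t: "t > 0" and small: "deg_fail k n t \<delta> S < 1"
    and F: "F \<in> ksub {1..n} k"
  shows "\<delta> \<le> real (Defs.deg (LM_complex k n S) k F)"
proof -
  have fk: "faces (LM_complex k n S) k = S"
    using S by (auto simp: faces_def LM_complex_def LM_cands_def)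
  have "exp (t * (\<delta> - (\<Sum>u\<in>{1..n} - F. ind S (insert u F)))) \<le> deg_fail k n t \<delta> S"
    unfolding deg_fail_def using F finite_ksub[of "{1..n}" k]
    by (intro member_le_sum[where f = "\<lambda>F. exp (t * (\<delta> - (\<Sum>u\<in>{1..n} - F. ind S (insert u F))))"]) auto
  then have "exp (t * (\<delta> - (\<Sum>u\<in>{1..n} - F. ind S (insert u F)))) < exp 0"
    unfolding exp_zero using small by (rule le_less_trans)
  then have "t * (\<delta> - (\<Sum>u\<in>{1..n} - F. ind S (insert u F))) < 0" by (simp only: exp_less_cancel_iff)
  then have "\<delta> - (\<Sum>u\<in>{1..n} - F. ind S (insert u F)) < 0" using t by (simp add: mult_less_0_iff)
  moreover have "S \<subseteq> ksub {1..n} (Suc k)" using S by (auto simp: LM_cands_def ksub_def)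
  ultimately show ?thesis using deg_eq_sum_ind[of "{1..n}" F k "LM_complex k n S"] F by (simp add: fk)
qed

lemma deg_fail_expectation:
  assumes k: "k \<le> n" and p: "0 \<le> p" "p \<le> 1"
  shows "bexp (LM_cands k n) p (deg_fail k n t \<delta>)
    \<le> real n ^ k * exp (t * \<delta> - p * real (n - k) * (1 - exp (- t)))"
proof -
  let ?U = "LM_cands k n"
  have "bexp ?U p (\<lambda>S. exp (t * (\<delta> - (\<Sum>u\<in>{1..n} - F. ind S (insert u F)))))
      \<le> exp (t * \<delta> - p * real (n - k) * (1 - exp (- t)))" if F: "F \<in> ksub {1..n} k" for F
  proof -
    have F': "F \<subseteq> {1..n}" "card F = k" "finite F"
      using F ksub_finite_elem[of "{1..n}" F k] by (auto simp: ksub_def)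
    have card: "card ({1..n} - F) = n - k" using F' by (subst card_Diff_subset) auto
    have "exp (t * (\<delta> - (\<Sum>u\<in>{1..n} - F. ind S (insert u F)))) =
        exp (t * \<delta>) * (\<Prod>u\<in>{1..n} - F. if insert u F \<in> S then exp (- t) else 1)" for S
    proof -
      have "exp (t * (\<delta> - (\<Sum>u\<in>{1..n} - F. ind S (insert u F)))) =
          exp (t * \<delta>) * exp (\<Sum>u\<in>{1..n} - F. - t * ind S (insert u F))"
        by (simp add: right_diff_distrib exp_diff exp_minus sum_negf sum_distrib_left divide_inverse)
      also have "exp (\<Sum>u\<in>{1..n} - F. - t * ind S (insert u F)) =
          (\<Prod>u\<in>{1..n} - F. exp (- t * ind S (insert u F)))" by (rule exp_sum) simp
      also have "\<dots> = (\<Prod>u\<in>{1..n} - F. if insert u F \<in> S then exp (- t) else 1)"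
        by (intro prod.cong refl) (simp add: ind_def)
      finally show ?thesis .
    qed
    then have "bexp ?U p (\<lambda>S. exp (t * (\<delta> - (\<Sum>u\<in>{1..n} - F. ind S (insert u F))))) =
       exp (t * \<delta>) * bexp ?U p (\<lambda>S. \<Prod>u\<in>{1..n} - F. if insert u F \<in> S then exp (- t) else 1)"
      by (simp only: bexp_cmult)
    also have "bexp ?U p (\<lambda>S. \<Prod>u\<in>{1..n} - F. if insert u F \<in> S then exp (- t) else 1) =
        (\<Prod>u\<in>{1..n} - F. p * exp (- t) + (1 - p) * 1)"
    proof -
      have "inj_on (\<lambda>u. insert u F) ({1..n} - F)" by (auto simp: inj_on_def)
      moreover have "(\<lambda>u. insert u F) ` ({1..n} - F) \<subseteq> ?U" using F' by (auto simp: LM_cands_def)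
      ultimately show ?thesis
        using bexp_prod_image[OF finite_LM_cands, of "\<lambda>u. insert u F" "{1..n} - F" k n p
            "\<lambda>_ b. if b then exp (- t) else 1"] by simp
    qed
    also have "\<dots> = (1 + - (p * (1 - exp (- t)))) ^ (n - k)"
      unfolding prod_constant card by (simp add: algebra_simps)
    also have "\<dots> \<le> exp (- (p * (1 - exp (- t)))) ^ (n - k)"
    proof (rule power_mono)
      show "1 + - (p * (1 - exp (- t))) \<le> exp (- (p * (1 - exp (- t))))"
        by (rule exp_ge_add_one_self)
      have "1 + - (p * (1 - exp (- t))) = (1 - p) + p * exp (- t)" by (simp add: algebra_simps)
      moreover have "0 \<le> (1 - p) + p * exp (- t)"
        using p by (intro add_nonneg_nonneg mult_nonneg_nonneg) auto
      ultimately show "0 \<le> 1 + - (p * (1 - exp (- t)))" by (simp only:)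
    qed
    also have "exp (t * \<delta>) * exp (- (p * (1 - exp (- t)))) ^ (n - k) =
        exp (t * \<delta> - p * real (n - k) * (1 - exp (- t)))"
      unfolding exp_of_nat_mult[symmetric] exp_add[symmetric]
      by (rule arg_cong[of _ _ exp]) (simp add: algebra_simps)
    finally show ?thesis by simp
  qed
  then have "bexp ?U p (deg_fail k n t \<delta>) \<le>
      (\<Sum>F\<in>ksub {1..n} k. exp (t * \<delta> - p * real (n - k) * (1 - exp (- t))))"
    unfolding deg_fail_def[abs_def] bexp_sum by (rule sum_mono)
  also have "\<dots> = real (n choose k) * exp (t * \<delta> - p * real (n - k) * (1 - exp (- t)))"
    by (simp add: card_ksub)
  also have "\<dots> \<le> real n ^ k * exp (t * \<delta> - p * real (n - k) * (1 - exp (- t)))"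
  proof (rule mult_right_mono)
    have "n choose k \<le> n ^ k" using k by (rule binomial_le_pow)
    then show "real (n choose k) \<le> real n ^ k" by (metis of_nat_le_iff of_nat_power)
  qed auto
  finally show ?thesis .
qed

section \<open>Choice of the exponent and of the constants\<close>

lemma power_of_two_between:
  fixes x :: real assumes "x \<ge> 1"
  obtains j where "x \<le> 2 ^ j" "2 ^ j \<le> 2 * x"
proof -
  define j where "j = (LEAST j. x \<le> 2 ^ j)"
  obtain j0 where "x < 2 ^ j0" using real_arch_pow[of 2 x] by auto
  then have j: "x \<le> 2 ^ j" using LeastI[of "\<lambda>j. x \<le> 2 ^ j" j0] by (simp add: j_def)
  have "2 ^ j \<le> 2 * x"
  proof (cases j)
    case 0
    then show ?thesis using assms by simp
  next
    case (Suc i)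
    then have "\<not> x \<le> 2 ^ i" using not_less_Least[of i "\<lambda>j. x \<le> 2 ^ j"] by (simp add: j_def)
    then show ?thesis using Suc by simp
  qed
  with j show thesis by (rule that)
qed

lemma norm_event:
  fixes c \<gamma> :: real
  assumes k: "k \<ge> 2" and c: "c \<ge> 0" and \<gamma>: "\<gamma> > 0"
  shows "\<exists>C0 > 0. \<forall>n p. n \<ge> 2 * k \<longrightarrow> ln (real n) \<ge> 1 \<longrightarrow> \<gamma> * ln (real n) \<ge> 1 \<longrightarrow>
      \<gamma> * ln (real n) / real n \<le> p \<longrightarrow> p \<le> 1 \<longrightarrow>
      (\<exists>j \<tau>. \<tau> > 0 \<and> bexp (LM_cands k n) p (norm_fail k n p \<tau> (2 ^ j)) \<le> real n powr (- c - 1) \<and>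
        sqrt \<tau> * real k \<le> C0 * sqrt (p * real (n - k)))"
proof -
  \<comment> \<open>With this factor \<open>a * (p * n)\<close> dominates both \<open>p * n\<close>
    and \<open>ln n\<close>.\<close>
  define a where "a = max 1 (1 / \<gamma>)"
  \<comment> \<open>Chosen so that \<open>k - b = - c - 1\<close>; the spare factor
    \<open>1 / n\<close> leaves room for the failure of the degree bound.\<close>
  define b where "b = real k + c + 1"
  define T where "T = 8 * exp (32 + K1 + b)"
  \<comment> \<open>The 4 combines the rounding to a power of two with the comparison of
    \<open>n\<close> and \<open>n - k\<close>.\<close>
  define C0 where "C0 = sqrt (4 * T * a) * real k"
  have a: "a \<ge> 1" "a * \<gamma> \<ge> 1" using \<gamma> by (auto simp: a_def max_def field_simps)
  have T: "T > 0" by (simp add: T_def)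
  have "C0 > 0" using a T k by (simp add: C0_def)
  moreover have "\<exists>j \<tau>. \<tau> > 0 \<and> bexp (LM_cands k n) p (norm_fail k n p \<tau> (2 ^ j)) \<le> real n powr (- c - 1) \<and>
        sqrt \<tau> * real k \<le> C0 * sqrt (p * real (n - k))"
    if n: "n \<ge> 2 * k" and ln1: "ln (real n) \<ge> 1" and \<gamma>ln: "\<gamma> * ln (real n) \<ge> 1"
      and p: "\<gamma> * ln (real n) / real n \<le> p" "p \<le> 1" for n p
  proof -
    have n0: "real n > 0" using n k by simp
    have pn: "\<gamma> * ln (real n) \<le> p * real n" using p(1) n0 by (simp add: field_simps)
    then have pn1: "1 \<le> p * real n" using \<gamma>ln by linarith
    have p0: "p > 0"
    proof (rule ccontr)
      assume "\<not> p > 0"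
      then have "p * real n \<le> 0" using n0 by (intro mult_nonpos_nonneg) auto
      then show False using pn1 by linarith
    qed
    let ?x = "a * (p * real n)"
    have x1: "p * real n \<le> ?x" using mult_right_mono[of 1 a "p * real n"] a(1) pn1 by simp
    have x2: "ln (real n) \<le> ?x"
    proof -
      have "1 * ln (real n) \<le> (a * \<gamma>) * ln (real n)" using a(2) ln1 by (intro mult_right_mono) auto
      also have "\<dots> = a * (\<gamma> * ln (real n))" by simp
      also have "\<dots> \<le> ?x" using pn a(1) by (intro mult_left_mono) auto
      finally show ?thesis by simp
    qed
    obtain j where j: "?x \<le> 2 ^ j" "2 ^ j \<le> 2 * ?x"
      using power_of_two_between[of ?x] x1 pn1 by auto
    define q :: nat where "q = 2 ^ j"
    define \<tau> where "\<tau> = T * real q"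
    have q: "?x \<le> real q" "real q \<le> 2 * ?x" using j by (auto simp: q_def)
    have "q > 0" by (simp add: q_def)
    then have \<tau>0: "\<tau> > 0" using T by (simp add: \<tau>_def)
    have "bexp (LM_cands k n) p (norm_fail k n p \<tau> q) \<le> real n powr (real k - b)"
      by (rule norm_fail_expectation)
        (use k n p p0 pn1 order_trans[OF x1 q(1)] order_trans[OF x2 q(1)] c n0 in
          \<open>auto simp: b_def \<tau>_def T_def\<close>)
    moreover have "real k - b = - c - 1" by (simp add: b_def)
    moreover have "sqrt \<tau> * real k \<le> C0 * sqrt (p * real (n - k))"
    proof -
      have "p * real n \<le> p * (2 * real (n - k))"
        using p0 n by (intro mult_left_mono) (auto simp: of_nat_diff)
      then have "\<tau> \<le> T * (2 * (a * (2 * (p * real (n - k)))))"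
        unfolding \<tau>_def using q(2) T a(1)
        by (intro mult_left_mono order_trans[OF q(2)]) auto
      then have "\<tau> \<le> 4 * T * a * (p * real (n - k))" by (simp add: mult_ac)
      then have "sqrt \<tau> \<le> sqrt (4 * T * a) * sqrt (p * real (n - k))"
        unfolding real_sqrt_mult[symmetric] by (rule real_sqrt_le_mono)
      then have "sqrt \<tau> * real k \<le> sqrt (4 * T * a) * sqrt (p * real (n - k)) * real k"
        by (intro mult_right_mono) auto
      then show ?thesis by (simp add: C0_def mult_ac)
    qed
    ultimately show ?thesis using \<tau>0 unfolding q_def by (intro exI[of _ j] exI[of _ \<tau>]) simp
  qed
  ultimately show ?thesis by (intro exI[of _ C0] conjI allI impI)
qed

lemma eventually_ln_ge: "\<exists>N. \<forall>n\<ge>N. M \<le> ln (real n)"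
proof -
  have "filterlim (\<lambda>n. ln (real n)) at_top sequentially"
    by (rule filterlim_compose[OF ln_at_top filterlim_real_sequentially])
  then show ?thesis by (simp add: filterlim_at_top eventually_sequentially)
qed

theorem theorem1p2:
  fixes k :: nat and c \<gamma> :: real
  assumes "k \<ge> 2" and "c > 0" and "\<gamma> > c"
  shows "\<exists>C > 0. \<exists>N0. \<forall>n \<ge> N0. \<forall>p :: real. 0 \<le> p \<and> p \<le> 1 \<longrightarrow>
    (let d = p * real (n - k); \<gamma>A = C * sqrt d; \<gamma>D = C / sqrt d in
      (p \<ge> (real k + \<gamma>) * ln (real n) / real n \<longrightarrow>
         LM_prob k n p (\<lambda>X. spec_A k n d \<gamma>A X \<and> spec_L k n \<gamma>D X) \<ge> 1 - real n powr (- c)) \<and>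
      (p \<ge> \<gamma> * ln (real n) / real n \<longrightarrow>
         LM_prob k n p (\<lambda>X. spec_A k n d \<gamma>A X) \<ge> 1 - real n powr (- c)))"
proof -
  have k: "k \<ge> 2" and c0: "c \<ge> 0" and \<gamma>: "\<gamma> > 0" and k\<gamma>: "real k + \<gamma> > 0" using assms by auto
  from norm_event[OF k c0 \<gamma>] obtain C0 where C0: "C0 > 0" and event:
    "\<forall>n p. n \<ge> 2 * k \<longrightarrow> ln (real n) \<ge> 1 \<longrightarrow> \<gamma> * ln (real n) \<ge> 1 \<longrightarrow>
      \<gamma> * ln (real n) / real n \<le> p \<longrightarrow> p \<le> 1 \<longrightarrow>
      (\<exists>j \<tau>. \<tau> > 0 \<and> bexp (LM_cands k n) p (norm_fail k n p \<tau> (2 ^ j)) \<le> real n powr (- c - 1) \<and>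
        sqrt \<tau> * real k \<le> C0 * sqrt (p * real (n - k)))"
    by (elim exE conjE)
  \<comment> \<open>Two factors \<open>1 - \<eta>\<close> are lost, one in passing from
    \<open>n\<close> to \<open>n - k\<close> and one in the Chernoff exponent. This
    \<open>\<eta>\<close> keeps the exponent at least \<open>k\<close> plus the midpoint of
    \<open>c\<close> and \<open>\<gamma>\<close>.\<close>
  define \<eta> where "\<eta> = (\<gamma> - c) / (4 * (real k + \<gamma>))"
  have \<eta>: "\<eta> > 0" "\<eta> < 1" using assms k\<gamma> by (auto simp: \<eta>_def field_simps)
  have \<eta>2: "(real k + \<gamma>) * (1 - \<eta>) * (1 - \<eta>) \<ge> real k + (c + \<gamma>) / 2"
  proof -
    have "s * (x / (4 * s)) = x / 4" if "s > 0" for s x :: real using that by simp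
    from this[OF k\<gamma>] have "(real k + \<gamma>) * \<eta> = (\<gamma> - c) / 4" by (simp only: \<eta>_def)
    moreover have "(real k + \<gamma>) * (1 - 2 * \<eta>) = real k + \<gamma> - 2 * ((real k + \<gamma>) * \<eta>)"
      by (simp add: right_diff_distrib)
    ultimately have "real k + (c + \<gamma>) / 2 = (real k + \<gamma>) * (1 - 2 * \<eta>)" by simp
    also have "\<dots> \<le> (real k + \<gamma>) * ((1 - \<eta>) * (1 - \<eta>))"
      using k\<gamma> by (intro mult_left_mono) (auto simp: algebra_simps)
    finally show ?thesis by (simp add: mult.assoc)
  qed
  \<comment> \<open>Here \<open>exp (- t)\<close> is half of \<open>\<eta>\<close>, and
    \<open>t * \<epsilon>\<close> below is the other half; the Chernoff exponent becomes
    \<open>- d * (1 - \<eta>)\<close>.\<close>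
  define t where "t = ln (2 / \<eta>)"
  have t: "t > 0" "exp (- t) = \<eta> / 2" using \<eta> by (auto simp: t_def exp_minus)
  define \<epsilon> where "\<epsilon> = \<eta> / (2 * t)"
  have \<epsilon>: "\<epsilon> > 0" "t * \<epsilon> = \<eta> / 2" using \<eta> t by (auto simp: \<epsilon>_def)
  define CL where "CL = (real k + C0 + 2 * C0\<^sup>2) / \<epsilon>"
  define C where "C = real k + C0 + CL"
  have CL: "CL \<ge> 0" using \<epsilon> C0 by (simp add: CL_def)
  have C: "C > 0" using C0 CL by (simp add: C_def add_nonneg_pos add_pos_nonneg)
  \<comment> \<open>The second bound gives \<open>d \<ge> C\<^sup>2 + 1\<close> and hence
    \<open>C / sqrt d < 1\<close>, as needed for cohomology. The third makes the factor gained
    between \<open>c\<close> and \<open>\<gamma>\<close> at most 1/2, so that each failure term uses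
    half of \<open>n\<close> to the power \<open>- c\<close>.\<close>
  obtain N1 where N1: "\<And>n. n \<ge> N1 \<Longrightarrow>
      max 1 (max (2 / \<gamma> * (C\<^sup>2 + 1)) (2 * ln 2 / (\<gamma> - c))) \<le> ln (real n)"
    using eventually_ln_ge by blast
  \<comment> \<open>The last entry ensures \<open>k \<le> \<eta> * n\<close>, that is
    \<open>n - k \<ge> (1 - \<eta>) * n\<close>.\<close>
  define N0 where "N0 = max (max N1 (2 * k)) (nat \<lceil>real k / \<eta>\<rceil>)"
  have main: "(p \<ge> (real k + \<gamma>) * ln (real n) / real n \<longrightarrow>
         1 - real n powr (- c) \<le> LM_prob k n p (\<lambda>X. spec_A k n (p * real (n - k)) (C * sqrt (p * real (n - k))) X \<and>
           spec_L k n (C / sqrt (p * real (n - k))) X)) \<and>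
      (p \<ge> \<gamma> * ln (real n) / real n \<longrightarrow>
         1 - real n powr (- c) \<le> LM_prob k n p (\<lambda>X. spec_A k n (p * real (n - k)) (C * sqrt (p * real (n - k))) X))"
    if nN: "n \<ge> N0" and p: "0 \<le> p" "p \<le> 1" for n p
  proof -
    define d where "d = p * real (n - k)"
    have n: "n \<ge> 2 * k" "n \<ge> k" "n \<ge> 2" "real n > 0" using nN k by (auto simp: N0_def)
    have ln: "ln (real n) \<ge> 1" "2 / \<gamma> * (C\<^sup>2 + 1) \<le> ln (real n)" "2 * ln 2 / (\<gamma> - c) \<le> ln (real n)"
      using N1[of n] nN by (auto simp: N0_def)
    have "2 * (C\<^sup>2 + 1) \<le> \<gamma> * ln (real n)" using ln(2) \<gamma> by (simp add: field_simps)
    then have \<gamma>ln: "C\<^sup>2 + 1 \<le> \<gamma> * ln (real n) / 2" by simp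
    then have \<gamma>ln1: "\<gamma> * ln (real n) \<ge> 1" using zero_le_power2[of C] by linarith
    have "(\<gamma> - c) / 2 * ln (real n) \<ge> ln 2" using ln(3) assms by (simp add: field_simps)
    then have half: "real n powr (- ((\<gamma> - c) / 2)) \<le> 1 / 2"
    proof -
      have "real n \<noteq> 0" using n by simp
      then have "real n powr (- ((\<gamma> - c) / 2)) = exp (- ((\<gamma> - c) / 2 * ln (real n)))"
        by (simp only: powr_def if_False mult_minus_left)
      also have "\<dots> \<le> exp (- ln 2)" using \<open>(\<gamma> - c) / 2 * ln (real n) \<ge> ln 2\<close> by simp
      finally show ?thesis by (simp add: exp_minus)
    qed
    have nk: "real k \<le> \<eta> * real n"
    proof -
      have "real k / \<eta> \<le> real n" using nN unfolding N0_def by linarith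
      then show ?thesis using \<eta> by (simp add: field_simps)
    qed
    have weak: "\<gamma> * ln (real n) / real n \<le> (real k + \<gamma>) * ln (real n) / real n"
      using ln(1) n by (intro divide_right_mono mult_right_mono) auto
    have facts: "d \<ge> C\<^sup>2 + 1" if "\<gamma> * ln (real n) / real n \<le> p"
    proof -
      have "\<gamma> * ln (real n) \<le> p * real n" using that n by (simp add: field_simps)
      also have "\<dots> \<le> p * (2 * real (n - k))"
        using p n by (intro mult_left_mono) (auto simp: of_nat_diff)
      finally show ?thesis using \<gamma>ln unfolding d_def by linarith
    qed
    have nc: "real n powr (- c - 1) \<le> real n powr (- c) / 2"
    proof -
      have "real n powr (- c - 1) = real n powr (- c) / real n"
        using n by (simp add: powr_diff)
      also have "\<dots> \<le> real n powr (- c) / 2" using n by (intro divide_left_mono) auto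
      finally show ?thesis .
    qed
    have complex: "concentrated_complex n k p (sqrt \<tau> * real k) S"
      if "S \<subseteq> LM_cands k n" "\<tau> > 0" "norm_fail k n p \<tau> (2 ^ j) S < 1" for S \<tau> j
    proof
      show "\<bar>wform {1..n} k (\<lambda>H. ind S H - p) f g\<bar>
        \<le> sqrt \<tau> * real k * sqrt (ip (ksub {1..n} k) f f) * sqrt (ip (ksub {1..n} k) g g)" for f g
        by (rule norm_fail_small_imp_bound[OF _ refl]) (use k that in auto)
    qed (use k n p that in auto)
    have spec_A: "spec_A k n d (C * sqrt d) (LM_complex k n S)"
      if S: "S \<subseteq> LM_cands k n" "\<tau> > 0" "norm_fail k n p \<tau> (2 ^ j) S < 1"
        and \<kappa>: "sqrt \<tau> * real k \<le> C0 * sqrt d" and dC: "d \<ge> C\<^sup>2 + 1" for S \<tau> j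
    proof -
      have "1 \<le> d" using dC zero_le_power2[of C] by linarith
      then have "sqrt d \<ge> 1" by (rule real_sqrt_ge_1_iff[THEN iffD2])
      then have "real k * 1 \<le> real k * sqrt d" by (rule mult_left_mono) simp
      moreover have "0 \<le> CL * sqrt d" using CL \<open>1 \<le> d\<close> by simp
      ultimately have *: "real k + sqrt \<tau> * real k \<le> C * sqrt d"
        using \<kappa> by (simp add: C_def distrib_right)
      interpret cc: concentrated_complex n k p "sqrt \<tau> * real k" S by (rule complex[OF S])
      from cc.spec_A_holds[OF *] show ?thesis by (simp only: cc.d_def cc.X_def d_def)
    qed
    have spec_L: "spec_L k n (C / sqrt d) (LM_complex k n S)"
      if S: "S \<subseteq> LM_cands k n" "\<tau> > 0" "norm_fail k n p \<tau> (2 ^ j) S < 1"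
        and \<kappa>: "sqrt \<tau> * real k \<le> C0 * sqrt d" and dC: "d \<ge> C\<^sup>2 + 1"
        and deg: "deg_fail k n t (\<epsilon> * d) S < 1" for S \<tau> j
    proof -
      let ?\<kappa> = "sqrt \<tau> * real k"
      have d0: "d > 0" using dC zero_le_power2[of C] by linarith
      define s where "s = sqrt d"
      have s: "s > 0" "s * s = d" using d0 by (auto simp: s_def)
      have "1 \<le> d" using dC zero_le_power2[of C] by linarith
      then have s1: "s \<ge> 1" unfolding s_def by (rule real_sqrt_ge_1_iff[THEN iffD2])
      have sC: "C < s"
      proof -
        have "C\<^sup>2 < s\<^sup>2" using dC s by (simp add: power2_eq_square)
        then show ?thesis using s(1) C by (simp add: power_less_imp_less_base)
      qed
      have "concentrated_complex_degree n k p ?\<kappa> S (\<epsilon> * d) (C / sqrt d)"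
      proof (rule concentrated_complex_degree.intro[OF complex[OF S]], unfold_locales)
        show "0 < p * real (n - k)" using d0 unfolding d_def .
        show "0 < \<epsilon> * d" using \<epsilon>(1) d0 by (rule mult_pos_pos)
        show "\<epsilon> * d \<le> real (Defs.deg (LM_complex k n S) k F)" if "F \<in> ksub {1..n} k" for F
          by (rule deg_fail_small_imp[OF S(1) t(1) deg that])
        have \<kappa>2: "?\<kappa>\<^sup>2 \<le> C0\<^sup>2 * d"
        proof -
          have "?\<kappa>\<^sup>2 \<le> (C0 * s)\<^sup>2" using \<kappa> S(2) unfolding s_def by (intro power_mono) auto
          also have "(C0 * s)\<^sup>2 = C0\<^sup>2 * d" unfolding s(2)[symmetric] by (simp add: power2_eq_square)
          finally show ?thesis .
        qed
        have "2 * ?\<kappa>\<^sup>2 / d \<le> 2 * (C0\<^sup>2 * d) / d"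
          using \<kappa>2 d0 by (intro divide_right_mono mult_left_mono) auto
        also have "\<dots> = 2 * C0\<^sup>2 * 1" using d0 by simp
        also have "\<dots> \<le> 2 * C0\<^sup>2 * s" using s1 by (intro mult_left_mono) auto
        finally have "2 * ?\<kappa>\<^sup>2 / d \<le> 2 * C0\<^sup>2 * s" .
        moreover have "real k * 1 \<le> real k * s" using s1 by (intro mult_left_mono) auto
        ultimately have "real k + ?\<kappa> + 2 * ?\<kappa>\<^sup>2 / d \<le> (real k + C0 + 2 * C0\<^sup>2) * s"
          using \<kappa> unfolding s_def[symmetric] by (simp add: algebra_simps)
        then have "(real k + ?\<kappa> + 2 * ?\<kappa>\<^sup>2 / d) / (\<epsilon> * d) \<le> (real k + C0 + 2 * C0\<^sup>2) * s / (\<epsilon> * d)"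
          using \<epsilon> d0 by (intro divide_right_mono) auto
        also have "\<dots> = CL / s" using s \<epsilon> unfolding CL_def s(2)[symmetric] by simp
        also have "\<dots> \<le> C / s" using s C0 by (intro divide_right_mono) (auto simp: C_def)
        finally show "(real k + ?\<kappa> + 2 * ?\<kappa>\<^sup>2 / (p * real (n - k))) / (\<epsilon> * d) \<le> C / sqrt d"
          unfolding s_def d_def .
      qed
      then interpret cc: concentrated_complex_degree n k p ?\<kappa> S "\<epsilon> * d" "C / sqrt d" .
      have "C / sqrt d < 1" using sC s(1) unfolding s_def[symmetric] by simp
      from cc.spec_L_holds[OF this] show ?thesis by (simp only: cc.X_def)
    qed
    show ?thesis
      unfolding d_def[symmetric]
    proof (intro conjI impI)
      assume pk: "(real k + \<gamma>) * ln (real n) / real n \<le> p"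
      then have p\<gamma>: "\<gamma> * ln (real n) / real n \<le> p" using weak by linarith
      obtain j \<tau> where j: "\<tau> > 0"
        "bexp (LM_cands k n) p (norm_fail k n p \<tau> (2 ^ j)) \<le> real n powr (- c - 1)"
        "sqrt \<tau> * real k \<le> C0 * sqrt d"
        using event[rule_format, OF n(1) ln(1) \<gamma>ln1 p\<gamma> p(2), folded d_def] by blast
      let ?B = "\<lambda>S. norm_fail k n p \<tau> (2 ^ j) S + deg_fail k n t (\<epsilon> * d) S"
      have nn: "0 \<le> norm_fail k n p \<tau> (2 ^ j) S" "0 \<le> deg_fail k n t (\<epsilon> * d) S" for S
        using norm_fail_nonneg[OF _ j(1)] by (auto simp: deg_fail_def intro: sum_nonneg)
      have "1 - bexp (LM_cands k n) p ?B \<le> LM_prob k n p (\<lambda>X. spec_A k n d (C * sqrt d) X \<and>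
           spec_L k n (C / sqrt d) X)"
      proof (rule LM_prob_ge[OF p])
        fix S assume S: "S \<subseteq> LM_cands k n"
        show "0 \<le> ?B S" using nn[of S] by linarith
        assume "?B S < 1"
        then have "norm_fail k n p \<tau> (2 ^ j) S < 1" "deg_fail k n t (\<epsilon> * d) S < 1"
          using nn[of S] by linarith+
        then show "spec_A k n d (C * sqrt d) (LM_complex k n S) \<and> spec_L k n (C / sqrt d) (LM_complex k n S)"
          using spec_A[OF S j(1) _ j(3) facts[OF p\<gamma>]] spec_L[OF S j(1) _ j(3) facts[OF p\<gamma>]] by blast
      qed
      moreover have "bexp (LM_cands k n) p ?B \<le> real n powr (- c)"
      proof -
        have "bexp (LM_cands k n) p (deg_fail k n t (\<epsilon> * d))
            \<le> real n ^ k * exp (t * (\<epsilon> * d) - d * (1 - exp (- t)))"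
          unfolding d_def using n p by (intro deg_fail_expectation)
        also have "t * (\<epsilon> * d) - d * (1 - exp (- t)) = - (d * (1 - \<eta>))"
        proof -
          have "t * (\<epsilon> * d) = (t * \<epsilon>) * d" by simp
          then show ?thesis unfolding t(2) \<epsilon>(2) by (simp add: field_simps)
        qed
        \<comment> \<open>Both losses meet here: \<open>d\<close> is at least
          \<open>(1 - \<eta>) * p * n\<close>, and the exponent carries a second factor
          \<open>1 - \<eta>\<close>.\<close>
        also have "exp (- (d * (1 - \<eta>))) \<le> exp (- ((real k + (c + \<gamma>) / 2) * ln (real n)))"
        proof -
          have "(real k + \<gamma>) * ln (real n) * (1 - \<eta>) \<le> p * real n * (1 - \<eta>)"
            using pk n \<eta> by (intro mult_right_mono) (auto simp: field_simps)
          also have "\<dots> \<le> d"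
          proof -
            have "p * (real n * (1 - \<eta>)) \<le> p * real (n - k)"
              using nk n p by (intro mult_left_mono) (auto simp: of_nat_diff algebra_simps)
            then show ?thesis by (simp add: d_def mult.assoc)
          qed
          finally have "(real k + \<gamma>) * ln (real n) * (1 - \<eta>) * (1 - \<eta>) \<le> d * (1 - \<eta>)"
            using \<eta> by (intro mult_right_mono) auto
          moreover have "(real k + (c + \<gamma>) / 2) * ln (real n)
              \<le> (real k + \<gamma>) * (1 - \<eta>) * (1 - \<eta>) * ln (real n)"
            using \<eta>2 ln(1) by (intro mult_right_mono) auto
          ultimately have "(real k + (c + \<gamma>) / 2) * ln (real n) \<le> d * (1 - \<eta>)"
            by (simp add: mult_ac)
          then show ?thesis by simp
        qed
        also have "real n ^ k * exp (- ((real k + (c + \<gamma>) / 2) * ln (real n))) =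
            real n powr (- c) * real n powr (- ((\<gamma> - c) / 2))"
        proof -
          have "real n \<noteq> 0" using n by simp
          then have "exp (- ((real k + (c + \<gamma>) / 2) * ln (real n))) = real n powr (- (real k + (c + \<gamma>) / 2))"
            by (simp only: powr_def if_False mult_minus_left)
          moreover have "real n ^ k = real n powr (real k)" using n by (simp add: powr_realpow)
          moreover have "real k + - (real k + (c + \<gamma>) / 2) = - c + - ((\<gamma> - c) / 2)" by (simp add: field_simps)
          ultimately show ?thesis by (simp only: powr_add[symmetric])
        qed
        also have "\<dots> \<le> real n powr (- c) * (1 / 2)" using half by (intro mult_left_mono) auto
        finally have "bexp (LM_cands k n) p (deg_fail k n t (\<epsilon> * d)) \<le> real n powr (- c) / 2"
          by (simp add: mult_left_mono)
        then show ?thesis using j(2) nc unfolding bexp_add by linarith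
      qed
      ultimately show "1 - real n powr (- c) \<le> LM_prob k n p (\<lambda>X. spec_A k n d (C * sqrt d) X \<and>
           spec_L k n (C / sqrt d) X)" by linarith
    next
      assume p\<gamma>: "\<gamma> * ln (real n) / real n \<le> p"
      obtain j \<tau> where j: "\<tau> > 0"
        "bexp (LM_cands k n) p (norm_fail k n p \<tau> (2 ^ j)) \<le> real n powr (- c - 1)"
        "sqrt \<tau> * real k \<le> C0 * sqrt d"
        using event[rule_format, OF n(1) ln(1) \<gamma>ln1 p\<gamma> p(2), folded d_def] by blast
      have "1 - bexp (LM_cands k n) p (norm_fail k n p \<tau> (2 ^ j))
          \<le> LM_prob k n p (\<lambda>X. spec_A k n d (C * sqrt d) X)"
        by (rule LM_prob_ge[OF p norm_fail_nonneg[OF _ j(1)]])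
          (use spec_A[OF _ j(1) _ j(3) facts[OF p\<gamma>]] in auto)
      moreover have "0 \<le> real n powr (- c)" by simp
      ultimately show "1 - real n powr (- c) \<le> LM_prob k n p (\<lambda>X. spec_A k n d (C * sqrt d) X)"
        using j(2) nc by linarith
    qed
  qed
  show ?thesis
    unfolding Let_def by (intro exI[of _ C] exI[of _ N0] conjI C allI impI) (use main in auto)
qed

end
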